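(* Assuming the Intermediate Hypothesis, for any non-trivial parameter setting $(\tau,\xi,\sigma)$ there is a constant $\rho \ge 1$ such that for any $\varepsilon > 0$ the problem Subset Sum$^\rho(\tau,\xi,\sigma)$ cannot be solved in time $O\big((\max(X)\,\Sigma(X)/(n t))^{1-\varepsilon}\big) = O\big(n^{(\xi+\sigma-\tau-1)(1-\varepsilon)}\big)$.
   Context: Subset Sum: given a set $X$ of $n$ positive integers and a target $t$, decide whether some subset of $X$ sums to $t$. $\max(X)$ denotes the maximum element of $X$ and $\Sigma(X)$ the sum of all elements of $X$. A parameter setting is a tuple $(\tau,\xi,\sigma)\in\mathbb{R}^3$; it is non-trivial if $\sigma \ge 2$ and $1 \le \xi \le \tau \le \sigma \le 1+\xi$. For a constant $\rho\ge 1$, Subset Sum$^\rho(\tau,\xi,\sigma)$ is the set of all Subset Sum instances $(X,t)$ (with $X$ a set) for which $t/|X|^\tau$, $\max(X)/|X|^\xi$, and $\Sigma(X)/|X|^\sigma$ all lie in $[1/\rho,\rho]$. $k$-Sum: given a set $Z\subseteq\{1,\dots,U\}$ of $N$ integers and a target $T$, decide whether there exist $z_1,\dots,z_k\in Z$ with $z_1+\dots+z_k=T$. Intermediate Hypothesis: for any constants $\alpha,\varepsilon>0$ there exists a constant $k\ge 3$ such that $k$-Sum restricted to $N \le U^\alpha$ cannot be solved in time $O(U^{1-\varepsilon})$. *)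

theory Defs
  imports Complex_Main "HOL-Library.Discrete_Functions" "HOL-Library.Landau_Symbols"
begin

section \<open>Word RAM\<close>

text \<open>
  Deterministic word RAM with \<open>w\<close>-bit words: registers and a memory of words, both indexed by
  natural numbers, unit-cost arithmetic modulo \<open>2 ^ w\<close>, unit-cost indirect memory access.
  Programs are given in structured form; a program mentions finitely many registers. Word values
  are natural numbers below \<open>2 ^ w\<close>.
\<close>

datatype binop = Add | Sub | Mul | Div | Mod | BitAnd | BitOr | BitXor | Shl | Shr | Eq | Less

fun binop_val :: "nat \<Rightarrow> binop \<Rightarrow> nat \<Rightarrow> nat \<Rightarrow> nat" where
  "binop_val w Add a b = (a + b) mod 2 ^ w"
| "binop_val w Sub a b = (a + 2 ^ w - b) mod 2 ^ w"
| "binop_val w Mul a b = (a * b) mod 2 ^ w"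
| "binop_val w Div a b = (a div b) mod 2 ^ w"
| "binop_val w Mod a b = (a mod b) mod 2 ^ w"
| "binop_val w BitAnd a b = Bit_Operations.and a b mod 2 ^ w"
| "binop_val w BitOr a b = Bit_Operations.or a b mod 2 ^ w"
| "binop_val w BitXor a b = Bit_Operations.xor a b mod 2 ^ w"
| "binop_val w Shl a b = (a * 2 ^ b) mod 2 ^ w"
| "binop_val w Shr a b = (a div 2 ^ b) mod 2 ^ w"
| "binop_val w Eq a b = of_bool (a = b) mod 2 ^ w"
| "binop_val w Less a b = of_bool (a < b) mod 2 ^ w"

text \<open>
  Arguments of type \<^typ>\<open>nat\<close> are register names, except for the constant in \<open>Const\<close>.
  \<open>Load r a\<close> reads the memory cell addressed by register \<open>a\<close> into register \<open>r\<close>;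
  \<open>Store a r\<close> writes register \<open>r\<close> to that cell.
\<close>

datatype com =
    Skip
  | Const nat nat
  | Op binop nat nat nat
  | Load nat nat
  | Store nat nat
  | Seq com com
  | Cond nat com com
  | While nat com

type_synonym state = "(nat \<Rightarrow> nat) \<times> (nat \<Rightarrow> nat)"

text \<open>
  \<open>exec w p s n s'\<close>: with word length \<open>w\<close>, program \<open>p\<close> started in state \<open>s\<close> (registers, memory)
  halts after exactly \<open>n\<close> steps in state \<open>s'\<close>. Every instruction and every test costs one step.
\<close>

inductive exec :: "nat \<Rightarrow> com \<Rightarrow> state \<Rightarrow> nat \<Rightarrow> state \<Rightarrow> bool" for w :: nat where
  Skip: "exec w Skip s 1 s"
| Const: "exec w (Const r v) (R, M) 1 (R(r := v mod 2 ^ w), M)"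
| Op: "exec w (Op f r a b) (R, M) 1 (R(r := binop_val w f (R a) (R b)), M)"
| Load: "exec w (Load r a) (R, M) 1 (R(r := M (R a)), M)"
| Store: "exec w (Store a r) (R, M) 1 (R, M(R a := R r))"
| Seq: "exec w p s m s' \<Longrightarrow> exec w q s' n s'' \<Longrightarrow> exec w (Seq p q) s (m + n) s''"
| CondTrue: "fst s r \<noteq> 0 \<Longrightarrow> exec w p s n s' \<Longrightarrow> exec w (Cond r p q) s (Suc n) s'"
| CondFalse: "fst s r = 0 \<Longrightarrow> exec w q s n s' \<Longrightarrow> exec w (Cond r p q) s (Suc n) s'"
| WhileTrue: "fst s r \<noteq> 0 \<Longrightarrow> exec w p s m s' \<Longrightarrow> exec w (While r p) s' n s'' \<Longrightarrow>
    exec w (While r p) s (Suc (m + n)) s''"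
| WhileFalse: "fst s r = 0 \<Longrightarrow> exec w (While r p) s 1 s"

definition init_state :: "nat list \<Rightarrow> state" where
  "init_state xs = (\<lambda>_. 0, \<lambda>a. if a < length xs then xs ! a else 0)"

definition accepting :: "state \<Rightarrow> bool" where
  "accepting s \<longleftrightarrow> fst s 0 \<noteq> 0"

text \<open>
  Words have \<open>c\<close> times as many bits as are needed to write down every input number and the
  length of the input; the constant \<open>c\<close> may depend on the algorithm.
\<close>

definition word_length :: "nat \<Rightarrow> nat list \<Rightarrow> nat" where
  "word_length c xs = c * (floor_log (Max (set (length xs # xs))) + 1)"

text \<open>
  A problem is given by its instances \<open>I\<close>, the admissible encodings \<open>enc i\<close> of each instance
  (the algorithm has to handle all of them), and its yes-instances. The instances are solved in
  time \<open>O(T)\<close>, where \<open>T\<close> depends on the instance.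
\<close>

definition solvable_in_time ::
    "'i set \<Rightarrow> ('i \<Rightarrow> nat list set) \<Rightarrow> ('i \<Rightarrow> bool) \<Rightarrow> ('i \<Rightarrow> real) \<Rightarrow> bool" where
  "solvable_in_time I enc yes T \<longleftrightarrow>
    (\<exists>p c C. 0 < c \<and> 0 < C \<and>
      (\<forall>i\<in>I. \<forall>xs\<in>enc i. \<exists>n s.
        exec (word_length c xs) p (init_state xs) n s \<and> real n \<le> C * T i \<and>
        (accepting s \<longleftrightarrow> yes i)))"


section \<open>k-Sum\<close>

text \<open>An instance is a triple \<open>(Z, T, U)\<close>.\<close>

type_synonym ksum_instance = "nat set \<times> nat \<times> nat"

definition ksum_instances :: "real \<Rightarrow> ksum_instance set" where
  "ksum_instances \<alpha> = {(Z, T, U). 1 \<le> U \<and> Z \<subseteq> {1..U} \<and> real (card Z) \<le> real U powr \<alpha>}"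

definition ksum_yes :: "nat \<Rightarrow> ksum_instance \<Rightarrow> bool" where
  "ksum_yes k = (\<lambda>(Z, T, U). \<exists>zs. length zs = k \<and> set zs \<subseteq> Z \<and> sum_list zs = T)"

definition ksum_encodings :: "ksum_instance \<Rightarrow> nat list set" where
  "ksum_encodings = (\<lambda>(Z, T, U). {[U, T, card Z] @ zs |zs. distinct zs \<and> set zs = Z})"

definition intermediate_hypothesis :: bool where
  "intermediate_hypothesis \<longleftrightarrow>
    (\<forall>\<alpha>>0. \<forall>\<epsilon>>0. \<exists>k\<ge>3.
      \<not> solvable_in_time (ksum_instances \<alpha>) ksum_encodings (ksum_yes k)
          (\<lambda>(Z, T, U). real U powr (1 - \<epsilon>)))"


section \<open>Subset Sum\<close>

type_synonym subset_sum_instance = "nat set \<times> nat"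

definition subset_sum_instances :: "subset_sum_instance set" where
  "subset_sum_instances = {(X, t). finite X \<and> (\<forall>x\<in>X. 0 < x)}"

definition subset_sum_yes :: "subset_sum_instance \<Rightarrow> bool" where
  "subset_sum_yes = (\<lambda>(X, t). \<exists>Y\<subseteq>X. \<Sum>Y = t)"

definition subset_sum_encodings :: "subset_sum_instance \<Rightarrow> nat list set" where
  "subset_sum_encodings = (\<lambda>(X, t). {[t, card X] @ xs |xs. distinct xs \<and> set xs = X})"

definition nontrivial_setting :: "real \<Rightarrow> real \<Rightarrow> real \<Rightarrow> bool" where
  "nontrivial_setting \<tau> \<xi> \<sigma> \<longleftrightarrow> 2 \<le> \<sigma> \<and> 1 \<le> \<xi> \<and> \<xi> \<le> \<tau> \<and> \<tau> \<le> \<sigma> \<and> \<sigma> \<le> 1 + \<xi>"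

text \<open>
  For \<open>\<rho> \<ge> 1\<close> the empty set never qualifies, since \<open>0 powr \<tau> = 0\<close> and \<open>t / 0 = 0 < 1 / \<rho>\<close>.
\<close>

definition subset_sum_class :: "real \<Rightarrow> real \<Rightarrow> real \<Rightarrow> real \<Rightarrow> subset_sum_instance set" where
  "subset_sum_class \<rho> \<tau> \<xi> \<sigma> =
    {(X, t) \<in> subset_sum_instances.
      real t / real (card X) powr \<tau> \<in> {1 / \<rho>..\<rho>} \<and>
      real (Max X) / real (card X) powr \<xi> \<in> {1 / \<rho>..\<rho>} \<and>
      real (\<Sum>X) / real (card X) powr \<sigma> \<in> {1 / \<rho>..\<rho>}}"

end

theory Submission
  imports Defs
begin

text \<open>
  Write \<open>e = \<xi> + \<sigma> - \<tau> - 1\<close>. On the class both time bounds agree up to constant factors.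

  If \<open>e \<le> 1\<close>, the bound is sublinear in \<open>n\<close> and an adversary argument suffices: for even numbers and an
  odd target, some cell that is never read can be replaced by the number 1 so that the answer changes.

  If \<open>e > 1\<close>, k-Sum reduces to Subset Sum. All numbers have the form \<open>d q + r\<close>: many pads with \<open>r = 0\<close>,
  a few huge fillers that force the right target and maximum, and items \<open>d (E + G j + z) + 1\<close> for
  \<open>z \<in> Z\<close> and \<open>j < \<kappa>\<close>. Residues modulo \<open>d\<close> count fillers and items, so a solution contains all
  fillers and exactly \<open>\<kappa>\<close> items; what remains of the target is smaller than every pad, so no pad is
  used and the chosen \<open>z\<close> sum to the k-Sum target.

  The exponents may be uncomputable, so no program can compute the sizes that put the instance into the
  class. The reduction therefore tries all powers of two for the sizes (polylogarithmically many),
  runs the assumed algorithm with a step limit in a fresh memory region, and trusts its answers only for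
  a greedy search: \<open>(\<kappa>, T)\<close> becomes \<open>(\<kappa> - 1, T - z)\<close> if the answer for the latter is positive.
  Reaching \<open>(0, 0)\<close> exhibits a solution, so wrong guesses do no harm, and the right guess succeeds.
\<close>

section \<open>Expressions and weakest preconditions\<close>

text \<open>The assumed algorithm runs with a word length determined by the largest number of its
  input, and a simulation has to use exactly that length. Hence all sizes are powers of two: the
  target dominates the instance, and its bit length becomes a linear expression in the guessed
  exponents. The algorithm also expects zeros behind its input; since a simulated run may leave
  garbage at unknown places, each round gets a memory region of its own instead of cleaning up, and
  words are made long enough to address all regions.

  Writing an instance takes time linear in \<open>n\<close>, so the reduction can only transfer time
  bounds that are at least linear; this is why \<open>e = 1\<close> separates the two cases.

  Up to constants, the instance has \<open>U powr (1 / (e - \<beta>))\<close> elements. The slack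
  \<open>\<beta>\<close> buys the factor \<open>\<phi>\<close> between fillers and items: the
  residue of one filler equals that of \<open>4 * \<phi>\<close> items, but these weigh about four
  fillers, so items cannot stand in for a missing filler.\<close>

datatype aexp = Lit nat | Reg nat | Bin binop aexp aexp | Mem aexp

text \<open>Contents of registers and memory are truncated because the machine has no move
  instruction: a copy is made by \<open>BitOr\<close> of a register with itself, which reduces
  modulo \<open>2 ^ w\<close>.\<close>

primrec aval :: "nat \<Rightarrow> aexp \<Rightarrow> state \<Rightarrow> nat" where
  "aval w (Lit v) s = v mod 2 ^ w"
| "aval w (Reg r) s = fst s r mod 2 ^ w"
| "aval w (Bin f a b) s = binop_val w f (aval w a s) (aval w b s)"
| "aval w (Mem a) s = snd s (aval w a s) mod 2 ^ w"

primrec cost :: "aexp \<Rightarrow> nat" where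
  "cost (Lit v) = 1"
| "cost (Reg r) = 1"
| "cost (Bin f a b) = cost a + (cost b + 1)"
| "cost (Mem a) = cost a + 2"

primrec regs_below :: "nat \<Rightarrow> aexp \<Rightarrow> bool" where
  "regs_below S (Lit v) \<longleftrightarrow> True"
| "regs_below S (Reg r) \<longleftrightarrow> r < S"
| "regs_below S (Bin f a b) \<longleftrightarrow> regs_below S a \<and> regs_below S b"
| "regs_below S (Mem a) \<longleftrightarrow> regs_below S a"

text \<open>The result goes to register \<open>r\<close>, and only registers from \<open>r\<close>
  on are overwritten; the second operand is evaluated at \<open>Suc r\<close>, so the first result
  survives.\<close>

primrec comp :: "nat \<Rightarrow> aexp \<Rightarrow> com" where
  "comp r (Lit v) = Const r v"
| "comp r (Reg x) = Op BitOr r x x"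
| "comp r (Bin f a b) = Seq (comp r a) (Seq (comp (Suc r) b) (Op f r r (Suc r)))"
| "comp r (Mem a) = Seq (comp r a) (Seq (Load r r) (Op BitOr r r r))"

lemma binop_val_less [simp]: "binop_val w f a b < 2 ^ w"
  by (cases f) auto

lemma aval_less [simp]: "aval w e s < 2 ^ w"
  by (cases e) auto

lemma sub_mod_power: "b \<le> a \<Longrightarrow> a < 2 ^ w \<Longrightarrow> (a + 2 ^ w - b) mod 2 ^ w = a - (b::nat)"
  by (metis add_diff_assoc2 less_imp_diff_less mod_add_self2 mod_less)

lemma aval_mod [simp]: "aval w e s mod 2 ^ w = aval w e s"
  by simp

lemma aval_cong: "regs_below S e \<Longrightarrow> (\<And>x. x < S \<Longrightarrow> fst s x = fst s' x) \<Longrightarrow> snd s = snd s' \<Longrightarrow>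
    aval w e s = aval w e s'"
  by (induction e) auto

lemma regs_below_mono: "regs_below S e \<Longrightarrow> S \<le> S' \<Longrightarrow> regs_below S' e"
  by (induction e) auto

lemma exec_compI:
  "exec w c s n (R', M) \<Longrightarrow> R' r = v \<Longrightarrow> (\<And>x. x < r \<Longrightarrow> R' x = R x) \<Longrightarrow>
    \<exists>R'. exec w c s n (R', M) \<and> R' r = v \<and> (\<forall>x<r. R' x = R x)"
  by blast

lemma exec_comp:
  assumes "regs_below r e"
  shows "\<exists>R'. exec w (comp r e) (R, M) (cost e) (R', M) \<and> R' r = aval w e (R, M) \<and> (\<forall>x<r. R' x = R x)"
  using assms
proof (induction e arbitrary: r R)
  case (Lit v)
  have "exec w (Const r v) (R, M) 1 (R(r := v mod 2 ^ w), M)"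
    by (rule exec.intros)
  then show ?case unfolding comp.simps cost.simps by (rule exec_compI) auto
next
  case (Reg x)
  have "exec w (Op BitOr r x x) (R, M) 1 (R(r := binop_val w BitOr (R x) (R x)), M)"
    by (rule exec.intros)
  then show ?case unfolding comp.simps cost.simps by (rule exec_compI) auto
next
  case (Bin f a b)
  obtain R1 where 1: "exec w (comp r a) (R, M) (cost a) (R1, M)" "R1 r = aval w a (R, M)"
    "\<forall>x<r. R1 x = R x"
    using Bin by force
  obtain R2 where 2: "exec w (comp (Suc r) b) (R1, M) (cost b) (R2, M)" "R2 (Suc r) = aval w b (R1, M)"
    "\<forall>x<Suc r. R2 x = R1 x"
    using Bin.IH(2)[of "Suc r" R1] Bin.prems regs_below_mono[of r b "Suc r"] by auto
  have b: "aval w b (R1, M) = aval w b (R, M)"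
    by (rule aval_cong[of r]) (use Bin.prems 1 in auto)
  have "exec w (comp r (Bin f a b)) (R, M) (cost (Bin f a b))
      (R2(r := binop_val w f (R2 r) (R2 (Suc r))), M)"
    unfolding comp.simps cost.simps by (rule exec.Seq[OF 1(1) exec.Seq[OF 2(1) exec.Op]])
  then show ?case by (rule exec_compI) (use 1 2 b in auto)
next
  case (Mem a)
  obtain R1 where 1: "exec w (comp r a) (R, M) (cost a) (R1, M)" "R1 r = aval w a (R, M)"
    "\<forall>x<r. R1 x = R x"
    using Mem by force
  define R2 where "R2 = R1(r := M (R1 r))"
  have "exec w (comp r (Mem a)) (R, M) (cost (Mem a)) (R2(r := binop_val w BitOr (R2 r) (R2 r)), M)"
    unfolding comp.simps cost.simps one_add_one[symmetric] R2_def
    by (rule exec.Seq[OF 1(1) exec.Seq[OF exec.Load exec.Op]])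
  then show ?case by (rule exec_compI) (use 1 in \<open>auto simp: R2_def\<close>)
qed

text \<open>
  Registers from \<open>S\<close> on are scratch space of compiled expressions; states are compared below \<open>S\<close> only.
  The postcondition also sees the number of steps.
\<close>

definition wp :: "nat \<Rightarrow> nat \<Rightarrow> com \<Rightarrow> (nat \<Rightarrow> state \<Rightarrow> bool) \<Rightarrow> state \<Rightarrow> bool" where
  "wp w S c Q s \<longleftrightarrow> (\<forall>R. (\<forall>x<S. R x = fst s x) \<longrightarrow>
     (\<exists>n R' s'. exec w c (R, snd s) n (R', snd s') \<and> (\<forall>x<S. R' x = fst s' x) \<and> Q n s'))"

lemma wp_execI:
  "exec w c (R, snd s) n (R', M') \<Longrightarrow> M' = snd s' \<Longrightarrow> (\<And>x. x < S \<Longrightarrow> R' x = fst s' x) \<Longrightarrow> Q n s' \<Longrightarrow>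
    \<exists>n R' s'. exec w c (R, snd s) n (R', snd s') \<and> (\<forall>x<S. R' x = fst s' x) \<and> Q n s'"
  by (intro exI conjI) auto

definition assign :: "nat \<Rightarrow> nat \<Rightarrow> aexp \<Rightarrow> com" where
  "assign S x e = Seq (comp S e) (Op BitOr x S S)"

definition store :: "nat \<Rightarrow> aexp \<Rightarrow> aexp \<Rightarrow> com" where
  "store S a e = Seq (comp S a) (Seq (comp (Suc S) e) (Store S (Suc S)))"

definition ifte :: "nat \<Rightarrow> aexp \<Rightarrow> com \<Rightarrow> com \<Rightarrow> com" where
  "ifte S e c1 c2 = Seq (comp S e) (Cond S c1 c2)"

text \<open>\<open>While\<close> tests a register, so the condition is evaluated once before the
  loop and again at the end of each pass.\<close>

definition loop :: "nat \<Rightarrow> aexp \<Rightarrow> com \<Rightarrow> com" where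
  "loop S e c = Seq (comp S e) (While S (Seq c (comp S e)))"

lemma wpE:
  assumes "wp w S c Q s" "\<forall>x<S. R x = fst s x"
  obtains n R' s' where "exec w c (R, snd s) n (R', snd s')" "\<forall>x<S. R' x = fst s' x" "Q n s'"
proof -
  from assms have "\<exists>n R' s'. exec w c (R, snd s) n (R', snd s') \<and> (\<forall>x<S. R' x = fst s' x) \<and> Q n s'"
    unfolding wp_def by simp
  with that show thesis by (elim exE conjE)
qed

lemma wpI:
  assumes "\<And>R. \<forall>x<S. R x = fst s x \<Longrightarrow>
    \<exists>n R' s'. exec w c (R, snd s) n (R', snd s') \<and> (\<forall>x<S. R' x = fst s' x) \<and> Q n s'"
  shows "wp w S c Q s"
  unfolding wp_def using assms by (intro allI impI)

lemma wp_mono: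
  assumes "wp w S c Q s" "\<And>n s'. Q n s' \<Longrightarrow> Q' n s'"
  shows "wp w S c Q' s"
proof (rule wpI)
  fix R assume R: "\<forall>x<S. R x = fst s x"
  obtain n R' s' where 1: "exec w c (R, snd s) n (R', snd s')" "\<forall>x<S. R' x = fst s' x" "Q n s'"
    by (rule wpE[OF assms(1) R])
  show "\<exists>n R' s'. exec w c (R, snd s) n (R', snd s') \<and> (\<forall>x<S. R' x = fst s' x) \<and> Q' n s'"
    by (rule wp_execI[OF 1(1) refl]) (use 1 assms(2) in auto)
qed

lemma wp_Skip: "Q 1 s \<Longrightarrow> wp w S Skip Q s"
  by (rule wpI, rule wp_execI[OF exec.Skip refl]) auto

lemma wp_Seq:
  assumes "wp w S c1 (\<lambda>n s'. wp w S c2 (\<lambda>n'. Q (n + n')) s') s"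
  shows "wp w S (Seq c1 c2) Q s"
  unfolding wp_def
proof (intro allI impI)
  fix R assume R: "\<forall>x<S. R x = fst s x"
  obtain n R1 s1 where 1: "exec w c1 (R, snd s) n (R1, snd s1)" "\<forall>x<S. R1 x = fst s1 x"
    "wp w S c2 (\<lambda>n'. Q (n + n')) s1"
    by (rule wpE[OF assms R])
  obtain n' R2 s2 where 2: "exec w c2 (R1, snd s1) n' (R2, snd s2)" "\<forall>x<S. R2 x = fst s2 x"
    "Q (n + n') s2"
    by (rule wpE[OF 1(3,2)])
  show "\<exists>n R' s'. exec w (Seq c1 c2) (R, snd s) n (R', snd s') \<and> (\<forall>x<S. R' x = fst s' x) \<and> Q n s'"
    by (rule wp_execI[OF exec.Seq[OF 1(1) 2(1)] refl]) (use 2 in auto)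
qed

lemma wp_assign:
  assumes "regs_below S e" "x < S" "Q (cost e + 1) ((fst s)(x := aval w e s), snd s)"
  shows "wp w S (assign S x e) Q s"
  unfolding wp_def
proof (intro allI impI)
  fix R assume R: "\<forall>x<S. R x = fst s x"
  obtain R1 where 1: "exec w (comp S e) (R, snd s) (cost e) (R1, snd s)"
    "R1 S = aval w e (R, snd s)" "\<forall>x<S. R1 x = R x"
    using exec_comp[OF assms(1)] by blast
  have e: "aval w e (R, snd s) = aval w e s" using R by (intro aval_cong[OF assms(1)]) auto
  have "exec w (assign S x e) (R, snd s) (cost e + 1) (R1(x := binop_val w BitOr (R1 S) (R1 S)), snd s)"
    unfolding assign_def by (rule exec.Seq[OF 1(1) exec.Op])
  then show "\<exists>n R' s'. exec w (assign S x e) (R, snd s) n (R', snd s') \<and> (\<forall>x<S. R' x = fst s' x) \<and> Q n s'"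
    by (rule wp_execI[where s' = "((fst s)(x := aval w e s), snd s)"]) (use assms(3) 1 R e in auto)
qed

lemma wp_store:
  assumes "regs_below S a" "regs_below S e"
    "Q (cost a + (cost e + 1)) (fst s, (snd s)(aval w a s := aval w e s))"
  shows "wp w S (store S a e) Q s"
  unfolding wp_def
proof (intro allI impI)
  fix R assume R: "\<forall>x<S. R x = fst s x"
  obtain R1 where 1: "exec w (comp S a) (R, snd s) (cost a) (R1, snd s)"
    "R1 S = aval w a (R, snd s)" "\<forall>x<S. R1 x = R x"
    using exec_comp[OF assms(1)] by blast
  have a: "aval w a (R, snd s) = aval w a s" using R by (intro aval_cong[OF assms(1)]) auto
  obtain R2 where 2: "exec w (comp (Suc S) e) (R1, snd s) (cost e) (R2, snd s)"
    "R2 (Suc S) = aval w e (R1, snd s)" "\<forall>x<Suc S. R2 x = R1 x"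
    using exec_comp[OF regs_below_mono[OF assms(2), of "Suc S"]] by (simp del: fun_upd_apply) blast
  have e: "aval w e (R1, snd s) = aval w e s" using R 1 by (intro aval_cong[OF assms(2)]) auto
  have "exec w (store S a e) (R, snd s) (cost a + (cost e + 1)) (R2, (snd s)(R2 S := R2 (Suc S)))"
    unfolding store_def by (rule exec.Seq[OF 1(1) exec.Seq[OF 2(1) exec.Store]])
  then show "\<exists>n R' s'. exec w (store S a e) (R, snd s) n (R', snd s') \<and> (\<forall>x<S. R' x = fst s' x) \<and> Q n s'"
    by (rule wp_execI[where s' = "(fst s, (snd s)(aval w a s := aval w e s))"])
      (use assms(3) 1 2 R a e in auto)
qed

lemma wp_ifte:
  assumes "regs_below S e"
    "aval w e s \<noteq> 0 \<Longrightarrow> wp w S c1 (\<lambda>n. Q (cost e + Suc n)) s"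
    "aval w e s = 0 \<Longrightarrow> wp w S c2 (\<lambda>n. Q (cost e + Suc n)) s"
  shows "wp w S (ifte S e c1 c2) Q s"
  unfolding wp_def
proof (intro allI impI)
  fix R assume R: "\<forall>x<S. R x = fst s x"
  obtain R1 where 1: "exec w (comp S e) (R, snd s) (cost e) (R1, snd s)"
    "R1 S = aval w e (R, snd s)" "\<forall>x<S. R1 x = R x"
    using exec_comp[OF assms(1)] by blast
  have e: "aval w e (R, snd s) = aval w e s" using R by (intro aval_cong[OF assms(1)]) auto
  have R1: "\<forall>x<S. R1 x = fst s x" using 1 R by auto
  define c where "c = (if aval w e s \<noteq> 0 then c1 else c2)"
  have "wp w S c (\<lambda>n. Q (cost e + Suc n)) s" using assms unfolding c_def by auto
  from this R1 obtain n R2 s2 where 2: "exec w c (R1, snd s) n (R2, snd s2)" "\<forall>x<S. R2 x = fst s2 x"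
     "Q (cost e + Suc n) s2"
    by (rule wpE)
  have "exec w (Cond S c1 c2) (R1, snd s) (Suc n) (R2, snd s2)"
    using 2(1) 1(2) e exec.CondTrue[of "(R1, snd s)" S w c1 n "(R2, snd s2)" c2]
      exec.CondFalse[of "(R1, snd s)" S w c2 n "(R2, snd s2)" c1]
    by (auto simp: c_def split: if_splits)
  from exec.Seq[OF 1(1) this] show "\<exists>n R' s'. exec w (ifte S e c1 c2) (R, snd s) n (R', snd s') \<and> (\<forall>x<S. R' x = fst s' x) \<and> Q n s'"
    unfolding ifte_def by (rule wp_execI[OF _ refl]) (use 2 in auto)
qed

text \<open>\<open>I n s\<close> speaks of the moments right after an evaluation of the condition,
  with \<open>n\<close> counting all steps so far including that evaluation; the \<open>+ 1\<close>
  in \<open>body\<close> and \<open>fin\<close> is the test instruction of \<open>While\<close>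
  itself. Termination comes from \<open>\<mu>\<close>.\<close>

lemma wp_loop:
  fixes \<mu> :: "state \<Rightarrow> nat"
  assumes e: "regs_below S e"
    and body: "\<And>n s. I n s \<Longrightarrow> aval w e s \<noteq> 0 \<Longrightarrow>
      wp w S c (\<lambda>m s'. I (n + (m + cost e + 1)) s' \<and> \<mu> s' < \<mu> s) s"
    and init: "I (cost e) s"
    and fin: "\<And>n s. I n s \<Longrightarrow> aval w e s = 0 \<Longrightarrow> Q (n + 1) s"
  shows "wp w S (loop S e c) Q s"
proof -
  let ?W = "While S (Seq c (comp S e))"
  \<comment> \<open>Between passes, register \<open>S\<close> holds the value of the condition. This
    lies outside the registers that \<open>wp\<close> tracks, so the induction is on raw
    executions.\<close>
  have W: "\<exists>m R' s'. exec w ?W (R, snd s) m (R', snd s') \<and> (\<forall>x<S. R' x = fst s' x) \<and> Q (n + m) s'"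
    if "I n s" "\<forall>x<S. R x = fst s x" "R S = aval w e s" for n s R
    using that
  proof (induction "\<mu> s" arbitrary: n s R rule: less_induct)
    case less
    show ?case
    proof (cases "aval w e s = 0")
      case True
      have "exec w ?W (R, snd s) 1 (R, snd s)" using less True by (intro exec.WhileFalse) auto
      then show ?thesis by (rule wp_execI[OF _ refl]) (use fin[OF less(2) True] less in auto)
    next
      case False
      obtain m R1 s1 where 1: "exec w c (R, snd s) m (R1, snd s1)" "\<forall>x<S. R1 x = fst s1 x"
        "I (n + (m + cost e + 1)) s1 \<and> \<mu> s1 < \<mu> s"
        by (rule wpE[OF body[OF less(2) False] less(3)])
      obtain R2 where 2: "exec w (comp S e) (R1, snd s1) (cost e) (R2, snd s1)"
        "R2 S = aval w e (R1, snd s1)" "\<forall>x<S. R2 x = R1 x"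
        using exec_comp[OF e] by blast
      have e': "aval w e (R1, snd s1) = aval w e s1" using 1 by (intro aval_cong[OF e]) auto
      obtain m' R' s' where 3: "exec w ?W (R2, snd s1) m' (R', snd s')" "\<forall>x<S. R' x = fst s' x"
        "Q (n + (m + cost e + 1) + m') s'"
        using less(1)[OF conjunct2[OF 1(3)] conjunct1[OF 1(3)], of R2] 1(2) 2 e' by auto
      have ex: "exec w ?W (R, snd s) (Suc ((m + cost e) + m')) (R', snd s')"
        using less False by (intro exec.WhileTrue[OF _ exec.Seq[OF 1(1) 2(1)] 3(1)]) auto
      have "Q (n + Suc ((m + cost e) + m')) s'" using 3(3) by (simp add: algebra_simps)
      then show ?thesis by (intro wp_execI[OF ex refl]) (use 3(2) in auto)
    qed
  qed
  show ?thesis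
    unfolding wp_def loop_def
  proof (intro allI impI)
    fix R assume R: "\<forall>x<S. R x = fst s x"
    obtain R1 where 1: "exec w (comp S e) (R, snd s) (cost e) (R1, snd s)"
      "R1 S = aval w e (R, snd s)" "\<forall>x<S. R1 x = R x"
      using exec_comp[OF e] by blast
    have e': "aval w e (R, snd s) = aval w e s" using R by (intro aval_cong[OF e]) auto
    obtain m R' s' where 3: "exec w ?W (R1, snd s) m (R', snd s')" "\<forall>x<S. R' x = fst s' x"
        "Q (cost e + m) s'"
      using W[OF init, of R1] 1 R e' by auto
    show "\<exists>n R' s'. exec w (Seq (comp S e) ?W) (R, snd s) n (R', snd s') \<and> (\<forall>x<S. R' x = fst s' x) \<and> Q n s'"
      by (rule wp_execI[OF exec.Seq[OF 1(1) 3(1)] refl]) (use 3(2,3) in auto)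
  qed
qed


text \<open>
  Simulation of a program with \<open>v\<close>-bit words on wider words: results are reduced modulo \<open>2 ^ v\<close>, memory is
  shifted to a base address, and every loop iteration consumes one unit of fuel. Without fuel all
  loops stop at once, so the simulation always halts.
\<close>

abbreviation "rMod \<equiv> 20::nat"
abbreviation "rBase \<equiv> 24::nat"
abbreviation "rFuel \<equiv> 29::nat"
abbreviation "zone \<equiv> 40::nat"

primrec nregs :: "com \<Rightarrow> nat" where
  "nregs Skip = 0"
| "nregs (Const r v) = Suc r"
| "nregs (Op f r a b) = Suc (max r (max a b))"
| "nregs (Load r a) = Suc (max r a)"
| "nregs (Store a r) = Suc (max a r)"
| "nregs (Seq p q) = max (nregs p) (nregs q)"
| "nregs (Cond r p q) = max (Suc r) (max (nregs p) (nregs q))"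
| "nregs (While r p) = max (Suc r) (nregs p)"

text \<open>Reducing the address confines every access to the region, even when the simulated
  registers contain numbers that are too large, as may happen after a wrong guess.\<close>

abbreviation sim_addr :: "nat \<Rightarrow> aexp" where
  "sim_addr a \<equiv> Bin Add (Bin Mod (Reg (zone + a)) (Reg rMod)) (Reg rBase)"

abbreviation sim_test :: "nat \<Rightarrow> aexp" where
  "sim_test r \<equiv> Bin Mul (Bin Less (Lit 0) (Reg (zone + r))) (Bin Less (Lit 0) (Reg rFuel))"

primrec sim :: "nat \<Rightarrow> com \<Rightarrow> com" where
  "sim S Skip = Skip"
| "sim S (Const r v) = assign S (zone + r) (Bin Mod (Lit v) (Reg rMod))"
| "sim S (Op f r a b) =
    assign S (zone + r) (Bin Mod (Bin f (Reg (zone + a)) (Reg (zone + b))) (Reg rMod))"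
| "sim S (Load r a) = assign S (zone + r) (Mem (sim_addr a))"
| "sim S (Store a r) = store S (sim_addr a) (Reg (zone + r))"
| "sim S (Seq p q) = Seq (sim S p) (sim S q)"
| "sim S (Cond r p q) = ifte S (Reg (zone + r)) (sim S p) (sim S q)"
| "sim S (While r p) =
    loop S (sim_test r) (Seq (assign S rFuel (Bin Sub (Reg rFuel) (Lit 1))) (sim S p))"

primrec sim_cost :: "com \<Rightarrow> nat" where
  "sim_cost Skip = 1"
| "sim_cost (Const r v) = 4"
| "sim_cost (Op f r a b) = 6"
| "sim_cost (Load r a) = 8"
| "sim_cost (Store a r) = 7"
| "sim_cost (Seq p q) = sim_cost p + sim_cost q"
| "sim_cost (Cond r p q) = 2 + sim_cost p + sim_cost q"
| "sim_cost (While r p) = 12 + sim_cost p"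

text \<open>Every operation is an integer expression reduced modulo a power of two, and
  \<open>2 ^ v\<close> divides \<open>2 ^ w\<close>. Only subtraction adds the modulus itself; there
  the two expressions differ by a multiple of \<open>2 ^ v\<close>.\<close>

lemma binop_val_mod:
  assumes "a < 2 ^ v" "b < 2 ^ v" "v \<le> w"
  shows "binop_val w f a b mod 2 ^ v = binop_val v f a b"
proof -
  have m: "x mod 2 ^ w mod 2 ^ v = x mod 2 ^ v" for x :: nat
    by (rule mod_mod_cancel) (simp add: assms le_imp_power_dvd)
  obtain q where q: "(2::nat) ^ w = 2 ^ v * q"
    using le_imp_power_dvd[OF assms(3), of "2::nat"] by (elim dvdE)
  have "q \<noteq> 0" using q by (metis mult_0_right power_not_zero zero_neq_numeral)
  then obtain q' where q': "q = Suc q'" by (cases q) auto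
  have "a + 2 ^ w - b = (a + 2 ^ v - b) + 2 ^ v * q'"
    using assms q q' by simp
  then have "(a + 2 ^ w - b) mod 2 ^ v = (a + 2 ^ v - b) mod 2 ^ v" by simp
  then show ?thesis by (cases f) (simp_all only: binop_val.simps m)
qed

inductive_cases exec_SkipE: "exec w Skip s n s'"
inductive_cases exec_ConstE: "exec w (Const r v) s n s'"
inductive_cases exec_OpE: "exec w (Op f r a b) s n s'"
inductive_cases exec_LoadE: "exec w (Load r a) s n s'"
inductive_cases exec_StoreE: "exec w (Store a r) s n s'"
inductive_cases exec_SeqE: "exec w (Seq p q) s n s'"
inductive_cases exec_CondE: "exec w (Cond r p q) s n s'"
inductive_cases exec_WhileE: "exec w (While r p) s n s'"

definition sim_rel :: "nat \<Rightarrow> nat \<Rightarrow> nat \<Rightarrow> state \<Rightarrow> state \<Rightarrow> bool" where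
  "sim_rel nr v B s0 s \<longleftrightarrow>
    (\<forall>r<nr. fst s (zone + r) = fst s0 r \<and> fst s0 r < 2 ^ v) \<and>
    (\<forall>a<2 ^ v. snd s (B + a) = snd s0 a \<and> snd s0 a < 2 ^ v)"

definition sim_frame :: "nat \<Rightarrow> nat \<Rightarrow> state \<Rightarrow> state \<Rightarrow> bool" where
  "sim_frame v B s s' \<longleftrightarrow>
    (\<forall>x<zone. x \<noteq> rFuel \<longrightarrow> fst s' x = fst s x) \<and>
    (\<forall>a. a < B \<or> B + 2 ^ v \<le> a \<longrightarrow> snd s' a = snd s a) \<and> fst s' rFuel \<le> fst s rFuel"

definition sim_ok :: "nat \<Rightarrow> nat \<Rightarrow> nat \<Rightarrow> state \<Rightarrow> bool" where
  "sim_ok w v B s \<longleftrightarrow> fst s rMod = 2 ^ v \<and> fst s rBase = B \<and> fst s rFuel < 2 ^ w"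

text \<open>Confinement and cost hold whatever the region contains, since most guesses are wrong.
  Agreement with the simulated program is claimed only for runs with at most as many steps as there
  is fuel, and such a run uses no more fuel than it has steps.\<close>

definition sim_post :: "nat \<Rightarrow> nat \<Rightarrow> nat \<Rightarrow> com \<Rightarrow> state \<Rightarrow> nat \<Rightarrow> state \<Rightarrow> bool" where
  "sim_post nr v B p s n s' \<longleftrightarrow> sim_frame v B s s' \<and>
    n \<le> sim_cost p * (1 + (fst s rFuel - fst s' rFuel)) \<and>
    (\<forall>s0 k s0'. sim_rel nr v B s0 s \<and> exec v p s0 k s0' \<and> k \<le> fst s rFuel \<longrightarrow>
       sim_rel nr v B s0' s' \<and> fst s rFuel \<le> fst s' rFuel + k)"

lemma sim_postD:
  "sim_post nr v B p s n s' \<Longrightarrow> sim_rel nr v B s0 s \<Longrightarrow> exec v p s0 k s0' \<Longrightarrow> k \<le> fst s rFuel \<Longrightarrow>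
    sim_rel nr v B s0' s' \<and> fst s rFuel \<le> fst s' rFuel + k"
  unfolding sim_post_def by blast

lemma sim_postI:
  assumes "sim_frame v B s s'" "n \<le> sim_cost p * (1 + (fst s rFuel - fst s' rFuel))"
    "\<And>s0 k s0'. sim_rel nr v B s0 s \<Longrightarrow> exec v p s0 k s0' \<Longrightarrow> k \<le> fst s rFuel \<Longrightarrow>
      sim_rel nr v B s0' s' \<and> fst s rFuel \<le> fst s' rFuel + k"
  shows "sim_post nr v B p s n s'"
  unfolding sim_post_def using assms by blast

lemma sim_frame_refl: "sim_frame v B s s"
  by (simp add: sim_frame_def)

lemma sim_frame_trans: "sim_frame v B s s1 \<Longrightarrow> sim_frame v B s1 s2 \<Longrightarrow> sim_frame v B s s2"
  by (fastforce simp: sim_frame_def)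

lemma sim_ok_frame: "sim_ok w v B s \<Longrightarrow> sim_frame v B s s' \<Longrightarrow> sim_ok w v B s'"
  by (auto simp: sim_ok_def sim_frame_def)

lemma wp_sim:
  assumes "zone + nr \<le> S" "v < w" "B + 2 ^ v \<le> 2 ^ w" "nregs p \<le> nr" "sim_ok w v B s"
  shows "wp w S (sim S p) (sim_post nr v B p s) s"
  using assms(4,5)
proof (induction p arbitrary: s)
  have 1: "(2::nat) ^ v < 2 ^ w" using assms by simp
  have m: "x mod 2 ^ w mod 2 ^ v = x mod 2 ^ v" for x :: nat
    by (rule mod_mod_cancel) (use assms in \<open>simp add: le_imp_power_dvd\<close>)
  have m': "x mod 2 ^ v mod 2 ^ w = x mod 2 ^ v" for x :: nat
    using 1 by (meson less_trans mod_less mod_less_divisor zero_less_numeral zero_less_power)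
  have lt: "x < 2 ^ v \<Longrightarrow> x mod 2 ^ w = x" for x :: nat
    using 1 by (meson less_trans mod_less)
  have adr: "aval w (sim_addr a) s = B + fst s (zone + a) mod 2 ^ v" if "sim_ok w v B s" for a s
  proof -
    have "fst s (zone + a) mod 2 ^ v < 2 ^ v" by simp
    then have "fst s (zone + a) mod 2 ^ v + B < 2 ^ w" using assms(3) by linarith
    moreover from this have "B < 2 ^ w" by linarith
    ultimately show ?thesis using that 1 by (simp add: sim_ok_def m m')
  qed
  {
    case Skip
    show ?case unfolding sim.simps
      by (rule wp_Skip) (auto simp: sim_post_def sim_frame_refl elim: exec_SkipE)
  next
    case (Const r x)
    show ?case
      unfolding sim.simps
      by (rule wp_assign)
        (use Const assms(1) 1 in \<open>auto simp: sim_post_def sim_frame_def sim_ok_def sim_rel_def m m' elim!: exec_ConstE\<close>)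
  next
    case (Op f r a b)
    have *: "binop_val w f (fst s (zone + a) mod 2 ^ w) (fst s (zone + b) mod 2 ^ w) mod 2 ^ v
        = binop_val v f (fst s0 a) (fst s0 b)" if "sim_rel nr v B s0 s" for s0
    proof -
      have "fst s0 a < 2 ^ v" "fst s0 b < 2 ^ v" "fst s (zone + a) = fst s0 a" "fst s (zone + b) = fst s0 b"
        using that Op by (auto simp: sim_rel_def)
      then show ?thesis using assms(2) by (simp add: binop_val_mod lt)
    qed
    show ?case
      unfolding sim.simps
      by (rule wp_assign)
        (use Op assms(1) 1 * in \<open>auto simp: sim_post_def sim_frame_def sim_ok_def sim_rel_def m m' elim!: exec_OpE\<close>)
  next
    case (Load r a)
    show ?case
      unfolding sim.simps
    proof (rule wp_assign)
      show "sim_post nr v B (Load r a) s (cost (Mem (sim_addr a)) + 1)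
          ((fst s)(zone + r := aval w (Mem (sim_addr a)) s), snd s)"
      proof -
        have "snd s (B + fst s (zone + a) mod 2 ^ v) = snd s0 (fst s0 a)" 
          "snd s0 (fst s0 a) < 2 ^ v" if "sim_rel nr v B s0 s" for s0
          using that Load by (auto simp: sim_rel_def)
        moreover from this have "snd s (B + fst s (zone + a) mod 2 ^ v) mod 2 ^ w = snd s0 (fst s0 a)"
          if "sim_rel nr v B s0 s" for s0
          using that lt by metis
        ultimately show ?thesis
          using Load unfolding aval.simps(4) adr[OF Load(2)]
          by (auto simp: sim_post_def sim_frame_def sim_rel_def elim!: exec_LoadE)
      qed
    qed (use Load assms(1) in auto)
  next
    case (Store a r)
    have [simp]: "x < nr \<Longrightarrow> sim_rel nr v B s0 s \<Longrightarrow> fst s (zone + x) mod 2 ^ w = fst s0 x" for x s0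
      using lt by (simp add: sim_rel_def)
    have "fst s (zone + a) mod 2 ^ v < 2 ^ v" by simp
    then have *: "x < B \<or> B + 2 ^ v \<le> x \<Longrightarrow> x \<noteq> B + fst s (zone + a) mod 2 ^ v" for x by linarith
    show ?case
      unfolding sim.simps
    proof (rule wp_store)
      show "sim_post nr v B (Store a r) s (cost (sim_addr a) + (cost (Reg (zone + r)) + 1))
         (fst s, (snd s)(aval w (sim_addr a) s := aval w (Reg (zone + r)) s))"
        using Store * unfolding adr[OF Store(2)]
        by (auto simp: sim_post_def sim_frame_def sim_rel_def lt elim!: exec_StoreE)
    qed (use Store assms(1) in auto)
  next
    case (Seq p q)
    show ?case unfolding sim.simps
    proof (rule wp_Seq, rule wp_mono)
      show "wp w S (sim S p) (sim_post nr v B p s) s" using Seq by auto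
      fix n s1 assume 1: "sim_post nr v B p s n s1"
      have "sim_ok w v B s1" using 1 Seq sim_ok_frame unfolding sim_post_def by blast
      then have "wp w S (sim S q) (sim_post nr v B q s1) s1" using Seq by auto
      then show "wp w S (sim S q) (\<lambda>n'. sim_post nr v B (Seq p q) s (n + n')) s1"
      proof (rule wp_mono)
        fix n' s2 assume 2: "sim_post nr v B q s1 n' s2"
        define f f1 f2 where "f = fst s rFuel" "f1 = fst s1 rFuel" "f2 = fst s2 rFuel"
        have f: "f2 \<le> f1" "f1 \<le> f" using 1 2 unfolding sim_post_def sim_frame_def f_f1_f2_def by auto
        have "n + n' \<le> sim_cost p * (1 + (f - f1)) + sim_cost q * (1 + (f1 - f2))"
          using 1 2 unfolding sim_post_def f_f1_f2_def by auto
        also have "\<dots> \<le> sim_cost p * (1 + (f - f2)) + sim_cost q * (1 + (f - f2))"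
          using f by (intro add_mono mult_left_mono) auto
        finally have n: "n + n' \<le> sim_cost (Seq p q) * (1 + (f - f2))" by (simp add: algebra_simps)
        have "sim_rel nr v B s0' s2 \<and> f \<le> f2 + k"
          if r: "sim_rel nr v B s0 s" "exec v (Seq p q) s0 k s0'" "k \<le> f" for s0 k s0'
        proof -
          obtain k1 k2 s01 where k: "k = k1 + k2" "exec v p s0 k1 s01" "exec v q s01 k2 s0'"
            using r(2) by (auto elim: exec_SeqE)
          have a: "sim_rel nr v B s01 s1" "f \<le> f1 + k1"
            using sim_postD[OF 1 r(1) k(2)] r(3) k(1) unfolding f_f1_f2_def by auto
          have "sim_rel nr v B s0' s2" "f1 \<le> f2 + k2"
            using sim_postD[OF 2 a(1) k(3)] a(2) r(3) k(1) unfolding f_f1_f2_def by auto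
          then show ?thesis using a k by auto
        qed
        then show "sim_post nr v B (Seq p q) s (n + n') s2"
          using 1 2 n sim_frame_trans unfolding sim_post_def f_f1_f2_def by blast
      qed
    qed
  next
    case (Cond r p q)
    have [simp]: "sim_rel nr v B s0 s \<Longrightarrow> fst s (zone + r) mod 2 ^ w = fst s0 r" for s0
      using Cond lt by (simp add: sim_rel_def)
    show ?case unfolding sim.simps
    proof (rule wp_ifte)
      assume nz: "aval w (Reg (zone + r)) s \<noteq> 0"
      have "wp w S (sim S p) (sim_post nr v B p s) s" using Cond by auto
      then show "wp w S (sim S p) (\<lambda>n. sim_post nr v B (Cond r p q) s (cost (Reg (zone + r)) + Suc n)) s"
      proof (rule wp_mono)
        fix n s' assume p: "sim_post nr v B p s n s'"
        show "sim_post nr v B (Cond r p q) s (cost (Reg (zone + r)) + Suc n) s'"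
        proof (rule sim_postI)
          show "sim_frame v B s s'" using p unfolding sim_post_def by blast
          have "n \<le> sim_cost p * (1 + (fst s rFuel - fst s' rFuel))"
            using p unfolding sim_post_def by blast
          then show "cost (Reg (zone + r)) + Suc n \<le> sim_cost (Cond r p q) * (1 + (fst s rFuel - fst s' rFuel))"
            by (simp add: add_mult_distrib)
        next
          fix s0 k s0' assume a: "sim_rel nr v B s0 s" "exec v (Cond r p q) s0 k s0'" "k \<le> fst s rFuel"
          then obtain k' where k': "k = Suc k'" "exec v p s0 k' s0'"
            using nz by (auto elim!: exec_CondE)
          then show "sim_rel nr v B s0' s' \<and> fst s rFuel \<le> fst s' rFuel + k"
            using sim_postD[OF p a(1) k'(2)] a(3) by auto
        qed
      qed
    next
      assume nz: "aval w (Reg (zone + r)) s = 0"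
      have "wp w S (sim S q) (sim_post nr v B q s) s" using Cond by auto
      then show "wp w S (sim S q) (\<lambda>n. sim_post nr v B (Cond r p q) s (cost (Reg (zone + r)) + Suc n)) s"
      proof (rule wp_mono)
        fix n s' assume p: "sim_post nr v B q s n s'"
        show "sim_post nr v B (Cond r p q) s (cost (Reg (zone + r)) + Suc n) s'"
        proof (rule sim_postI)
          show "sim_frame v B s s'" using p unfolding sim_post_def by blast
          have "n \<le> sim_cost q * (1 + (fst s rFuel - fst s' rFuel))"
            using p unfolding sim_post_def by blast
          then show "cost (Reg (zone + r)) + Suc n \<le> sim_cost (Cond r p q) * (1 + (fst s rFuel - fst s' rFuel))"
            by (simp add: add_mult_distrib)
        next
          fix s0 k s0' assume a: "sim_rel nr v B s0 s" "exec v (Cond r p q) s0 k s0'" "k \<le> fst s rFuel"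
          then obtain k' where k': "k = Suc k'" "exec v q s0 k' s0'"
            using nz by (auto elim!: exec_CondE)
          then show "sim_rel nr v B s0' s' \<and> fst s rFuel \<le> fst s' rFuel + k"
            using sim_postD[OF p a(1) k'(2)] a(3) by auto
        qed
      qed
    qed (use Cond assms(1) in auto)
  next
    case (While r p)
    define f where "f = fst s rFuel"
    let ?C = "12 + sim_cost p"
    \<comment> \<open>For each true run of the loop, some tail of it starts in a state represented
      by \<open>s'\<close>, and the fuel spent so far is at most the number of steps before that
      tail. The 7 is the cost of evaluating the first test.\<close>
    define I where "I n s' \<longleftrightarrow> sim_frame v B s s' \<and> n \<le> 7 + ?C * (f - fst s' rFuel) \<and>
      (\<forall>s0 k s0'. sim_rel nr v B s0 s \<and> exec v (While r p) s0 k s0' \<and> k \<le> f \<longrightarrow>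
        (\<exists>s1 k1. sim_rel nr v B s1 s' \<and> exec v (While r p) s1 k1 s0' \<and> k1 \<le> fst s' rFuel \<and>
          f + k1 \<le> fst s' rFuel + k))" for n s'
    have tst: "aval w (sim_test r) s' \<noteq> 0 \<longleftrightarrow> fst s' (zone + r) mod 2 ^ w \<noteq> 0 \<and> fst s' rFuel \<noteq> 0"
      if "sim_ok w v B s'" for s'
    proof -
      have "(1::nat) < 2 ^ w" using assms(2) by (intro one_less_power) auto
      then show ?thesis using that by (auto simp: sim_ok_def)
    qed
    have rl: "sim_rel nr v B s0 s' \<Longrightarrow> fst s' (zone + r) mod 2 ^ w = fst s0 r" for s0 s'
      using While lt by (simp add: sim_rel_def)
    show ?case unfolding sim.simps
    proof (rule wp_loop[where I = I and \<mu> = "\<lambda>s. fst s rFuel"])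
      show "regs_below S (sim_test r)" using assms(1) While by auto
      show "I (cost (sim_test r)) s"
        unfolding I_def f_def using sim_frame_refl by auto
    next
      fix n s'
      assume I: "I n s'" and t: "aval w (sim_test r) s' \<noteq> 0"
      have ok: "sim_ok w v B s'" using I While sim_ok_frame unfolding I_def by blast
      define f' where "f' = fst s' rFuel"
      have f': "f' \<noteq> 0" "f' < 2 ^ w" "fst s' (zone + r) mod 2 ^ w \<noteq> 0" "f' \<le> f"
        using t tst[OF ok] ok I unfolding sim_ok_def f'_def I_def sim_frame_def f_def by auto
      have "(1::nat) < 2 ^ w" using assms(2) by (intro one_less_power) auto
      then have ev: "aval w (Bin Sub (Reg rFuel) (Lit 1)) s' = f' - 1"
        using f' sub_mod_power[of 1 f' w] assms(2) by (simp add: f'_def[symmetric])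
      let ?s1 = "((fst s')(rFuel := f' - 1), snd s')"
      show "wp w S (Seq (assign S rFuel (Bin Sub (Reg rFuel) (Lit 1))) (sim S p))
        (\<lambda>m s''. I (n + (m + cost (sim_test r) + 1)) s'' \<and> fst s'' rFuel < fst s' rFuel) s'"
      proof (rule wp_Seq, rule wp_assign)
        have fr: "sim_frame v B s' ?s1" using f' by (auto simp: sim_frame_def f'_def)
        then have "sim_ok w v B ?s1" using ok sim_ok_frame by blast
        then have "wp w S (sim S p) (sim_post nr v B p ?s1) ?s1" using While by auto
        then show "wp w S (sim S p) (\<lambda>n'. (\<lambda>m s''. I (n + (m + cost (sim_test r) + 1)) s'' \<and>
           fst s'' rFuel < fst s' rFuel) (cost (Bin Sub (Reg rFuel) (Lit 1)) + 1 + n'))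
           ((fst s')(rFuel := aval w (Bin Sub (Reg rFuel) (Lit 1)) s'), snd s')"
          unfolding ev
        proof (rule wp_mono)
          fix m s'' assume p: "sim_post nr v B p ?s1 m s''"
          define f'' where "f'' = fst s'' rFuel"
          have f''1: "f'' \<le> f' - 1" "m \<le> sim_cost p * (1 + (f' - 1 - f''))"
            using p unfolding sim_post_def sim_frame_def f''_def by simp_all
          have eq: "1 + (f' - 1 - f'') = f' - f''" using f''1(1) f'(1) by linarith
          have f'': "f'' \<le> f' - 1" "m \<le> sim_cost p * (f' - f'')" using f''1 unfolding eq by blast+
          have fr2: "sim_frame v B s s''"
          proof (rule sim_frame_trans, rule sim_frame_trans)
            show "sim_frame v B s s'" using I unfolding I_def by blast
            show "sim_frame v B s' ?s1" by (rule fr)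
            show "sim_frame v B ?s1 s''" using p unfolding sim_post_def by blast
          qed
          have "n \<le> 7 + ?C * (f - f')" using I unfolding I_def f'_def by auto
          \<comment> \<open>Decreasing the fuel takes 4 steps; evaluating the condition and testing
            it takes 8.\<close>
          then have "n + (4 + m + 8) \<le> 7 + ?C * (f - f') + (12 * (f' - f'') + sim_cost p * (f' - f''))"
            using f'' f' by linarith
          also have "\<dots> = 7 + ?C * ((f - f') + (f' - f''))" by (simp add: algebra_simps)
          also have "(f - f') + (f' - f'') = f - f''" using f' f'' by auto
          finally have n: "n + (4 + m + 8) \<le> 7 + ?C * (f - f'')" .
          have "\<exists>s1 k1. sim_rel nr v B s1 s'' \<and> exec v (While r p) s1 k1 s0' \<and> k1 \<le> f'' \<and>
              f + k1 \<le> f'' + k"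
            if a: "sim_rel nr v B s0 s" "exec v (While r p) s0 k s0'" "k \<le> f" for s0 k s0'
          proof -
            obtain s1 k1 where b: "sim_rel nr v B s1 s'" "exec v (While r p) s1 k1 s0'" "k1 \<le> f'"
              "f + k1 \<le> f' + k"
              using I a unfolding I_def f'_def by blast
            have "fst s1 r \<noteq> 0" using rl[OF b(1)] f' by auto
            then obtain j i s2 where c: "k1 = Suc (j + i)" "exec v p s1 j s2" "exec v (While r p) s2 i s0'"
              using b(2) by (auto elim: exec_WhileE)
            have "sim_rel nr v B s1 ?s1" using b(1) by (auto simp: sim_rel_def)
            then have "sim_rel nr v B s2 s''" "f' - 1 \<le> f'' + j"
              using sim_postD[OF p _ c(2)] c(1) b(3) unfolding f''_def by auto
            then show ?thesis using b c f' by (intro exI[of _ s2] exI[of _ i]) auto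
          qed
          then show "I (n + (cost (Bin Sub (Reg rFuel) (Lit 1)) + 1 + m + cost (sim_test r) + 1)) s'' \<and>
              fst s'' rFuel < fst s' rFuel"
            using n fr2 f' f'' unfolding I_def f''_def f'_def by (auto simp: algebra_simps)
        qed
      qed (use assms(1) in auto)
    next
      fix n s'
      assume I: "I n s'" and t: "aval w (sim_test r) s' = 0"
      have ok: "sim_ok w v B s'" using I While sim_ok_frame unfolding I_def by blast
      define f' where "f' = fst s' rFuel"
      have "n \<le> 7 + ?C * (f - f')" using I unfolding I_def f'_def by auto
      then have n: "n + 1 \<le> ?C * (1 + (f - f'))" by (simp add: algebra_simps)
      have "sim_rel nr v B s0' s' \<and> f \<le> f' + k"
        if a: "sim_rel nr v B s0 s" "exec v (While r p) s0 k s0'" "k \<le> f" for s0 k s0'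
      proof -
        obtain s1 k1 where b: "sim_rel nr v B s1 s'" "exec v (While r p) s1 k1 s0'" "k1 \<le> f'"
              "f + k1 \<le> f' + k"
          using I a unfolding I_def f'_def by blast
        \<comment> \<open>A run of \<open>While\<close> takes at least one step, so fuel is left,
          and the test can only have failed because the simulated register is zero.\<close>
        have "k1 \<noteq> 0" using b(2) by (auto elim: exec_WhileE)
        then have "fst s1 r = 0" using t tst[OF ok] rl[OF b(1)] b(3) unfolding f'_def by auto
        then have "s0' = s1" using b(2) by (auto elim: exec_WhileE)
        then show ?thesis using b by auto
      qed
      then show "sim_post nr v B (While r p) s (n + 1) s'"
        using n I unfolding sim_post_def I_def f'_def f_def by auto
    qed
  }
qed

section \<open>The Subset Sum instance of a k-Sum instance\<close>

definition pad :: "nat \<Rightarrow> nat \<Rightarrow> nat \<Rightarrow> nat" where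
  "pad d a i = d * (a + i)"

definition filler :: "nat \<Rightarrow> nat \<Rightarrow> nat \<Rightarrow> nat \<Rightarrow> nat" where
  "filler d H \<phi> i = d * (H + i) + 4 * \<phi>"

definition item :: "nat \<Rightarrow> nat \<Rightarrow> nat \<Rightarrow> nat \<Rightarrow> nat \<Rightarrow> nat" where
  "item d E G j z = d * (E + G * j + z) + 1"

text \<open>There are \<open>m\<close> pads with quotients from \<open>a\<close> on,
  \<open>s\<close> fillers with quotients from \<open>E * \<phi>\<close> on, and items with
  quotients a little above \<open>E\<close>. The bounds on \<open>\<phi>\<close> make all items
  together no heavier than one filler. The bound on \<open>a\<close> puts every pad above what
  colours and k-Sum target can contribute. The bounds on \<open>E * \<phi>\<close> put fillers above
  pads and absorb the filler indices \<open>i < s\<close>.\<close>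

locale gadget =
  fixes k U m s \<phi> a E :: nat and Z :: "nat set"
  assumes k: "1 \<le> k" and U: "1 \<le> U" and Z: "Z \<subseteq> {1..U}"
    and m: "1 \<le> m" and s: "1 \<le> s"
    and phi: "16 * k \<le> \<phi>" "16 * k * card Z \<le> \<phi>"
    and a: "4 * k ^ 3 * (U + 1) * \<phi> \<le> a" "m \<le> a"
    and E: "8 * a \<le> E * \<phi>" "4 * s \<le> E * \<phi>"
begin

text \<open>Large enough to prevent carries between residues and quotients: \<open>s\<close> fillers
  contribute \<open>4 * \<phi> * s\<close> to the residue, and a subset that sums to the target has
  at most \<open>2 * \<phi> * s + k\<close> items.\<close>

definition "d = 32 * s * \<phi>"
text \<open>A missing filler can be compensated in the residue only by \<open>4 * \<phi>\<close>
  additional items, and these weigh \<open>4 * \<phi> * E = 4 * H\<close>, far more than the filler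
  itself.\<close>

definition "H = E * \<phi>"
text \<open>Larger than any sum of at most \<open>k\<close> elements of \<open>Z\<close>, so
  reduction modulo \<open>G\<close> removes the colours \<open>j\<close> from the items. Colours are
  there because k-Sum may use an element repeatedly while the elements of a set are
  distinct.\<close>

definition "G = k * U + 1"

definition "Pads = pad d a ` {..<m}"
definition "Fills = filler d H \<phi> ` {..<s}"
definition "Items \<kappa> = (\<lambda>(j, z). item d E G j z) ` ({..<\<kappa>} \<times> Z)"
definition "X \<kappa> = Pads \<union> Fills \<union> Items \<kappa>"
text \<open>The quotient of \<open>target \<kappa> T\<close> by \<open>d\<close>; the residue is
  \<open>4 * \<phi> * s + \<kappa>\<close>.\<close>

definition "tq \<kappa> T = (\<Sum>i<s. H + i) + (\<Sum>j<\<kappa>. E + G * j) + T"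
definition "target \<kappa> T = (\<Sum>i<s. filler d H \<phi> i) + (\<Sum>j<\<kappa>. d * (E + G * j) + 1) + d * T"

lemma finZ [simp]: "finite Z" using Z finite_subset by blast

lemma d_pos [simp]: "0 < d" using s phi k by (auto simp: d_def)
lemma d_neq [simp]: "d \<noteq> 0" using d_pos by linarith
lemma d_ge [simp]: "Suc 0 \<le> d" using d_pos by linarith
lemma phi_pos: "16 \<le> \<phi>" using phi k by linarith
lemma d_gt: "4 * \<phi> < d"
proof -
  have "32 * 1 * \<phi> \<le> 32 * s * \<phi>" using s by (intro mult_mono) auto
  then show ?thesis using phi_pos unfolding d_def by linarith
qed
lemma a_pos: "0 < a" using m a by linarith
lemma E_pos: "0 < E" using E(1) a_pos by (cases E) auto
lemma s_le_H: "4 * s \<le> H" and a_le_H: "8 * a \<le> H"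
  using E by (auto simp: H_def)

text \<open>Colours and k-Sum target together weigh less than one pad; this is what excludes pads
  from every solution.\<close>

lemma small_le_a: assumes "\<kappa> \<le> k" "T \<le> k * U" shows "G * \<kappa> * \<kappa> + T < a"
proof -
  have "G * \<kappa> * \<kappa> + T \<le> G * k * k + k * U"
    using assms by (intro add_mono mult_mono) auto
  also have "\<dots> \<le> k ^ 3 * U + k * k + k * U" by (simp add: G_def power3_eq_cube algebra_simps)
  also have "\<dots> \<le> k ^ 3 * U + k ^ 3 + k ^ 3 * U"
    using k by (intro add_mono mult_right_mono) (auto simp: power3_eq_cube)
  also have "\<dots> < 4 * k ^ 3 * (U + 1)" using k U by (simp add: algebra_simps)
  also have "\<dots> \<le> 4 * k ^ 3 * (U + 1) * \<phi>" using phi_pos by simp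
  finally show ?thesis using a by linarith
qed

lemma colour_sum: "(\<Sum>j<\<kappa>. G * j) \<le> G * \<kappa> * \<kappa>"
proof -
  have "(\<Sum>j<\<kappa>. G * j) \<le> (\<Sum>j<\<kappa>. G * \<kappa>)" by (intro sum_mono mult_left_mono) auto
  then show ?thesis by (simp add: algebra_simps)
qed

lemma target_tq: "target \<kappa> T = d * tq \<kappa> T + (4 * \<phi> * s + \<kappa>)"
proof -
  have 1: "(\<Sum>i<s. filler d H \<phi> i) = d * (\<Sum>i<s. H + i) + 4 * \<phi> * s"
    unfolding filler_def sum.distrib[of _ "\<lambda>_. 4 * \<phi>"] sum_distrib_left by simp
  have 2: "(\<Sum>j<\<kappa>. d * (E + G * j) + 1) = d * (\<Sum>j<\<kappa>. E + G * j) + \<kappa>"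
    unfolding sum.distrib[of _ "\<lambda>_. 1"] sum_distrib_left by simp
  show ?thesis unfolding target_def tq_def 1 2 by (simp add: algebra_simps)
qed

text \<open>The factor 8 clears the fractions in \<open>s * s \<le> s * H / 4\<close> and
  \<open>a \<le> H / 8\<close>.\<close>

lemma tq_le:
  assumes "\<kappa> \<le> k" "T \<le> k * U"
  shows "8 * tq \<kappa> T + 8 \<le> 10 * (s * H) + 8 * (k * E) + 2 * H"
proof -
  have "(\<Sum>i<s. H + i) \<le> (\<Sum>i<s. H + s)" by (intro sum_mono) auto
  then have 1: "(\<Sum>i<s. H + i) \<le> s * H + s * s" by (simp add: algebra_simps)
  have "s * (4 * s) \<le> s * H" using s_le_H by (intro mult_left_mono) auto
  then have 2: "4 * (s * s) \<le> s * H" by (simp add: algebra_simps)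
  have 3: "(\<Sum>j<\<kappa>. E + G * j) \<le> k * E + G * \<kappa> * \<kappa>"
    using colour_sum[of \<kappa>] assms by (auto simp: sum.distrib intro!: add_mono)
  have "tq \<kappa> T \<le> (s * H + s * s) + (k * E + G * \<kappa> * \<kappa>) + T"
    unfolding tq_def by (intro add_mono 1 3 le_refl)
  then have "tq \<kappa> T + 1 \<le> s * H + s * s + k * E + a"
    using small_le_a[OF assms] by linarith
  then show ?thesis using 2 a_le_H by linarith
qed

lemma kE_le: "16 * (k * E) \<le> H"
  using mult_right_mono[OF phi(1), of E] by (simp add: H_def algebra_simps)

text \<open>Twice the residue of the fillers: the surplus \<open>4 * \<phi> * s\<close> leaves room
  for the crude bound on the number of items in an arbitrary subset with the right sum.\<close>

lemma residue_less: assumes "\<kappa> \<le> k" shows "8 * (\<phi> * s) + \<kappa> < d"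
proof -
  have "k * 1 \<le> \<phi> * s" using phi s by (intro mult_mono) auto
  moreover have "0 < \<phi> * s" using phi_pos s by simp
  moreover have "d = 32 * (\<phi> * s)" by (simp add: d_def)
  ultimately show ?thesis using assms by linarith
qed

text \<open>A window of ratio two: when all sizes are powers of two, it fixes the bit length of the
  target.\<close>

lemma target_bounds:
  assumes "\<kappa> \<le> k" "T \<le> k * U"
  shows "s * d * H \<le> target \<kappa> T" "target \<kappa> T < 2 * (s * d * H)"
proof -
  have "s * H \<le> (\<Sum>i<s. H + i)" by (simp add: sum.distrib)
  also have "\<dots> \<le> tq \<kappa> T" by (simp add: tq_def)
  finally have "d * (s * H) \<le> d * tq \<kappa> T" by (rule mult_left_mono) simp
  also have "\<dots> \<le> target \<kappa> T" by (simp add: target_tq)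
  finally show "s * d * H \<le> target \<kappa> T" by (simp only: mult_ac)
  define x where "x = s * H"
  have "1 * H \<le> x" using s unfolding x_def by (intro mult_right_mono) auto
  then have "tq \<kappa> T + 1 \<le> 2 * x"
    using tq_le[OF assms] kE_le unfolding x_def[symmetric] by linarith
  then have "tq \<kappa> T + 1 \<le> 2 * (s * H)" unfolding x_def .
  then have "d * (tq \<kappa> T + 1) \<le> d * (2 * (s * H))" by (intro mult_left_mono) auto
  moreover have "4 * \<phi> * s + \<kappa> < d" using residue_less[OF assms(1)] by (simp add: algebra_simps)
  ultimately have "target \<kappa> T < d * (2 * (s * H))" by (simp add: target_tq)
  then show "target \<kappa> T < 2 * (s * d * H)" by (simp only: mult_ac)
qed


section \<open>The three kinds of elements and the shape of a solution\<close>

lemma inj_pad: "inj_on (pad d a) A"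
  by (auto simp: inj_on_def pad_def)

lemma inj_filler: "inj_on (filler d H \<phi>) A"
  by (auto simp: inj_on_def filler_def)

lemma Z_less_G: "z \<in> Z \<Longrightarrow> z < G"
proof -
  assume "z \<in> Z"
  then have "z \<le> 1 * U" using Z by auto
  also have "\<dots> \<le> k * U" using k by (intro mult_right_mono) auto
  finally show ?thesis by (simp add: G_def)
qed

lemma inj_item: "inj_on (\<lambda>(j, z). item d E G j z) (J \<times> Z)"
proof (rule inj_onI, clarify)
  fix j z j' z' assume z: "z \<in> Z" "z' \<in> Z" and e: "item d E G j z = item d E G j' z'"
  have "G * j + z = G * j' + z'" using e by (simp add: item_def)
  then have "(G * j + z) div G = (G * j' + z') div G" "(G * j + z) mod G = (G * j' + z') mod G" by simp_all
  then show "j = j' \<and> z = z'" using Z_less_G[OF z(1)] Z_less_G[OF z(2)] by simp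
qed

lemma mod_pad: "x \<in> Pads \<Longrightarrow> x mod d = 0"
  by (auto simp: Pads_def pad_def)

lemma mod_filler: "x \<in> Fills \<Longrightarrow> x mod d = 4 * \<phi>"
  using d_gt by (auto simp: Fills_def filler_def)

lemma mod_item: "x \<in> Items \<kappa> \<Longrightarrow> x mod d = 1"
proof -
  have "1 < d" using d_gt phi_pos by linarith
  then have "Suc (d * q) mod d = 1" for q by (metis mod_Suc_eq mod_mult_self1_is_0 mod_less One_nat_def)
  then show "x \<in> Items \<kappa> \<Longrightarrow> x mod d = 1" by (auto simp: Items_def item_def)
qed

lemma disj: "Pads \<inter> Fills = {}" "(Pads \<union> Fills) \<inter> Items \<kappa> = {}"
proof -
  have False if "x \<in> Pads" "x \<in> Fills" for x
    using mod_pad[OF that(1)] mod_filler[OF that(2)] phi_pos by simp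
  then show "Pads \<inter> Fills = {}" by blast
  have False if "x \<in> Pads" "x \<in> Items \<kappa>" for x
    using mod_pad[OF that(1)] mod_item[OF that(2)] by simp
  moreover have False if "x \<in> Fills" "x \<in> Items \<kappa>" for x
    using mod_filler[OF that(1)] mod_item[OF that(2)] phi_pos by simp
  ultimately show "(Pads \<union> Fills) \<inter> Items \<kappa> = {}" by blast
qed

lemma fin [simp]: "finite Pads" "finite Fills" "finite (Items \<kappa>)" "finite (X \<kappa>)"
  by (auto simp: Pads_def Fills_def Items_def X_def)

lemma card_X: "card (X \<kappa>) = m + s + \<kappa> * card Z"
proof -
  have "card (X \<kappa>) = card Pads + card Fills + card (Items \<kappa>)"
    unfolding X_def using disj by (simp add: card_Un_disjoint)
  then show ?thesis
    by (simp add: Pads_def Fills_def Items_def card_image[OF inj_pad] card_image[OF inj_filler]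
        card_image[OF inj_item] card_cartesian_product)
qed

lemma subset_sums:
  assumes "Y \<subseteq> X \<kappa>"
  obtains A B C where "A \<subseteq> {..<m}" "B \<subseteq> {..<s}" "C \<subseteq> {..<\<kappa>} \<times> Z"
    "\<Sum>Y = (\<Sum>i\<in>A. pad d a i) + (\<Sum>i\<in>B. filler d H \<phi> i) + (\<Sum>(j, z)\<in>C. item d E G j z)"
proof -
  have "Y \<inter> Pads \<subseteq> pad d a ` {..<m}" by (auto simp: Pads_def)
  then obtain A where A: "A \<subseteq> {..<m}" "Y \<inter> Pads = pad d a ` A"
    by (rule subset_imageE)
  have "Y \<inter> Fills \<subseteq> filler d H \<phi> ` {..<s}" by (auto simp: Fills_def)
  then obtain B where B: "B \<subseteq> {..<s}" "Y \<inter> Fills = filler d H \<phi> ` B"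
    by (rule subset_imageE)
  have "Y \<inter> Items \<kappa> \<subseteq> (\<lambda>(j, z). item d E G j z) ` ({..<\<kappa>} \<times> Z)" by (auto simp: Items_def)
  then obtain C where C: "C \<subseteq> {..<\<kappa>} \<times> Z" "Y \<inter> Items \<kappa> = (\<lambda>(j, z). item d E G j z) ` C"
    by (rule subset_imageE)
  have "finite Y" using assms fin(4) finite_subset by blast
  have "Y = (Y \<inter> Pads) \<union> (Y \<inter> Fills) \<union> (Y \<inter> Items \<kappa>)" using assms by (auto simp: X_def)
  then have "\<Sum>Y = \<Sum>((Y \<inter> Pads) \<union> (Y \<inter> Fills) \<union> (Y \<inter> Items \<kappa>))" by simp
  also have "\<dots> = \<Sum>((Y \<inter> Pads) \<union> (Y \<inter> Fills)) + \<Sum>(Y \<inter> Items \<kappa>)"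
    using disj(1) disj(2)[of \<kappa>] \<open>finite Y\<close> by (intro sum.union_disjoint) auto
  also have "\<Sum>((Y \<inter> Pads) \<union> (Y \<inter> Fills)) = \<Sum>(Y \<inter> Pads) + \<Sum>(Y \<inter> Fills)"
    using disj(1) disj(2)[of \<kappa>] \<open>finite Y\<close> by (intro sum.union_disjoint) auto
  also have "\<Sum>(Y \<inter> Pads) = (\<Sum>i\<in>A. pad d a i)" unfolding A by (simp add: sum.reindex[OF inj_pad])
  also have "\<Sum>(Y \<inter> Fills) = (\<Sum>i\<in>B. filler d H \<phi> i)" unfolding B by (simp add: sum.reindex[OF inj_filler])
  also have "\<Sum>(Y \<inter> Items \<kappa>) = (\<Sum>(j, z)\<in>C. item d E G j z)"
    unfolding C by (simp add: sum.reindex[OF inj_on_subset[OF inj_item C(1)]])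
  finally show thesis using that A(1) B(1) C(1) by blast
qed


text \<open>Division by \<open>d\<close> splits the equation into residues and quotients. Residues
  count fillers and items, up to a trade of fillers for \<open>4 * \<phi>\<close> items each, which
  the quotients exclude. Once all fillers are present, the rest of the quotient is smaller than a
  pad, and modulo \<open>G\<close> it is the sum of the chosen \<open>z\<close>.\<close>

lemma sums_eq_target:
  assumes "\<kappa> \<le> k" "T \<le> k * U"
    and A: "A \<subseteq> {..<m}" and B: "B \<subseteq> {..<s}" and C: "C \<subseteq> {..<\<kappa>} \<times> Z"
    and eq: "(\<Sum>i\<in>A. pad d a i) + (\<Sum>i\<in>B. filler d H \<phi> i) + (\<Sum>(j, z)\<in>C. item d E G j z) = target \<kappa> T"
  shows "card C = \<kappa>" "(\<Sum>(j, z)\<in>C. z) = T"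
proof -
  have fA: "finite A" and fB: "finite B" and fC: "finite C"
    using A B C finite_subset[of C "{..<\<kappa>} \<times> Z"] finite_subset[of A] finite_subset[of B] by auto
  define qA where "qA = (\<Sum>i\<in>A. a + i)"
  define qB where "qB = (\<Sum>i\<in>B. H + i)"
  define qC where "qC = (\<Sum>(j, z)\<in>C. G * j + z)"
  have sA: "(\<Sum>i\<in>A. pad d a i) = d * qA" by (simp add: qA_def pad_def sum_distrib_left)
  have sB: "(\<Sum>i\<in>B. filler d H \<phi> i) = d * qB + 4 * \<phi> * card B"
    unfolding filler_def sum.distrib[of _ "\<lambda>_. 4 * \<phi>"] qB_def sum_distrib_left by simp
  have "(\<Sum>(j, z)\<in>C. item d E G j z) = (\<Sum>p\<in>C. d * E + d * (case p of (j, z) \<Rightarrow> G * j + z) + 1)"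
    by (intro sum.cong) (auto simp: item_def algebra_simps)
  also have "\<dots> = d * (card C * E + qC) + card C"
    by (simp add: sum.distrib sum_Suc qC_def sum_distrib_left[symmetric] distrib_left)
  finally have sC: "(\<Sum>(j, z)\<in>C. item d E G j z) = d * (card C * E + qC) + card C" .
  define q where "q = qA + qB + card C * E + qC"
  define r where "r = 4 * \<phi> * card B + card C"
  have eq': "d * q + r = d * tq \<kappa> T + (4 * \<phi> * s + \<kappa>)"
    using eq unfolding sA sB sC target_tq q_def r_def by (simp add: algebra_simps)
  have rl: "4 * \<phi> * s + \<kappa> < d" using residue_less[OF assms(1)] by (simp add: algebra_simps)
  have "d * q < d * (tq \<kappa> T + 1)" using eq' rl by simp
  \<comment> \<open>The residue of the target is below \<open>d\<close>, so a subset of the same sum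
    cannot have a larger quotient.\<close>
  then have qle: "q \<le> tq \<kappa> T" unfolding mult_less_cancel1 by linarith
  have cB: "card B \<le> s" using B card_mono[of "{..<s}" B] by simp
  define x where "x = s * H"
  have "1 * H \<le> x" using s unfolding x_def by (intro mult_right_mono) auto
  then have "tq \<kappa> T \<le> 2 * x + k * E"
    using tq_le[OF assms(1,2)] kE_le unfolding x_def[symmetric] by linarith
  \<comment> \<open>Each item has quotient at least \<open>E\<close>, so the bound on the quotient
    limits the number of items. This is what makes \<open>r\<close> a genuine residue below
    \<open>d\<close>.\<close>
  then have "card C * E \<le> (2 * (s * \<phi>) + k) * E"
    using qle unfolding q_def x_def H_def by (simp add: algebra_simps)
  then have cC: "card C \<le> 2 * (s * \<phi>) + k" using E_pos by simp
  have "4 * \<phi> * card B \<le> 4 * \<phi> * s" using cB by (intro mult_left_mono) auto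
  moreover have "4 * \<phi> * s = 4 * (\<phi> * s)" "s * \<phi> = \<phi> * s" by simp_all
  ultimately have rd: "r < d" using cC residue_less[of k] unfolding r_def by linarith
  have r: "r = 4 * \<phi> * s + \<kappa>" and q: "q = tq \<kappa> T"
    using arg_cong[OF eq', of "\<lambda>x. x mod d"] arg_cong[OF eq', of "\<lambda>x. x div d"] rd rl by simp_all
  define j where "j = s - card B"
  \<comment> \<open>Each of the \<open>j\<close> missing fillers leaves a gap of
    \<open>4 * \<phi>\<close> in the residue that only items can close.\<close>
  have cC': "card C = \<kappa> + 4 * \<phi> * j"
    using r cB unfolding r_def j_def by (simp add: algebra_simps diff_mult_distrib2)
  have "(\<Sum>i<s. H + i) = qB + (\<Sum>i\<in>{..<s} - B. H + i)"
    unfolding qB_def using B by (simp add: sum.subset_diff add.commute)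
  also have "(\<Sum>i\<in>{..<s} - B. H + i) \<le> (\<Sum>i\<in>{..<s} - B. H + s)" by (intro sum_mono) auto
  also have "\<dots> = j * (H + s)" using B fB by (simp add: j_def card_Diff_subset)
  finally have miss: "(\<Sum>i<s. H + i) \<le> qB + j * (H + s)" by simp
  define c where "c = (\<Sum>j<\<kappa>. G * j)"
  have cT: "c + T < a" using small_le_a[OF assms(1,2)] colour_sum[of \<kappa>] unfolding c_def by linarith
  have tq: "tq \<kappa> T = (\<Sum>i<s. H + i) + \<kappa> * E + c + T" by (simp add: tq_def c_def sum.distrib)
  have "(\<kappa> + 4 * \<phi> * j) * E = \<kappa> * E + j * (4 * H)" by (simp add: H_def algebra_simps)
  then have "qA + qB + (\<kappa> * E + j * (4 * H)) + qC = (\<Sum>i<s. H + i) + \<kappa> * E + c + T"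
    using q unfolding q_def tq cC' by simp
  \<comment> \<open>The additional items weigh \<open>4 * j * H\<close>, the missing fillers at most
    \<open>j * (H + s)\<close>, and the only slack is \<open>c + T < a\<close>.\<close>
  then have "j * (4 * H) \<le> j * (H + s) + c + T"
    using miss by linarith
  moreover have "j * (H + s) \<le> j * (2 * H)" using s_le_H by (intro mult_left_mono) auto
  moreover have "j * (4 * H) = 4 * (j * H)" "j * (2 * H) = 2 * (j * H)" by simp_all
  ultimately have jH: "2 * (j * H) < a" using cT by linarith
  have j0: "j = 0"
  proof (rule ccontr)
    assume "j \<noteq> 0"
    then have "1 * H \<le> j * H" by (intro mult_right_mono) auto
    then show False using jH a_le_H by linarith
  qed
  then show cCk: "card C = \<kappa>" using cC' by simp
  have "B = {..<s}" using j0 cB B unfolding j_def by (intro card_subset_eq) auto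
  then have main: "qA + qC = c + T" using q unfolding q_def tq qB_def cCk by simp
  have "A = {}"
  proof (rule ccontr)
    assume "A \<noteq> {}"
    then obtain i where "i \<in> A" by auto
    then have "a + i \<le> qA" unfolding qA_def using fA by (intro member_le_sum) auto
    then show False using main cT by linarith
  qed
  then have main: "qC = c + T" using main by (simp add: qA_def)
  define zC where "zC = (\<Sum>(j, z)\<in>C. z)"
  have qC: "qC = G * (\<Sum>(j, z)\<in>C. j) + zC"
    unfolding qC_def zC_def sum_distrib_left sum.distrib[symmetric] by (intro sum.cong) auto
  have "zC \<le> (\<Sum>(j, z)\<in>C. U)" unfolding zC_def using C Z by (intro sum_mono) auto
  also have "\<dots> \<le> k * U" using cCk assms(1) by simp
  finally have z: "zC < G" by (simp add: G_def)
  have c: "c = G * (\<Sum>j<\<kappa>. j)" by (simp add: c_def sum_distrib_left)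
  have T: "T < G" using assms by (simp add: G_def)
  have "zC = qC mod G" unfolding qC using z by simp
  also have "\<dots> = T" unfolding main c using T by simp
  finally show "(\<Sum>(j, z)\<in>C. z) = T" by (simp add: zC_def)
qed

lemma gadget_correct:
  assumes "\<kappa> \<le> k" "T \<le> k * U"
  shows "subset_sum_yes (X \<kappa>, target \<kappa> T) \<longleftrightarrow> ksum_yes \<kappa> (Z, T, U)"
proof
  assume "subset_sum_yes (X \<kappa>, target \<kappa> T)"
  then obtain Y where Y: "Y \<subseteq> X \<kappa>" "\<Sum>Y = target \<kappa> T" by (auto simp: subset_sum_yes_def)
  obtain A B C where ABC: "A \<subseteq> {..<m}" "B \<subseteq> {..<s}" "C \<subseteq> {..<\<kappa>} \<times> Z"
    "\<Sum>Y = (\<Sum>i\<in>A. pad d a i) + (\<Sum>i\<in>B. filler d H \<phi> i) + (\<Sum>(j, z)\<in>C. item d E G j z)"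
    by (rule subset_sums[OF Y(1)])
  note C = sums_eq_target[OF assms ABC(1-3) ABC(4)[symmetric, unfolded Y(2)]]
  have "finite C" using ABC(3) finite_subset[of C "{..<\<kappa>} \<times> Z"] by auto
  then obtain ps where ps: "set ps = C" "distinct ps" using finite_distinct_list by blast
  have "sum_list (map snd ps) = (\<Sum>p\<in>C. snd p)" using ps by (simp add: sum_list_distinct_conv_sum_set)
  then have "sum_list (map snd ps) = T" using C(2) by (simp add: case_prod_unfold)
  moreover have "length (map snd ps) = \<kappa>" using ps C(1) distinct_card by fastforce
  moreover have "set (map snd ps) \<subseteq> Z" using ps ABC(3) by auto
  ultimately show "ksum_yes \<kappa> (Z, T, U)" unfolding ksum_yes_def by blast
next
  assume "ksum_yes \<kappa> (Z, T, U)"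
  then obtain zs where zs: "length zs = \<kappa>" "set zs \<subseteq> Z" "sum_list zs = T" by (auto simp: ksum_yes_def)
  define C where "C = (\<lambda>j. (j, zs ! j)) ` {..<\<kappa>}"
  let ?I = "(\<lambda>(j, z). item d E G j z) ` C"
  have C: "C \<subseteq> {..<\<kappa>} \<times> Z" using zs by (auto simp: C_def)
  have sub: "?I \<subseteq> Items \<kappa>" using C by (auto simp: Items_def)
  have "\<Sum>?I = (\<Sum>(j, z)\<in>C. item d E G j z)" by (simp add: sum.reindex[OF inj_on_subset[OF inj_item C]])
  also have "\<dots> = (\<Sum>j<\<kappa>. item d E G j (zs ! j))"
    unfolding C_def by (subst sum.reindex) (auto simp: inj_on_def)
  also have "\<dots> = (\<Sum>j<\<kappa>. d * (E + G * j) + 1) + d * (\<Sum>j<\<kappa>. zs ! j)"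
    unfolding sum_distrib_left sum.distrib[symmetric] item_def by (intro sum.cong) (auto simp: algebra_simps)
  also have "(\<Sum>j<\<kappa>. zs ! j) = T" using zs by (simp add: sum_list_sum_nth atLeast0LessThan)
  finally have 1: "\<Sum>?I = (\<Sum>j<\<kappa>. d * (E + G * j) + 1) + d * T" .
  have 2: "\<Sum>Fills = (\<Sum>i<s. filler d H \<phi> i)" unfolding Fills_def by (simp add: sum.reindex[OF inj_filler])
  have "Fills \<inter> ?I = {}" using disj(2)[of \<kappa>] sub by blast
  then have "\<Sum>(Fills \<union> ?I) = target \<kappa> T"
    using 1 2 finite_subset[OF sub] by (simp add: sum.union_disjoint target_def)
  moreover have "Fills \<union> ?I \<subseteq> X \<kappa>" using sub by (auto simp: X_def)
  ultimately show "subset_sum_yes (X \<kappa>, target \<kappa> T)" unfolding subset_sum_yes_def by blast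
qed


text \<open>The order pads, fillers, items by colour lets the program compute an element from its
  index with a constant number of operations.\<close>

definition "elem zs l = (if l < m then pad d a l else if l < m + s then filler d H \<phi> (l - m)
  else item d E G ((l - m - s) div card Z) (zs ! ((l - m - s) mod card Z)))"

lemma elem_image:
  assumes "distinct zs" "set zs = Z"
  shows "elem zs ` {0..<m + s + \<kappa> * card Z} = X \<kappa>"
proof -
  define N where "N = card Z"
  have N: "length zs = N" using assms distinct_card N_def by fastforce
  have "elem zs l \<in> X \<kappa>" if l: "l < m + s + \<kappa> * N" for l
  proof -
    consider "l < m" | "m \<le> l" "l < m + s" | "m + s \<le> l" by linarith
    then show ?thesis
    proof cases
      case 3
      define q where "q = l - m - s"
      have q: "q < \<kappa> * N" using l 3 by (simp add: q_def)
      then have "q div N < \<kappa>" by (rule less_mult_imp_div_less)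
      moreover have "q mod N < N" using q by (cases N) auto
      then have "zs ! (q mod N) \<in> Z" using N assms by (metis nth_mem)
      moreover have "elem zs l = item d E G (q div N) (zs ! (q mod N))"
        using 3 by (simp add: elem_def q_def N_def)
      ultimately show ?thesis by (auto simp: X_def Items_def)
    qed (auto simp: elem_def X_def Pads_def Fills_def)
  qed
  moreover have "x \<in> elem zs ` {0..<m + s + \<kappa> * N}" if x: "x \<in> X \<kappa>" for x
  proof -
    have "\<exists>l < m + s + \<kappa> * N. x = elem zs l"
      using x unfolding X_def
    proof (elim UnE)
      assume "x \<in> Pads"
      then obtain i where "i < m" "x = pad d a i" by (auto simp: Pads_def)
      then show ?thesis by (intro exI[of _ i]) (auto simp: elem_def)
    next
      assume "x \<in> Fills"
      then obtain i where "i < s" "x = filler d H \<phi> i" by (auto simp: Fills_def)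
      then show ?thesis by (intro exI[of _ "m + i"]) (auto simp: elem_def)
    next
      assume "x \<in> Items \<kappa>"
      then obtain j z where jz: "j < \<kappa>" "z \<in> Z" "x = item d E G j z" by (auto simp: Items_def)
      obtain i where i: "i < N" "zs ! i = z" using jz(2) assms N by (metis in_set_conv_nth)
      have "j * N + i < (j + 1) * N" using i by simp
      also have "\<dots> \<le> \<kappa> * N" using jz(1) by (intro mult_right_mono) auto
      finally have "j * N + i < \<kappa> * N" .
      moreover have "(j * N + i) div N = j" "(j * N + i) mod N = i" using i by simp_all
      ultimately show ?thesis using i jz
        by (intro exI[of _ "m + s + (j * N + i)"]) (auto simp: elem_def N_def)
    qed
    then show ?thesis by auto
  qed
  ultimately show ?thesis unfolding N_def by fastforce
qed

text \<open>Distinctness comes from counting: \<open>elem zs\<close> maps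
  \<open>m + s + \<kappa> * card Z\<close> indices onto a set of exactly that size.\<close>

lemma encoding:
  assumes "distinct zs" "set zs = Z"
  shows "[t, m + s + \<kappa> * card Z] @ map (elem zs) [0..<m + s + \<kappa> * card Z] \<in> subset_sum_encodings (X \<kappa>, t)"
proof -
  let ?n = "m + s + \<kappa> * card Z"
  have "inj_on (elem zs) {0..<?n}"
    by (rule eq_card_imp_inj_on) (simp_all add: elem_image[OF assms] card_X)
  then have "distinct (map (elem zs) [0..<?n])" by (simp add: distinct_map)
  moreover have "set (map (elem zs) [0..<?n]) = X \<kappa>" using elem_image[OF assms] by simp
  ultimately show ?thesis unfolding subset_sum_encodings_def by (auto simp: card_X)
qed

section \<open>Sizes of the elements, their maximum and their sum\<close>

lemma item_quot_le: "G * k + U + 1 \<le> a"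
proof -
  have "G * k * 1 + 1 * U \<le> G * k * k + k * U" using k by (intro add_mono mult_mono) auto
  then show ?thesis using small_le_a[of k "k * U"] by simp
qed

lemma item_le:
  assumes "\<kappa> \<le> k" "x \<in> Items \<kappa>"
  shows "x \<le> d * (E + (G * k + U + 1))"
proof -
  obtain j z where jz: "j < \<kappa>" "z \<in> Z" "x = item d E G j z" using assms by (auto simp: Items_def)
  have "x \<le> d * (E + G * j + z + 1)" using jz d_pos by (simp add: item_def)
  also have "\<dots> \<le> d * (E + G * k + U + 1)"
    using jz Z assms by (intro mult_left_mono add_mono) auto
  finally show ?thesis by (simp add: algebra_simps)
qed

lemma E_le_H: "16 * E \<le> H"
  using kE_le k by (metis dual_order.trans mult.left_neutral mult_le_mono1 mult_le_mono2)

lemma item_le_H: assumes "\<kappa> \<le> k" "x \<in> Items \<kappa>" shows "x \<le> d * H"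
proof -
  have "E + (G * k + U + 1) \<le> H" using E_le_H a_le_H item_quot_le by linarith
  then show ?thesis using item_le[OF assms] by (meson dual_order.trans mult_le_mono2)
qed

lemma pad_le_2a: assumes "x \<in> Pads" shows "x \<le> 2 * (d * a)"
proof -
  obtain i where "i < m" "x = pad d a i" using assms by (auto simp: Pads_def)
  moreover from this have "d * (a + i) \<le> d * (2 * a)" using a by (intro mult_left_mono) auto
  ultimately show ?thesis by (simp add: pad_def)
qed

lemma pad_le_H: assumes "x \<in> Pads" shows "x \<le> d * H"
proof -
  have "d * (2 * a) \<le> d * H" using a_le_H by (intro mult_left_mono) auto
  moreover have "d * (2 * a) = 2 * (d * a)" by simp
  ultimately show ?thesis using pad_le_2a[OF assms] by linarith
qed

lemma filler_le: assumes "x \<in> Fills" shows "d * H \<le> x" "x \<le> 2 * (d * H)"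
proof -
  obtain i where i: "i < s" "x = filler d H \<phi> i" using assms by (auto simp: Fills_def)
  then show "d * H \<le> x" by (simp add: filler_def algebra_simps)
  have "x \<le> d * (H + i + 1)" using i d_gt by (simp add: filler_def)
  also have "\<dots> \<le> d * (2 * H)" using i s_le_H by (intro mult_left_mono) auto
  finally show "x \<le> 2 * (d * H)" by simp
qed

lemma Fills_ne: "Fills \<noteq> {}" using s by (auto simp: Fills_def lessThan_empty_iff)

lemma Max_bounds: assumes "\<kappa> \<le> k" shows "d * H \<le> Max (X \<kappa>)" "Max (X \<kappa>) \<le> 2 * (d * H)"
proof -
  obtain x where x: "x \<in> Fills" using Fills_ne by auto
  then have "x \<le> Max (X \<kappa>)" by (intro Max_ge) (auto simp: X_def)
  then show "d * H \<le> Max (X \<kappa>)" using filler_le(1)[OF x] by linarith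
  have "X \<kappa> \<noteq> {}" using x by (auto simp: X_def)
  moreover have "y \<le> 2 * (d * H)" if "y \<in> X \<kappa>" for y
    using that pad_le_H[of y] filler_le(2)[of y] item_le_H[OF assms, of y] by (auto simp: X_def)
  ultimately show "Max (X \<kappa>) \<le> 2 * (d * H)" by (intro Max.boundedI) auto
qed

lemma dH_le: "d * H \<le> s * d * H" using s by simp

text \<open>Together with \<open>size_le_target\<close>, this makes the target the number that
  determines the word length for the instance.\<close>

lemma elements_le_target:
  assumes "\<kappa> \<le> k" "T \<le> k * U" "x \<in> X \<kappa>"
  shows "x \<le> target \<kappa> T"
proof (cases "x \<in> Fills")
  case True
  then obtain i where i: "i < s" "x = filler d H \<phi> i" by (auto simp: Fills_def)
  then have "x \<le> (\<Sum>i<s. filler d H \<phi> i)" using member_le_sum[of i "{..<s}" "filler d H \<phi>"] by auto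
  then show ?thesis by (simp add: target_def)
next
  case False
  then have "x \<le> d * H" using assms(3) pad_le_H[of x] item_le_H[OF assms(1), of x] by (auto simp: X_def)
  then show ?thesis using dH_le target_bounds[OF assms(1,2)] by linarith
qed

lemma size_le_target:
  assumes "\<kappa> \<le> k" "T \<le> k * U"
  shows "m + s + \<kappa> * card Z + 2 \<le> target \<kappa> T"
proof -
  have "\<kappa> * card Z \<le> k * card Z" using assms by (intro mult_right_mono) auto
  then have "16 * (\<kappa> * card Z) \<le> \<phi>" using phi(2) by linarith
  moreover have "1 * \<phi> \<le> H" unfolding H_def using E_pos by (intro mult_right_mono) auto
  ultimately have "m + s + \<kappa> * card Z + 2 \<le> H"
    using a(2) a_pos a_le_H s_le_H by linarith
  moreover have "1 * H \<le> d * H" by (intro mult_right_mono) auto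
  ultimately show ?thesis using dH_le target_bounds[OF assms] by linarith
qed

text \<open>Pads contribute the order \<open>m * d * a\<close>. Fillers are bounded by a target,
  hence by \<open>2 * (s * d * H)\<close>, and all items together by \<open>d * H\<close>.\<close>

lemma sum_bounds:
  assumes "\<kappa> \<le> k"
  shows "m * d * a \<le> \<Sum>(X \<kappa>)" "\<Sum>(X \<kappa>) \<le> 2 * (m * d * a) + 3 * (s * d * H)"
proof -
  have "\<Sum>(X \<kappa>) = \<Sum>(Pads \<union> Fills) + \<Sum>(Items \<kappa>)"
    unfolding X_def by (rule sum.union_disjoint) (auto simp: disj)
  also have "\<Sum>(Pads \<union> Fills) = \<Sum>Pads + \<Sum>Fills"
    by (rule sum.union_disjoint) (auto simp: disj)
  finally have eq: "\<Sum>(X \<kappa>) = \<Sum>Pads + \<Sum>Fills + \<Sum>(Items \<kappa>)" .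
  have cP: "card Pads = m" by (simp add: Pads_def card_image[OF inj_pad])
  have "(\<Sum>x\<in>Pads. d * a) \<le> \<Sum>Pads" by (intro sum_mono) (auto simp: Pads_def pad_def)
  then have p1: "m * d * a \<le> \<Sum>Pads" by (simp add: cP mult.assoc)
  then show "m * d * a \<le> \<Sum>(X \<kappa>)" unfolding eq by linarith
  have "\<Sum>Pads \<le> (\<Sum>x\<in>Pads. 2 * (d * a))" by (intro sum_mono pad_le_2a)
  then have p2: "\<Sum>Pads \<le> 2 * (m * d * a)" by (simp add: cP algebra_simps)
  have "\<Sum>Fills = (\<Sum>i<s. filler d H \<phi> i)" unfolding Fills_def by (simp add: sum.reindex[OF inj_filler])
  also have "\<dots> \<le> target 0 0" by (simp add: target_def)
  finally have f2: "\<Sum>Fills \<le> 2 * (s * d * H)" using target_bounds[of 0 0] by linarith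
  have cI: "card (Items \<kappa>) \<le> k * card Z"
    using assms by (simp add: Items_def card_image[OF inj_item] card_cartesian_product)
  have "\<Sum>(Items \<kappa>) \<le> (\<Sum>x\<in>Items \<kappa>. d * (E + (G * k + U + 1)))" by (intro sum_mono item_le[OF assms])
  also have "\<dots> = card (Items \<kappa>) * (d * (E + (G * k + U + 1)))" by simp
  also have "\<dots> \<le> (k * card Z) * (d * (E + (G * k + U + 1)))" using cI by (intro mult_right_mono) auto
  also have "\<dots> = d * (k * card Z * E + k * card Z * (G * k + U + 1))" by (simp add: algebra_simps)
  \<comment> \<open>The summand \<open>E\<close> of each item is paid for by
    \<open>16 * k * card Z \<le> \<phi>\<close>, since \<open>H = E * \<phi>\<close>; colours and
    \<open>z\<close> are paid for by the lower bound on \<open>a\<close>.\<close>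
  also have "\<dots> \<le> d * H"
  proof (rule mult_left_mono)
    have "16 * k * card Z * E \<le> \<phi> * E" using phi(2) by (intro mult_right_mono) auto
    then have 1: "16 * (k * card Z * E) \<le> H" by (simp add: H_def algebra_simps)
    have "G * k + U + 1 = k * k * U + k + U + 1" by (simp add: G_def algebra_simps)
    also have "\<dots> \<le> k ^ 3 * U + k ^ 3 + k ^ 3 * U + k ^ 3"
      using k by (intro add_mono) (auto simp: power3_eq_cube)
    also have "\<dots> \<le> 4 * k ^ 3 * (U + 1)" by (simp add: algebra_simps)
    finally have "16 * k * card Z * (G * k + U + 1) \<le> \<phi> * (4 * k ^ 3 * (U + 1))"
      using phi(2) by (intro mult_mono) auto
    also have "\<dots> = 4 * k ^ 3 * (U + 1) * \<phi>" by (simp only: mult_ac)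
    also note a(1)
    finally have "16 * (k * card Z * (G * k + U + 1)) \<le> a" by (simp only: mult_ac)
    then show "k * card Z * E + k * card Z * (G * k + U + 1) \<le> H" using 1 a_le_H by linarith
  qed simp
  finally have "\<Sum>(Items \<kappa>) \<le> d * H" .
  then show "\<Sum>(X \<kappa>) \<le> 2 * (m * d * a) + 3 * (s * d * H)" unfolding eq using p2 f2 dH_le by linarith
qed

lemma X_pos: "x \<in> X \<kappa> \<Longrightarrow> 0 < x"
  using a_pos phi_pos by (auto simp: X_def Pads_def pad_def Fills_def filler_def Items_def item_def)

end

section \<open>Sublinear time\<close>

lemma exec_deterministic: "exec w p s n s' \<Longrightarrow> exec w p s n' s'' \<Longrightarrow> s'' = s'"
proof (induction arbitrary: n' s'' rule: exec.induct)
  case (Seq p s m s1 q n s2)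
  obtain m' k' s1' where "exec w p s m' s1'" "exec w q s1' k' s''"
    using Seq.prems by (auto elim: exec_SeqE)
  then show ?case using Seq.IH by metis
next
  case (WhileTrue s r p m s1 n s2)
  obtain m' k' s1' where "exec w p s m' s1'" "exec w (While r p) s1' k' s''"
    using WhileTrue.prems WhileTrue.hyps(1) by (auto elim: exec_WhileE)
  then show ?case using WhileTrue.IH by metis
next
  case (CondTrue s r p n s1 q)
  from CondTrue.prems show ?case
    by (rule exec_CondE) (use CondTrue.hyps(1) CondTrue.IH in simp_all)
next
  case (CondFalse s r q n s1 p)
  from CondFalse.prems show ?case
    by (rule exec_CondE) (use CondFalse.hyps(1) CondFalse.IH in simp_all)
next
  case (WhileFalse s r p)
  from WhileFalse.prems show ?case
    by (rule exec_WhileE) (use WhileFalse.hyps(1) in simp_all)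
qed (auto elim: exec_SkipE exec_ConstE exec_OpE exec_LoadE exec_StoreE)

text \<open>
  \<open>A\<close> contains the cells whose initial content can influence the run.
\<close>

definition reads :: "nat \<Rightarrow> com \<Rightarrow> state \<Rightarrow> nat \<Rightarrow> state \<Rightarrow> nat set \<Rightarrow> bool" where
  "reads w p s n s' A \<longleftrightarrow> finite A \<and> card A \<le> n \<and>
    (\<forall>M. (\<forall>a\<in>A. M a = snd s a) \<longrightarrow>
      (\<exists>M'. exec w p (fst s, M) n (fst s', M') \<and> (\<forall>a. M a = snd s a \<longrightarrow> M' a = snd s' a)))"

lemma readsI:
  assumes "finite A" "card A \<le> n"
    "\<And>M. \<forall>a\<in>A. M a = snd s a \<Longrightarrow>
      \<exists>M'. exec w p (fst s, M) n (fst s', M') \<and> (\<forall>a. M a = snd s a \<longrightarrow> M' a = snd s' a)"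
  shows "reads w p s n s' A"
  unfolding reads_def using assms by auto

lemma readsE:
  assumes "reads w p s n s' A" "\<forall>a\<in>A. M a = snd s a"
  obtains M' where "exec w p (fst s, M) n (fst s', M')" "\<forall>a. M a = snd s a \<longrightarrow> M' a = snd s' a"
  using assms unfolding reads_def by blast

lemma readsD: "reads w p s n s' A \<Longrightarrow> finite A" "reads w p s n s' A \<Longrightarrow> card A \<le> n"
  unfolding reads_def by auto

text \<open>Only \<open>Load\<close> depends on the memory, and it reads one cell in one step. In a
  sequence, the second part may read cells written by the first; a write stores the same value in
  both runs, so cells that agree initially still agree later, and the two sets of cells can be
  united.\<close>

lemma exec_reads: "exec w p s n s' \<Longrightarrow> \<exists>A. reads w p s n s' A"
proof (induction rule: exec.induct)
  case (Skip s)
  show ?case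
  proof (intro exI[of _ "{}"] readsI)
    fix M
    show "\<exists>M'. exec w Skip (fst s, M) 1 (fst s, M') \<and> (\<forall>a. M a = snd s a \<longrightarrow> M' a = snd s a)"
      using exec.Skip[of w "(fst s, M)"] by blast
  qed auto
next
  case (Const r v R M)
  show ?case
  proof (intro exI[of _ "{}"] readsI)
    fix M2
    show "\<exists>M'. exec w (Const r v) (fst (R, M), M2) 1 (fst (R(r := v mod 2 ^ w), M), M') \<and>
        (\<forall>a. M2 a = snd (R, M) a \<longrightarrow> M' a = snd (R(r := v mod 2 ^ w), M) a)"
      using exec.Const[of w r v R M2] by (intro exI[of _ M2]) simp
  qed auto
next
  case (Op f r a b R M)
  show ?case
  proof (intro exI[of _ "{}"] readsI)
    fix M2
    show "\<exists>M'. exec w (Op f r a b) (fst (R, M), M2) 1 (fst (R(r := binop_val w f (R a) (R b)), M), M') \<and>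
        (\<forall>x. M2 x = snd (R, M) x \<longrightarrow> M' x = snd (R(r := binop_val w f (R a) (R b)), M) x)"
      using exec.Op[of w f r a b R M2] by (intro exI[of _ M2]) simp
  qed auto
next
  case (Load r a R M)
  show ?case
  proof (intro exI[of _ "{R a}"] readsI)
    fix M2 assume "\<forall>x\<in>{R a}. M2 x = snd (R, M) x"
    then have "exec w (Load r a) (R, M2) 1 (R(r := M (R a)), M2)"
      using exec.Load[of w r a R M2] by simp
    then show "\<exists>M'. exec w (Load r a) (fst (R, M), M2) 1 (fst (R(r := M (R a)), M), M') \<and>
              (\<forall>x. M2 x = snd (R, M) x \<longrightarrow> M' x = snd (R(r := M (R a)), M) x)"
      by (intro exI[of _ M2]) simp
  qed auto
next
  case (Store a r R M)
  show ?case
  proof (intro exI[of _ "{}"] readsI)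
    fix M2
    show "\<exists>M'. exec w (Store a r) (fst (R, M), M2) 1 (fst (R, M(R a := R r)), M') \<and>
              (\<forall>x. M2 x = snd (R, M) x \<longrightarrow> M' x = snd (R, M(R a := R r)) x)"
      using exec.Store[of w a r R M2] by (intro exI[of _ "M2(R a := R r)"]) simp
  qed auto
next
  case (Seq p s m s1 q n s2)
  then obtain A B where A: "reads w p s m s1 A" and B: "reads w q s1 n s2 B" by auto
  show ?case
  proof (intro exI[of _ "A \<union> B"] readsI)
    show "finite (A \<union> B)" using A B readsD by auto
    show "card (A \<union> B) \<le> m + n" using card_Un_le[of A B] readsD(2)[OF A] readsD(2)[OF B] by linarith
    fix M assume M: "\<forall>a\<in>A \<union> B. M a = snd s a"
    then have "\<forall>a\<in>A. M a = snd s a" by auto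
    with A obtain M1 where 1: "exec w p (fst s, M) m (fst s1, M1)" "\<forall>a. M a = snd s a \<longrightarrow> M1 a = snd s1 a"
      by (rule readsE)
    then have "\<forall>a\<in>B. M1 a = snd s1 a" using M by auto
    with B obtain M2 where 2: "exec w q (fst s1, M1) n (fst s2, M2)" "\<forall>a. M1 a = snd s1 a \<longrightarrow> M2 a = snd s2 a"
      by (rule readsE)
    show "\<exists>M'. exec w (Seq p q) (fst s, M) (m + n) (fst s2, M') \<and> (\<forall>a. M a = snd s a \<longrightarrow> M' a = snd s2 a)"
      using exec.Seq[OF 1(1) 2(1)] 1(2) 2(2) by blast
  qed
next
  case (CondTrue s r p n s' q)
  then obtain A where A: "reads w p s n s' A" by auto
  show ?case
  proof (intro exI[of _ A] readsI)
    fix M assume "\<forall>a\<in>A. M a = snd s a"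
    with A obtain M1 where 1: "exec w p (fst s, M) n (fst s', M1)" "\<forall>a. M a = snd s a \<longrightarrow> M1 a = snd s' a"
      by (rule readsE)
    show "\<exists>M'. exec w (Cond r p q) (fst s, M) (Suc n) (fst s', M') \<and> (\<forall>a. M a = snd s a \<longrightarrow> M' a = snd s' a)"
      using exec.CondTrue[OF _ 1(1), of r q] CondTrue.hyps 1(2) by auto
  qed (use readsD[OF A] in auto)
next
  case (CondFalse s r q n s' p)
  then obtain A where A: "reads w q s n s' A" by auto
  show ?case
  proof (intro exI[of _ A] readsI)
    fix M assume "\<forall>a\<in>A. M a = snd s a"
    with A obtain M1 where 1: "exec w q (fst s, M) n (fst s', M1)" "\<forall>a. M a = snd s a \<longrightarrow> M1 a = snd s' a"
      by (rule readsE)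
    show "\<exists>M'. exec w (Cond r p q) (fst s, M) (Suc n) (fst s', M') \<and> (\<forall>a. M a = snd s a \<longrightarrow> M' a = snd s' a)"
      using exec.CondFalse[OF _ 1(1), of r p] CondFalse.hyps 1(2) by auto
  qed (use readsD[OF A] in auto)
next
  case (WhileTrue s r p m s1 n s2)
  then obtain A B where A: "reads w p s m s1 A" and B: "reads w (While r p) s1 n s2 B" by auto
  show ?case
  proof (intro exI[of _ "A \<union> B"] readsI)
    show "finite (A \<union> B)" using A B readsD by auto
    show "card (A \<union> B) \<le> Suc (m + n)" using card_Un_le[of A B] readsD(2)[OF A] readsD(2)[OF B] by linarith
    fix M assume M: "\<forall>a\<in>A \<union> B. M a = snd s a"
    then have "\<forall>a\<in>A. M a = snd s a" by auto
    with A obtain M1 where 1: "exec w p (fst s, M) m (fst s1, M1)" "\<forall>a. M a = snd s a \<longrightarrow> M1 a = snd s1 a"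
      by (rule readsE)
    then have "\<forall>a\<in>B. M1 a = snd s1 a" using M by auto
    with B obtain M2 where 2: "exec w (While r p) (fst s1, M1) n (fst s2, M2)" "\<forall>a. M1 a = snd s1 a \<longrightarrow> M2 a = snd s2 a"
      by (rule readsE)
    have "exec w (While r p) (fst s, M) (Suc (m + n)) (fst s2, M2)"
      by (rule exec.WhileTrue[OF _ 1(1) 2(1)]) (use WhileTrue.hyps in simp)
    then show "\<exists>M'. exec w (While r p) (fst s, M) (Suc (m + n)) (fst s2, M') \<and> (\<forall>a. M a = snd s a \<longrightarrow> M' a = snd s2 a)"
      using 1(2) 2(2) by blast
  qed
next
  case (WhileFalse s r p)
  show ?case
  proof (intro exI[of _ "{}"] readsI)
    fix M
    have "exec w (While r p) (fst s, M) 1 (fst s, M)"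
      by (rule exec.WhileFalse) (use WhileFalse in simp)
    then show "\<exists>M'. exec w (While r p) (fst s, M) 1 (fst s, M') \<and> (\<forall>a. M a = snd s a \<longrightarrow> M' a = snd s a)"
      by blast
  qed auto
qed


text \<open>With fewer steps than candidate cells, one candidate is never read, by the pigeonhole
  principle. Changing it alone cannot change the registers, hence not the verdict.\<close>

lemma unread_position:
  assumes "exec w p (init_state xs) n s" "n < card I"
  shows "\<exists>i\<in>I. \<forall>ys. length ys = length xs \<longrightarrow> (\<forall>j<length xs. j \<noteq> i \<longrightarrow> ys ! j = xs ! j) \<longrightarrow>
       (\<exists>s'. exec w p (init_state ys) n s' \<and> (accepting s' \<longleftrightarrow> accepting s))"
proof -
  obtain A where A: "reads w p (init_state xs) n s A" using exec_reads[OF assms(1)] by auto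
  have "finite I" using assms(2) by (metis card.infinite not_less_zero)
  have "\<not> I \<subseteq> A" using card_mono[of A I] readsD[OF A] assms(2) by linarith
  then obtain i where i: "i \<in> I" "i \<notin> A" by auto
  show ?thesis
  proof (intro bexI[OF _ i(1)] allI impI)
    fix ys :: "nat list" assume ys: "length ys = length xs" "\<forall>j<length xs. j \<noteq> i \<longrightarrow> ys ! j = xs ! j"
    have "\<forall>a\<in>A. snd (init_state ys) a = snd (init_state xs) a"
      using i ys by (auto simp: init_state_def)
    with A obtain M' where "exec w p (fst (init_state xs), snd (init_state ys)) n (fst s, M')"
      by (rule readsE)
    then have "exec w p (init_state ys) n (fst s, M')" by (simp add: init_state_def)
    then show "\<exists>s'. exec w p (init_state ys) n s' \<and> (accepting s' \<longleftrightarrow> accepting s)"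
      by (intro exI[of _ "(fst s, M')"]) (simp add: accepting_def)
  qed
qed

section \<open>Word length of an instance and membership in the class\<close>

lemma word_length_max:
  assumes "\<And>y. y \<in> set ys \<Longrightarrow> y \<le> t" "n \<le> t"
  shows "word_length c ([t, n] @ ys) = c * (floor_log (max (length ys + 2) t) + 1)"
proof -
  have "Max (set (length ([t, n] @ ys) # [t, n] @ ys)) = max (length ys + 2) t"
    by (rule Max_eqI) (use assms(2) in \<open>auto simp: max_def dest!: assms(1)\<close>)
  then show ?thesis by (simp only: word_length_def)
qed

text \<open>Sizes are chosen as powers of \<open>m\<close>, whereas the class is defined by powers
  of the number \<open>n\<close> of elements. The passage costs \<open>3 powr e\<close>, which
  \<open>3 powr S\<close> bounds uniformly for all three exponents when \<open>S\<close> is their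
  sum.\<close>

lemma ratio_bounds:
  fixes m n q c e S :: real
  assumes "0 < m" "m \<le> n" "n \<le> 3 * m" "0 \<le> e" "e \<le> S" "1 \<le> c" "m powr e / c \<le> q" "q \<le> c * m powr e"
  shows "q / n powr e \<in> {1 / (c * 3 powr S)..c * 3 powr S}"
proof -
  have n: "m powr e \<le> n powr e" "n powr e \<le> 3 powr e * m powr e"
    using assms powr_mono2[of e n "3 * m"] by (auto intro: powr_mono2 simp: powr_mult)
  have S: "3 powr e \<le> 3 powr S" "1 \<le> (3::real) powr S" using assms by (auto intro: powr_mono ge_one_powr_ge_zero)
  have pos: "0 < m powr e" "0 < n powr e" using assms by auto
  have "q \<le> c * n powr e" using assms(6,8) n(1) by (meson dual_order.trans mult_left_mono zero_le_one)
  then have "q / n powr e \<le> c * 1" using pos by (simp add: divide_le_eq)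
  also have "\<dots> \<le> c * 3 powr S" using S assms by (intro mult_left_mono) auto
  finally have 1: "q / n powr e \<le> c * 3 powr S" .
  have "n powr e \<le> 3 powr S * m powr e" using n(2) S(1) pos by (meson dual_order.trans mult_right_mono less_imp_le)
  also have "\<dots> \<le> 3 powr S * (q * c)" using assms(6,7) by (intro mult_left_mono) (auto simp: divide_le_eq)
  finally have "1 * n powr e \<le> q * (c * 3 powr S)" by (simp add: mult_ac)
  then have "1 / (c * 3 powr S) \<le> q / n powr e"
    using assms(6) pos by (simp add: divide_simps mult_ac)
  with 1 show ?thesis by auto
qed

lemma subset_sum_classI:
  fixes m :: nat and c \<tau> \<xi> \<sigma> :: real
  assumes "finite X" "\<And>x. x \<in> X \<Longrightarrow> 0 < x" "0 < m" "m \<le> card X" "card X \<le> 3 * m" "1 \<le> c"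
    "0 \<le> \<tau>" "0 \<le> \<xi>" "0 \<le> \<sigma>"
    "real m powr \<tau> / c \<le> t" "t \<le> c * real m powr \<tau>"
    "real m powr \<xi> / c \<le> Max X" "Max X \<le> c * real m powr \<xi>"
    "real m powr \<sigma> / c \<le> \<Sum>X" "\<Sum>X \<le> c * real m powr \<sigma>"
  shows "(X, t) \<in> subset_sum_class (c * 3 powr (\<tau> + \<xi> + \<sigma>)) \<tau> \<xi> \<sigma>"
proof -
  have n: "real (card X) \<le> 3 * real m" using assms(5) by linarith
  note r = ratio_bounds[of "real m" "real (card X)" _ "\<tau> + \<xi> + \<sigma>" c]
  show ?thesis
    unfolding subset_sum_class_def subset_sum_instances_def
    using r[of \<tau> t] r[of \<xi> "Max X"] r[of \<sigma> "\<Sum>X"] n assms by simp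
qed


lemma nat_ceiling_bounds:
  fixes x :: real
  assumes "1 \<le> x"
  shows "x \<le> real (nat \<lceil>x\<rceil>)" "real (nat \<lceil>x\<rceil>) \<le> 2 * x" "1 \<le> nat \<lceil>x\<rceil>"
    "x \<le> real y \<Longrightarrow> nat \<lceil>x\<rceil> \<le> y"
  using assms by linarith+

text \<open>\<open>m\<close> small numbers from \<open>2 * a\<close> on and \<open>s\<close> fillers
  from \<open>2 * H\<close> on, all even, with the fillers summing to one less than the target. The
  bounds \<open>m \<le> a\<close> and \<open>2 * a \<le> H\<close> keep the two blocks
  disjoint.\<close>

locale hidden_one =
  fixes m s a H :: nat
  assumes m: "2 \<le> m" and s: "1 \<le> s" "s \<le> m" and a: "m \<le> a" and H: "2 * a \<le> H"
begin

definition "elem r j = (if j = r then 1 else if j < m then 2 * (a + j) else 2 * (H + (j - m)))"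
definition "X r = elem r ` {..<m + s}"
definition "t = (\<Sum>i<s. 2 * (H + i)) + 1"
definition "enc r = [t, m + s] @ map (elem r) [0..<m + s]"
text \<open>The number replaced by 1 must not be a filler; an index beyond the list means that
  nothing is replaced.\<close>

definition "valid r \<longleftrightarrow> r < m \<or> m + s \<le> r"

lemma inj_elem: "inj_on (elem r) {..<m + s}"
proof (rule inj_onI)
  fix x y assume e: "elem r x = elem r y"
  have "even (elem r z) \<longleftrightarrow> z \<noteq> r" for z by (simp add: elem_def)
  then have "x = r \<longleftrightarrow> y = r" using e by metis
  then show "x = y" using e H a m by (cases "x = r") (auto simp: elem_def split: if_splits)
qed

lemma card_X: "card (X r) = m + s" by (simp add: X_def card_image[OF inj_elem])

lemma finite_X: "finite (X r)" by (simp add: X_def)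

lemma enc: "enc r \<in> subset_sum_encodings (X r, t)"
proof -
  have "distinct (map (elem r) [0..<m + s])" "set (map (elem r) [0..<m + s]) = X r"
    using inj_elem by (auto simp: distinct_map X_def atLeast0LessThan)
  then show ?thesis unfolding subset_sum_encodings_def enc_def by (auto simp: card_X)
qed

lemma t_bounds: "2 * s * H \<le> t" "t \<le> 2 * s * (H + s) + 1"
proof -
  have "(\<Sum>i<s. 2 * H) \<le> (\<Sum>i<s. 2 * (H + i))" by (intro sum_mono) auto
  then show "2 * s * H \<le> t" by (simp add: t_def mult_ac)
  have "(\<Sum>i<s. 2 * (H + i)) \<le> (\<Sum>i<s. 2 * (H + s))" by (intro sum_mono) auto
  then show "t \<le> 2 * s * (H + s) + 1" by (simp add: t_def mult_ac)
qed

lemma H_le_t: "2 * H \<le> t"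
  using t_bounds(1) s(1) by (metis le_trans mult.commute mult.right_neutral mult_le_mono2 mult.assoc)

lemma elem_le_t: assumes "j < m + s" shows "elem r j \<le> t"
proof -
  consider "j = r" | "j \<noteq> r" "j < m" | "j \<noteq> r" "m \<le> j" by linarith
  then show ?thesis
  proof cases
    case 3
    have "2 * (H + (j - m)) \<le> (\<Sum>i<s. 2 * (H + i))"
      using member_le_sum[of "j - m" "{..<s}" "\<lambda>i. 2 * (H + i)"] 3 assms by auto
    then show ?thesis using 3 by (simp add: elem_def t_def)
  qed (use H_le_t H a in \<open>auto simp: elem_def t_def\<close>)
qed

text \<open>The target is fixed and dominates every element, so replacing an element leaves the word
  length, and with it the machine, unchanged.\<close>

lemma word_length_enc: "word_length c (enc r) = word_length c (enc r')"
proof -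
  have "m + s \<le> t" using H_le_t H a s by linarith
  then have "word_length c (enc r) = c * (floor_log (max (m + s + 2) t) + 1)" for r
    unfolding enc_def by (subst word_length_max) (auto simp: elem_le_t)
  then show ?thesis by simp
qed

lemma Max_X: assumes "valid r" shows "2 * H \<le> Max (X r)" "Max (X r) \<le> 2 * (H + s)"
proof -
  have "elem r m = 2 * H" using assms s by (auto simp: elem_def valid_def)
  moreover have "elem r m \<in> X r" using s by (auto simp: X_def)
  ultimately show "2 * H \<le> Max (X r)" using finite_X Max_ge by metis
  have "x \<le> 2 * (H + s)" if "x \<in> X r" for x
    using that H a s by (auto simp: X_def elem_def)
  moreover have "X r \<noteq> {}" using s by (auto simp: X_def lessThan_empty_iff)
  ultimately show "Max (X r) \<le> 2 * (H + s)" using finite_X by (intro Max.boundedI) auto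
qed

lemma sum_X: assumes "valid r" shows "m * a \<le> \<Sum>(X r)" "\<Sum>(X r) \<le> 4 * (m * a) + t"
proof -
  have "\<Sum>(X r) = (\<Sum>j\<in>{..<m + s}. elem r j)" by (simp add: X_def sum.reindex[OF inj_elem])
  also have "{..<m + s} = {..<m} \<union> {m..<m + s}" by auto
  also have "(\<Sum>j\<in>{..<m} \<union> {m..<m + s}. elem r j) = (\<Sum>j<m. elem r j) + (\<Sum>j\<in>{m..<m + s}. elem r j)"
    by (rule sum.union_disjoint) auto
  also have "(\<Sum>j\<in>{m..<m + s}. elem r j) = (\<Sum>i<s. elem r (i + m))"
    using sum.shift_bounds_nat_ivl[of "elem r" 0 m s] by (simp add: add.commute atLeast0LessThan)
  also have "\<dots> = (\<Sum>i<s. 2 * (H + i))"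
    using assms by (intro sum.cong) (auto simp: elem_def valid_def)
  finally have eq: "\<Sum>(X r) = (\<Sum>j<m. elem r j) + (\<Sum>i<s. 2 * (H + i))" .
  have "(\<Sum>j<m. elem r j) \<le> (\<Sum>j<m. 4 * a)" using a m by (intro sum_mono) (auto simp: elem_def)
  then show "\<Sum>(X r) \<le> 4 * (m * a) + t" unfolding eq t_def by (simp add: mult_ac)
  have "(\<Sum>j\<in>{..<m} - {r}. 2 * a) \<le> (\<Sum>j\<in>{..<m} - {r}. elem r j)" by (intro sum_mono) (auto simp: elem_def)
  also have "\<dots> \<le> (\<Sum>j<m. elem r j)" by (intro sum_mono2) auto
  finally have 1: "card ({..<m} - {r}) * (2 * a) \<le> (\<Sum>j<m. elem r j)" by simp
  have "m \<le> 2 * card ({..<m} - {r})" using m by (cases "r < m") auto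
  then have "m * a \<le> 2 * card ({..<m} - {r}) * a" by (rule mult_right_mono) simp
  also have "\<dots> = card ({..<m} - {r}) * (2 * a)" by simp
  also note 1
  finally show "m * a \<le> \<Sum>(X r)" unfolding eq by linarith
qed

lemma no: assumes "m + s \<le> r" shows "\<not> subset_sum_yes (X r, t)"
proof -
  have "even x" if "x \<in> X r" for x
    using that assms by (auto simp: X_def elem_def)
  then have ev: "even (\<Sum>Y)" if "Y \<subseteq> X r" for Y
    using that by (intro dvd_sum) blast
  have "even (\<Sum>i<s. 2 * (H + i))" by (rule dvd_sum) simp
  then have "odd t" by (simp add: t_def)
  show ?thesis
  proof
    assume "subset_sum_yes (X r, t)"
    then obtain Y where Y: "Y \<subseteq> X r" "\<Sum>Y = t" unfolding subset_sum_yes_def by auto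
    show False using ev[OF Y(1)] \<open>odd t\<close> unfolding Y(2) by (rule notE[rotated])
  qed
qed

lemma yes: assumes "r < m" shows "subset_sum_yes (X r, t)"
proof -
  let ?J = "insert r {m..<m + s}"
  have J: "?J \<subseteq> {..<m + s}" using assms by auto
  have "\<Sum>(elem r ` ?J) = (\<Sum>j\<in>?J. elem r j)" 
    using sum.reindex[OF inj_on_subset[OF inj_elem J], of "\<lambda>x. x" r] by (simp del: image_insert)
  also have "\<dots> = 1 + (\<Sum>j\<in>{m..<m + s}. elem r j)" using assms by (simp add: elem_def)
  also have "(\<Sum>j\<in>{m..<m + s}. elem r j) = (\<Sum>i<s. elem r (i + m))"
    using sum.shift_bounds_nat_ivl[of "elem r" 0 m s] by (simp add: add.commute atLeast0LessThan)
  also have "\<dots> = (\<Sum>i<s. 2 * (H + i))"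
    using assms by (intro sum.cong) (auto simp: elem_def)
  finally have 1: "\<Sum>(elem r ` ?J) = t" by (simp add: t_def)
  have 2: "elem r ` ?J \<subseteq> X r" unfolding X_def by (rule image_mono[OF J])
  show ?thesis unfolding subset_sum_yes_def case_prod_conv
    by (rule exI, rule conjI[OF 2 1])
qed

text \<open>The rejecting run on the even instance misses the cell of some small number. The
  instance with 1 in that cell is rejected by a run of the same length, but \<open>solves\<close>
  provides an accepting one, against determinism.\<close>

lemma adversary:
  assumes "exec (word_length c (enc (m + s))) p (init_state (enc (m + s))) n0 s0" "n0 < m" "\<not> accepting s0"
    and solves: "\<And>r. r < m \<Longrightarrow>
      \<exists>n s'. exec (word_length c (enc r)) p (init_state (enc r)) n s' \<and> accepting s'"
  shows False
proof -
  \<comment> \<open>Cells 0 and 1 hold the target and the number of elements.\<close>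
  have "n0 < card {2..<2 + m}" using assms(2) by simp
  from unread_position[OF assms(1) this] obtain i where i: "i \<in> {2..<2 + m}"
    "\<forall>ys. length ys = length (enc (m + s)) \<longrightarrow>
      (\<forall>j < length (enc (m + s)). j \<noteq> i \<longrightarrow> ys ! j = enc (m + s) ! j) \<longrightarrow>
      (\<exists>s'. exec (word_length c (enc (m + s))) p (init_state ys) n0 s' \<and> (accepting s' \<longleftrightarrow> accepting s0))"
    by (elim bexE)
  define r where "r = i - 2"
  have r: "r < m" "i = r + 2" using i(1) by (auto simp: r_def)
  have "enc r ! j = enc (m + s) ! j" if "j < length (enc (m + s))" "j \<noteq> i" for j
    using that r by (auto simp: enc_def nth_Cons elem_def split: nat.splits)
  moreover have "length (enc r) = length (enc (m + s))" by (simp add: enc_def)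
  ultimately obtain s1 where s1: "exec (word_length c (enc (m + s))) p (init_state (enc r)) n0 s1" "\<not> accepting s1"
    using i(2)[rule_format, of "enc r"] assms(3) by auto
  obtain n2 s2 where s2: "exec (word_length c (enc r)) p (init_state (enc r)) n2 s2" "accepting s2"
    using solves[OF r(1)] by auto
  have "s2 = s1" using exec_deterministic[OF s1(1)] s2(1) word_length_enc[of c r "m + s"] by metis
  then show False using s1 s2 by simp
qed

end


lemma no_sublinear_algorithm:
  fixes \<tau> \<xi> \<sigma> \<gamma> :: real
  assumes "nontrivial_setting \<tau> \<xi> \<sigma>" "\<gamma> < 1"
  shows "\<not> solvable_in_time (subset_sum_class (64 * 3 powr (\<tau> + \<xi> + \<sigma>)) \<tau> \<xi> \<sigma>) subset_sum_encodings
    subset_sum_yes (\<lambda>(X, t). real (card X) powr \<gamma>)"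
proof
  have par: "2 \<le> \<sigma>" "1 \<le> \<xi>" "\<xi> \<le> \<tau>" "\<tau> \<le> \<sigma>" "\<sigma> \<le> 1 + \<xi>"
    using assms(1) by (auto simp: nontrivial_setting_def)
  assume "solvable_in_time (subset_sum_class (64 * 3 powr (\<tau> + \<xi> + \<sigma>)) \<tau> \<xi> \<sigma>) subset_sum_encodings
    subset_sum_yes (\<lambda>(X, t). real (card X) powr \<gamma>)"
  then obtain p c C where C: "0 < C" and solves: "\<And>X t xs. (X, t) \<in> subset_sum_class (64 * 3 powr (\<tau> + \<xi> + \<sigma>)) \<tau> \<xi> \<sigma> \<Longrightarrow>
      xs \<in> subset_sum_encodings (X, t) \<Longrightarrow> \<exists>n s. exec (word_length c xs) p (init_state xs) n s \<and>
        real n \<le> C * real (card X) powr \<gamma> \<and> (accepting s \<longleftrightarrow> subset_sum_yes (X, t))"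
    unfolding solvable_in_time_def by fastforce
  \<comment> \<open>Here \<open>1 - \<delta> = max \<gamma> 0\<close>, since \<open>\<gamma>\<close>
    may be negative while monotonicity in the base needs a nonnegative exponent.\<close>
  define \<delta> where "\<delta> = 1 - max \<gamma> 0"
  have \<delta>: "0 < \<delta>" "\<delta> \<le> 1" using assms(2) by (auto simp: \<delta>_def)
  \<comment> \<open>So large that \<open>2 * C < m powr \<delta>\<close>; an instance with at most
    \<open>2 * m\<close> numbers is then decided in fewer than \<open>m\<close> steps.\<close>
  obtain m :: nat where m0: "max 2 ((2 * C) powr (1 / \<delta>) + 1) \<le> real m" using real_arch_simple by blast
  then have m: "2 \<le> m" "1 \<le> real m" by auto
  have "2 * C = ((2 * C) powr (1 / \<delta>)) powr \<delta>" using C \<delta> by (simp add: powr_powr)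
  also have "\<dots> < real m powr \<delta>" using m0 C \<delta> by (intro powr_less_mono2) auto
  finally have mC: "2 * C < real m powr \<delta>" .
  \<comment> \<open>\<open>s * H\<close>, \<open>H\<close> and \<open>m * a\<close> have the orders
    of target, maximum and sum. From \<open>\<tau> - \<xi> \<le> 1\<close> follows
    \<open>s \<le> m\<close>, and from \<open>\<sigma> \<le> 1 + \<xi>\<close> with the factor 8
    follows \<open>2 * a \<le> H\<close>.\<close>
  define s where "s = nat \<lceil>real m powr (\<tau> - \<xi>)\<rceil>"
  define a where "a = nat \<lceil>real m powr (\<sigma> - 1)\<rceil>"
  define H where "H = nat \<lceil>8 * real m powr \<xi>\<rceil>"
  have p1: "1 \<le> real m powr (\<tau> - \<xi>)" "1 \<le> real m powr (\<sigma> - 1)" "1 \<le> real m powr \<xi>"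
    using par m by (auto intro: ge_one_powr_ge_zero)
  then have p8: "1 \<le> 8 * real m powr \<xi>" by linarith
  have mle: "real m powr (\<tau> - \<xi>) \<le> real m" "real m \<le> real m powr (\<sigma> - 1)"
    "real m powr (\<sigma> - 1) \<le> real m powr \<xi>" "real m \<le> real m powr \<xi>" "real m powr \<tau> \<le> real m powr \<sigma>"
    using par m powr_mono[of "\<tau> - \<xi>" 1 "real m"] powr_mono[of 1 "\<sigma> - 1" "real m"] powr_mono[of 1 \<xi> "real m"]
    by (auto intro: powr_mono)
  have sb: "real m powr (\<tau> - \<xi>) \<le> s" "s \<le> 2 * real m powr (\<tau> - \<xi>)" "1 \<le> s" "s \<le> m"
    unfolding s_def using nat_ceiling_bounds[OF p1(1)] mle(1) by blast+
  have ab: "real m powr (\<sigma> - 1) \<le> a" "a \<le> 2 * real m powr (\<sigma> - 1)"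
    unfolding a_def using nat_ceiling_bounds[OF p1(2)] by blast+
  have Hb: "8 * real m powr \<xi> \<le> H" "H \<le> 9 * real m powr \<xi>"
    unfolding H_def using p1(3) by linarith+
  have am: "m \<le> a" "2 * a \<le> H" using ab Hb mle by linarith+
  interpret hidden_one m s a H
    by unfold_locales (use m sb am in auto)
  have pp: "real m powr (\<tau> - \<xi>) * real m powr \<xi> = real m powr \<tau>" "real m * real m powr (\<sigma> - 1) = real m powr \<sigma>"
    using m by (simp_all add: powr_add[symmetric] powr_mult_base)
  have t1: "real m powr \<tau> \<le> t"
  proof -
    have "real m powr \<tau> \<le> s * real H" unfolding pp[symmetric] using sb Hb p1 by (intro mult_mono) auto
    also have "\<dots> \<le> real (2 * s * H)" by simp
    also have "\<dots> \<le> t" using t_bounds(1) of_nat_le_iff by blast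
    finally show ?thesis .
  qed
  have t2: "real t \<le> 41 * real m powr \<tau>"
  proof -
    have "real t \<le> real (2 * s * (H + s) + 1)" using t_bounds(2) of_nat_le_iff by blast
    also have "\<dots> = 2 * (real s * (real H + real s)) + 1" by simp
    also have "real s * (real H + real s) \<le> (2 * real m powr (\<tau> - \<xi>)) * (10 * real m powr \<xi>)"
      using sb Hb mle p1 by (intro mult_mono) auto
    also have "\<dots> = 20 * real m powr \<tau>" unfolding pp[symmetric] by simp
    also have "1 \<le> real m powr \<tau>" using par m by (intro ge_one_powr_ge_zero) auto
    finally show ?thesis by simp
  qed
  have cls: "(X r, t) \<in> subset_sum_class (64 * 3 powr (\<tau> + \<xi> + \<sigma>)) \<tau> \<xi> \<sigma>" if r: "valid r" for r
  proof (rule subset_sum_classI[of _ m])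
    show "0 < x" if "x \<in> X r" for x using that am m by (auto simp: X_def elem_def)
    show "m \<le> card (X r)" "card (X r) \<le> 3 * m" using sb by (auto simp: card_X)
    have "real (2 * H) \<le> real (Max (X r))" "real (Max (X r)) \<le> real (2 * (H + s))"
      using Max_X[OF r] of_nat_le_iff by blast+
    then show "real m powr \<xi> / 64 \<le> Max (X r)" "Max (X r) \<le> 64 * real m powr \<xi>"
      using Hb sb mle p1 by auto
    have S: "real (m * a) \<le> real (\<Sum>(X r))" "real (\<Sum>(X r)) \<le> real (4 * (m * a) + t)"
      using sum_X[OF r] of_nat_le_iff by blast+
    have "real m powr \<sigma> / 64 \<le> real m powr \<sigma>" by simp
    also have "\<dots> \<le> real m * real a" unfolding pp[symmetric] using ab by (intro mult_left_mono) auto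
    also have "\<dots> = real (m * a)" by simp
    also note S(1)
    finally show "real m powr \<sigma> / 64 \<le> \<Sum>(X r)" .
    have "real m * real a \<le> real m * (2 * real m powr (\<sigma> - 1))" using ab by (intro mult_left_mono) auto
    also have "\<dots> = 2 * real m powr \<sigma>" unfolding pp[symmetric] by simp
    finally have "real (4 * (m * a) + t) \<le> 8 * real m powr \<sigma> + 41 * real m powr \<tau>" using t2 by simp
    also have "\<dots> \<le> 64 * real m powr \<sigma>" using mle(5) powr_ge_zero[of "real m" \<tau>] by linarith
    finally show "real (\<Sum>(X r)) \<le> 64 * real m powr \<sigma>" using S(2) by linarith
    show "real m powr \<tau> / 64 \<le> t" "real t \<le> 64 * real m powr \<tau>" using t1 t2 by auto
  qed (use m par finite_X in auto)
  have vn: "valid (m + s)" by (simp add: valid_def)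
  obtain n0 s0 where e: "exec (word_length c (enc (m + s))) p (init_state (enc (m + s))) n0 s0"
    "real n0 \<le> C * real (card (X (m + s))) powr \<gamma>" "accepting s0 \<longleftrightarrow> subset_sum_yes (X (m + s), t)"
    using solves[OF cls[OF vn] enc] by blast
  have "real (card (X (m + s))) powr \<gamma> \<le> real (m + s) powr (1 - \<delta>)"
    unfolding card_X \<delta>_def using m by (intro powr_mono) auto
  also have "\<dots> \<le> (2 * real m) powr (1 - \<delta>)" using sb \<delta> by (intro powr_mono2) auto
  also have "\<dots> = 2 powr (1 - \<delta>) * real m powr (1 - \<delta>)" by (simp add: powr_mult)
  also have "\<dots> \<le> 2 * real m powr (1 - \<delta>)"
    using \<delta> powr_mono[of "1 - \<delta>" 1 "2::real"] by (intro mult_right_mono) auto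
  finally have "C * real (card (X (m + s))) powr \<gamma> \<le> C * (2 * real m powr (1 - \<delta>))"
    using C by (intro mult_left_mono) auto
  also have "\<dots> = 2 * C * real m powr (1 - \<delta>)" by simp
  also have "\<dots> < real m powr \<delta> * real m powr (1 - \<delta>)" using mC m by (intro mult_strict_right_mono) auto
  also have "\<dots> = real m" using m by (simp add: powr_add[symmetric])
  finally have n0: "n0 < m" using e(2) by linarith
  show False
  proof (rule adversary[OF e(1) n0])
    show "\<not> accepting s0" using e(3) no[of "m + s"] by simp
    fix r assume r: "r < m"
    then have "valid r" by (simp add: valid_def)
    then show "\<exists>n s'. exec (word_length c (enc r)) p (init_state (enc r)) n s' \<and> accepting s'"
      using solves[OF cls enc, of r] yes[OF r] by blast
  qed
qed

section \<open>Asking the assumed algorithm\<close>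

abbreviation aAdd (infixl "\<oplus>" 65) where "a \<oplus> b \<equiv> Bin Add a b"
abbreviation aSub (infixl "\<ominus>" 65) where "a \<ominus> b \<equiv> Bin Sub a b"
abbreviation aMul (infixl "\<otimes>" 70) where "a \<otimes> b \<equiv> Bin Mul a b"
abbreviation aDiv (infixl "\<oslash>" 70) where "a \<oslash> b \<equiv> Bin Div a b"

primrec assigns :: "nat \<Rightarrow> (nat \<times> aexp) list \<Rightarrow> com" where
  "assigns S [] = Skip"
| "assigns S (u # us) = Seq (assign S (fst u) (snd u)) (assigns S us)"

primrec upds :: "nat \<Rightarrow> (nat \<times> aexp) list \<Rightarrow> state \<Rightarrow> state" where
  "upds w [] s = s"
| "upds w (u # us) s = upds w us ((fst s)(fst u := aval w (snd u) s), snd s)"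

primrec upds_cost :: "(nat \<times> aexp) list \<Rightarrow> nat" where
  "upds_cost [] = 1"
| "upds_cost (u # us) = cost (snd u) + 1 + upds_cost us"

lemma wp_assigns:
  assumes "\<forall>u\<in>set us. fst u < S \<and> regs_below S (snd u)" "Q (upds_cost us) (upds w us s)"
  shows "wp w S (assigns S us) Q s"
  using assms
proof (induction us arbitrary: s Q)
  case Nil
  then show ?case by (auto intro: wp_Skip)
next
  case (Cons u us)
  show ?case unfolding assigns.simps
  proof (rule wp_Seq, rule wp_assign)
    show "wp w S (assigns S us) (\<lambda>n'. Q (cost (snd u) + 1 + n')) ((fst s)(fst u := aval w (snd u) s), snd s)"
      by (rule Cons.IH) (use Cons.prems in auto)
  qed (use Cons.prems in auto)
qed

primrec clear :: "nat \<Rightarrow> nat \<Rightarrow> com" where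
  "clear S 0 = Skip"
| "clear S (Suc r) = Seq (clear S r) (assign S (zone + r) (Lit 0))"

lemma wp_clear:
  assumes "zone + nr \<le> S"
  shows "wp w S (clear S nr) (\<lambda>n s'. n = 1 + 2 * nr \<and> snd s' = snd s \<and> (\<forall>x<zone. fst s' x = fst s x) \<and>
    (\<forall>r<nr. fst s' (zone + r) = 0)) s"
  using assms
proof (induction nr)
  case 0
  then show ?case by (auto intro: wp_Skip)
next
  case (Suc r)
  have "wp w S (clear S r) (\<lambda>n s'. n = 1 + 2 * r \<and> snd s' = snd s \<and> (\<forall>x<zone. fst s' x = fst s x) \<and>
    (\<forall>i<r. fst s' (zone + i) = 0)) s" using Suc by auto
  then show ?case unfolding clear.simps
  proof (rule wp_Seq[OF wp_mono], goal_cases)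
    case (1 n s1)
    show ?case by (rule wp_assign) (use 1 Suc.prems in \<open>auto simp: less_Suc_eq\<close>)
  qed
qed

definition bounded :: "nat \<Rightarrow> state \<Rightarrow> bool" where
  "bounded w s \<longleftrightarrow> (\<forall>x<zone. fst s x < 2 ^ w)"

lemma boundedD: "bounded w s \<Longrightarrow> x < zone \<Longrightarrow> fst s x < 2 ^ w"
  by (simp add: bounded_def)

lemma bounded_mod: "bounded w s \<Longrightarrow> x < zone \<Longrightarrow> fst s x mod 2 ^ w = fst s x"
  by (simp add: bounded_def)

lemma bounded_upd: "bounded w s \<Longrightarrow> v < 2 ^ w \<Longrightarrow> bounded w ((fst s)(x := v), M)"
  by (simp add: bounded_def)

lemma bounded_upds: "bounded w s \<Longrightarrow> bounded w (upds w us s)"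
  by (induction us arbitrary: s) (simp_all add: bounded_upd)

text \<open>
  Registers: 0 verdict, 1 U, 2 T, 3 N, 4 bit length of U, 5 number of candidates for each exponent,
  6 step limit F, 7 size of a memory region, 9 round h, 10 number of rounds, 11 \<open>\<kappa>\<close>, 12 remaining
  target, 13 z, 14 guess, 15 m, 16 s, 17 \<open>\<phi>\<close>, 18 a, 19 E, 20 simulated modulus, 21 d, 22 H, 23 G,
  24 base address, 25 n, 26 t, 27 index, 28 element, 29 fuel, 30 to 32 exponents of s, \<open>\<phi>\<close> and E,
  34 and 35 the query, 36 \<open>k N\<close>, from 40 on the registers of the assumed algorithm.
\<close>

abbreviation size_exp :: aexp where
  "size_exp \<equiv> Reg 15 \<oplus> Reg 16 \<oplus> Reg 34 \<otimes> Reg 3"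

text \<open>Closed form of the gadget target, with \<open>\<kappa>\<close> and the k-Sum target in
  registers 34 and 35; the two halved terms are the sums of the filler indices and of the
  colours.\<close>

definition target_exp :: aexp where
  "target_exp = Reg 16 \<otimes> (Reg 21 \<otimes> Reg 22 \<oplus> Lit 4 \<otimes> Reg 17)
    \<oplus> Reg 21 \<otimes> ((Reg 16 \<otimes> Reg 16 \<ominus> Reg 16) \<oslash> Lit 2)
    \<oplus> Reg 34 \<otimes> (Reg 21 \<otimes> Reg 19 \<oplus> Lit 1)
    \<oplus> Reg 21 \<otimes> (Reg 23 \<otimes> ((Reg 34 \<otimes> Reg 34 \<ominus> Reg 34) \<oslash> Lit 2))
    \<oplus> Reg 21 \<otimes> Reg 35"

lemma target_exp_simps: "zone \<le> S \<Longrightarrow> regs_below S target_exp" "cost target_exp \<le> 60"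
  by (simp_all add: target_exp_def)

definition fill_body :: "nat \<Rightarrow> com" where
  "fill_body S = Seq
    (ifte S (Bin Less (Reg 27) (Reg 15))
      (assigns S [(28, Reg 21 \<otimes> (Reg 18 \<oplus> Reg 27))])
      (ifte S (Bin Less (Reg 27) (Reg 15 \<oplus> Reg 16))
        (assigns S [(28, Reg 21 \<otimes> (Reg 22 \<oplus> (Reg 27 \<ominus> Reg 15)) \<oplus> Lit 4 \<otimes> Reg 17)])
        (assigns S [(33, Reg 27 \<ominus> (Reg 15 \<oplus> Reg 16)),
          (28, Reg 21 \<otimes> (Reg 19 \<oplus> Reg 23 \<otimes> (Reg 33 \<oslash> Reg 3) \<oplus> Mem (Lit 3 \<oplus> Bin Mod (Reg 33) (Reg 3))) \<oplus> Lit 1)])))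
    (Seq (store S (Reg 24 \<oplus> Lit 2 \<oplus> Reg 27) (Reg 28)) (assigns S [(27, Reg 27 \<oplus> Lit 1)]))"

text \<open>Reduced modulo \<open>2 ^ w\<close>, so that it describes what is written even under a
  wrong guess, where numbers may overflow.\<close>

definition elem_val :: "nat \<Rightarrow> state \<Rightarrow> nat \<Rightarrow> nat" where
  "elem_val w s l = (let R = fst s; q = l - (R 15 + R 16) in
    if l < R 15 then R 21 * (R 18 + l)
    else if l < R 15 + R 16 then R 21 * (R 22 + (l - R 15)) + 4 * R 17
    else R 21 * (R 19 + R 23 * (q div R 3) + snd s (3 + q mod R 3)) + 1) mod 2 ^ w"

definition fill :: "nat \<Rightarrow> com" where
  "fill S = Seq (assigns S [(27, Lit 0)]) (loop S (Bin Less (Reg 27) (Reg 25)) (fill_body S))"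

lemma wp_fill_body:
  assumes S: "zone \<le> S" and b: "bounded w s"
    and l: "fst s 27 < fst s 15 + fst s 16 + fst s 34 * fst s 3"
    and fit: "fst s 24 + 2 + (fst s 15 + fst s 16 + fst s 34 * fst s 3) < 2 ^ w"
    and N: "fst s 3 + 3 < 2 ^ w" and w: "3 \<le> w"
  shows "wp w S (fill_body S) (\<lambda>n s'. n \<le> 50 \<and> bounded w s' \<and>
    (\<forall>x<zone. x \<notin> {27, 28, 33} \<longrightarrow> fst s' x = fst s x) \<and> fst s' 27 = fst s 27 + 1 \<and>
    snd s' = (snd s)(fst s 24 + 2 + fst s 27 := elem_val w s (fst s 27))) s"
proof -
  let ?R = "fst s"
  have w8: "(8::nat) \<le> 2 ^ w" using power_increasing[OF w, of "2::nat"] by simp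
  note m = bounded_mod[OF b]
  have ms: "(?R 15 + ?R 16) mod 2 ^ w = ?R 15 + ?R 16" using fit by (intro mod_less) linarith
  \<comment> \<open>The common tail of the three branches, from any state in which register 28 holds
    the element.\<close>
  have rest: "wp w S (Seq (store S (Reg 24 \<oplus> Lit 2 \<oplus> Reg 27) (Reg 28)) (assigns S [(27, Reg 27 \<oplus> Lit 1)]))
      (\<lambda>n s'. n0 + n \<le> 50 \<and> bounded w s' \<and>
      (\<forall>x<zone. x \<notin> {27, 28, 33} \<longrightarrow> fst s' x = fst s x) \<and> fst s' 27 = fst s 27 + 1 \<and>
      snd s' = (snd s)(fst s 24 + 2 + fst s 27 := elem_val w s (fst s 27))) s1"
    if s1: "n0 \<le> 38" "bounded w s1" "snd s1 = snd s" "\<forall>x<zone. x \<notin> {28, 33} \<longrightarrow> fst s1 x = fst s x"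
      "fst s1 28 = elem_val w s (fst s 27)" for n0 s1
  proof -
    have f: "fst s1 24 = ?R 24" "fst s1 27 = ?R 27" using s1 by auto
    have "?R 24 + 2 + ?R 27 < 2 ^ w" using fit l by linarith
    then have ad: "aval w (Reg 24 \<oplus> Lit 2 \<oplus> Reg 27) s1 = ?R 24 + 2 + ?R 27"
      using w8 w m[of 24] m[of 27] by (simp add: f mod_simps)
    have "?R 27 + 1 < 2 ^ w" using fit l by linarith
    then have inc: "aval w (Reg 27 \<oplus> Lit 1) s1 = ?R 27 + 1"
      using w8 w m[of 27] by (simp add: f mod_simps)
    have v: "aval w (Reg 28) s1 = elem_val w s (fst s 27)"
      using bounded_mod[OF s1(2), of 28] s1(5) by simp
    show ?thesis
    proof (rule wp_Seq, rule wp_store)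
      let ?s2 = "(fst s1, (snd s1)(aval w (Reg 24 \<oplus> Lit 2 \<oplus> Reg 27) s1 := aval w (Reg 28) s1))"
      have b2: "bounded w ?s2" using s1(2) by (simp add: bounded_def)
      have inc2: "aval w (Reg 27 \<oplus> Lit 1) ?s2 = ?R 27 + 1" using inc by simp
      show "wp w S (assigns S [(27, Reg 27 \<oplus> Lit 1)])
        (\<lambda>n' s'. n0 + (cost (Reg 24 \<oplus> Lit 2 \<oplus> Reg 27) + (cost (Reg 28) + 1) + n') \<le> 50 \<and> bounded w s' \<and>
          (\<forall>x<zone. x \<notin> {27, 28, 33} \<longrightarrow> fst s' x = fst s x) \<and> fst s' 27 = fst s 27 + 1 \<and>
          snd s' = (snd s)(fst s 24 + 2 + fst s 27 := elem_val w s (fst s 27))) ?s2"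
      proof (rule wp_assigns)
        have "bounded w (upds w [(27, Reg 27 \<oplus> Lit 1)] ?s2)" by (rule bounded_upds[OF b2])
        moreover have "upds w [(27, Reg 27 \<oplus> Lit 1)] ?s2 = ((fst s1)(27 := ?R 27 + 1), snd ?s2)"
          by (simp only: upds.simps fst_conv snd_conv inc2)
        ultimately show "n0 + (cost (Reg 24 \<oplus> Lit 2 \<oplus> Reg 27) + (cost (Reg 28) + 1) + upds_cost [(27, Reg 27 \<oplus> Lit 1)]) \<le> 50 \<and>
          bounded w (upds w [(27, Reg 27 \<oplus> Lit 1)] ?s2) \<and>
          (\<forall>x<zone. x \<notin> {27, 28, 33} \<longrightarrow> fst (upds w [(27, Reg 27 \<oplus> Lit 1)] ?s2) x = fst s x) \<and>
          fst (upds w [(27, Reg 27 \<oplus> Lit 1)] ?s2) 27 = fst s 27 + 1 \<and>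
          snd (upds w [(27, Reg 27 \<oplus> Lit 1)] ?s2) = (snd s)(fst s 24 + 2 + fst s 27 := elem_val w s (fst s 27))"
          unfolding ad v using s1 by simp
      qed (use S in auto)
    qed (use S in auto)
  qed
  have tst1: "aval w (Bin Less (Reg 27) (Reg 15)) s \<noteq> 0 \<longleftrightarrow> ?R 27 < ?R 15"
    using w8 by (simp add: m)
  have tst2: "aval w (Bin Less (Reg 27) (Reg 15 \<oplus> Reg 16)) s \<noteq> 0 \<longleftrightarrow> ?R 27 < ?R 15 + ?R 16"
    using w8 by (simp add: m ms)
  show ?thesis unfolding fill_body_def
  proof (rule wp_Seq, rule wp_ifte)
    assume "aval w (Bin Less (Reg 27) (Reg 15)) s \<noteq> 0"
    then have c: "?R 27 < ?R 15" using tst1 by blast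
    show "wp w S (assigns S [(28, Reg 21 \<otimes> (Reg 18 \<oplus> Reg 27))]) (\<lambda>n s'. wp w S
      (Seq (store S (Reg 24 \<oplus> Lit 2 \<oplus> Reg 27) (Reg 28)) (assigns S [(27, Reg 27 \<oplus> Lit 1)]))
      (\<lambda>n' s'. cost (Bin Less (Reg 27) (Reg 15)) + Suc n + n' \<le> 50 \<and> bounded w s' \<and>
      (\<forall>x<zone. x \<notin> {27, 28, 33} \<longrightarrow> fst s' x = fst s x) \<and> fst s' 27 = fst s 27 + 1 \<and>
      snd s' = (snd s)(fst s 24 + 2 + fst s 27 := elem_val w s (fst s 27))) s') s"
      by (rule wp_assigns, use S in simp, rule rest, simp, rule bounded_upds[OF b])
        (use c in \<open>auto simp: elem_val_def Let_def mod_simps\<close>)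
  next
    assume "aval w (Bin Less (Reg 27) (Reg 15)) s = 0"
    then have c: "\<not> ?R 27 < ?R 15" using tst1 by blast
    show "wp w S (ifte S (Bin Less (Reg 27) (Reg 15 \<oplus> Reg 16))
        (assigns S [(28, Reg 21 \<otimes> (Reg 22 \<oplus> (Reg 27 \<ominus> Reg 15)) \<oplus> Lit 4 \<otimes> Reg 17)])
        (assigns S [(33, Reg 27 \<ominus> (Reg 15 \<oplus> Reg 16)),
          (28, Reg 21 \<otimes> (Reg 19 \<oplus> Reg 23 \<otimes> (Reg 33 \<oslash> Reg 3) \<oplus> Mem (Lit 3 \<oplus> Bin Mod (Reg 33) (Reg 3))) \<oplus> Lit 1)]))
      (\<lambda>n s'. wp w S
      (Seq (store S (Reg 24 \<oplus> Lit 2 \<oplus> Reg 27) (Reg 28)) (assigns S [(27, Reg 27 \<oplus> Lit 1)]))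
      (\<lambda>n' s'. cost (Bin Less (Reg 27) (Reg 15)) + Suc n + n' \<le> 50 \<and> bounded w s' \<and>
      (\<forall>x<zone. x \<notin> {27, 28, 33} \<longrightarrow> fst s' x = fst s x) \<and> fst s' 27 = fst s 27 + 1 \<and>
      snd s' = (snd s)(fst s 24 + 2 + fst s 27 := elem_val w s (fst s 27))) s') s"
    proof (rule wp_ifte)
      assume "aval w (Bin Less (Reg 27) (Reg 15 \<oplus> Reg 16)) s \<noteq> 0"
      then have c2: "?R 27 < ?R 15 + ?R 16" using tst2 by blast
      define e where "e = ?R 27 - ?R 15"
      have sub: "aval w (Reg 27 \<ominus> Reg 15) s = e"
        using c m sub_mod_power[of "?R 15" "?R 27" w] boundedD[OF b, of 27] by (simp add: e_def)
      have ee: "elem_val w s (?R 27) = (?R 21 * (?R 22 + e) + 4 * ?R 17) mod 2 ^ w"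
        using c c2 by (simp add: elem_val_def Let_def e_def)
      have "aval w (Reg 21 \<otimes> (Reg 22 \<oplus> (Reg 27 \<ominus> Reg 15)) \<oplus> Lit 4 \<otimes> Reg 17) s = elem_val w s (?R 27)"
        unfolding aval.simps(3)[of w Add] aval.simps(3)[of w Mul] sub ee
        by (simp add: mod_simps)
      note ev = this
      show "wp w S (assigns S [(28, Reg 21 \<otimes> (Reg 22 \<oplus> (Reg 27 \<ominus> Reg 15)) \<oplus> Lit 4 \<otimes> Reg 17)])
       (\<lambda>n s'. wp w S
      (Seq (store S (Reg 24 \<oplus> Lit 2 \<oplus> Reg 27) (Reg 28)) (assigns S [(27, Reg 27 \<oplus> Lit 1)]))
      (\<lambda>n' s'. cost (Bin Less (Reg 27) (Reg 15)) + Suc (cost (Bin Less (Reg 27) (Reg 15 \<oplus> Reg 16)) + Suc n) + n' \<le> 50 \<and> bounded w s' \<and>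
      (\<forall>x<zone. x \<notin> {27, 28, 33} \<longrightarrow> fst s' x = fst s x) \<and> fst s' 27 = fst s 27 + 1 \<and>
      snd s' = (snd s)(fst s 24 + 2 + fst s 27 := elem_val w s (fst s 27))) s') s"
        by (rule wp_assigns, use S in simp, rule rest, simp, rule bounded_upds[OF b])
          (simp_all del: aval.simps add: ev)
    next
      assume "aval w (Bin Less (Reg 27) (Reg 15 \<oplus> Reg 16)) s = 0"
      then have c2: "\<not> ?R 27 < ?R 15 + ?R 16" using tst2 by blast
      define q where "q = ?R 27 - (?R 15 + ?R 16)"
      \<comment> \<open>An index past pads and fillers exists only if there are items, so the
        divisor is positive.\<close>
      have N0: "0 < ?R 3" using l c2 by (cases "?R 3 = 0") auto
      have sub: "aval w (Reg 27 \<ominus> (Reg 15 \<oplus> Reg 16)) s = q"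
        using c2 m ms sub_mod_power[of "?R 15 + ?R 16" "?R 27" w] boundedD[OF b, of 27] by (simp add: q_def)
      have qw: "q < 2 ^ w" using boundedD[OF b, of 27] by (simp add: q_def)
      let ?s1 = "((fst s)(33 := q), snd s)"
      have "q mod ?R 3 < ?R 3" using N0 by simp
      then have "3 + q mod ?R 3 < 2 ^ w" using N by linarith
      then have md: "(3 + q mod ?R 3) mod 2 ^ w = 3 + q mod ?R 3" "q mod ?R 3 mod 2 ^ w = q mod ?R 3"
         "q div ?R 3 mod 2 ^ w = q div ?R 3"
        using le_less_trans[OF div_le_dividend qw] by simp_all
      have mem: "aval w (Mem (Lit 3 \<oplus> Bin Mod (Reg 33) (Reg 3))) ?s1 = snd s (3 + q mod ?R 3) mod 2 ^ w"
        using m[of 3] qw w8 md by simp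
      have dv: "aval w (Reg 33 \<oslash> Reg 3) ?s1 = q div ?R 3" using m[of 3] qw md by simp
      have ee: "elem_val w s (?R 27) = (?R 21 * (?R 19 + ?R 23 * (q div ?R 3) + snd s (3 + q mod ?R 3)) + 1) mod 2 ^ w"
        using c c2 by (simp add: elem_val_def Let_def q_def)
      have ev: "aval w (Reg 21 \<otimes> (Reg 19 \<oplus> Reg 23 \<otimes> (Reg 33 \<oslash> Reg 3) \<oplus> Mem (Lit 3 \<oplus> Bin Mod (Reg 33) (Reg 3))) \<oplus> Lit 1) ?s1
          = elem_val w s (?R 27)"
        unfolding aval.simps(3)[of w Add] aval.simps(3)[of w Mul] mem dv ee
        by (simp add: mod_simps)
      have u: "upds w [(33, Reg 27 \<ominus> (Reg 15 \<oplus> Reg 16)),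
          (28, Reg 21 \<otimes> (Reg 19 \<oplus> Reg 23 \<otimes> (Reg 33 \<oslash> Reg 3) \<oplus> Mem (Lit 3 \<oplus> Bin Mod (Reg 33) (Reg 3))) \<oplus> Lit 1)] s
        = ((fst s)(33 := q, 28 := elem_val w s (?R 27)), snd s)"
        by (simp only: upds.simps fst_conv snd_conv sub ev)
      show "wp w S (assigns S [(33, Reg 27 \<ominus> (Reg 15 \<oplus> Reg 16)),
          (28, Reg 21 \<otimes> (Reg 19 \<oplus> Reg 23 \<otimes> (Reg 33 \<oslash> Reg 3) \<oplus> Mem (Lit 3 \<oplus> Bin Mod (Reg 33) (Reg 3))) \<oplus> Lit 1)])
       (\<lambda>n s'. wp w S
      (Seq (store S (Reg 24 \<oplus> Lit 2 \<oplus> Reg 27) (Reg 28)) (assigns S [(27, Reg 27 \<oplus> Lit 1)]))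
      (\<lambda>n' s'. cost (Bin Less (Reg 27) (Reg 15)) + Suc (cost (Bin Less (Reg 27) (Reg 15 \<oplus> Reg 16)) + Suc n) + n' \<le> 50 \<and> bounded w s' \<and>
      (\<forall>x<zone. x \<notin> {27, 28, 33} \<longrightarrow> fst s' x = fst s x) \<and> fst s' 27 = fst s 27 + 1 \<and>
      snd s' = (snd s)(fst s 24 + 2 + fst s 27 := elem_val w s (fst s 27))) s') s"
        by (rule wp_assigns, use S in simp, rule rest, simp, rule bounded_upds[OF b])
          (simp_all only: u, simp_all)
    qed (use S in auto)
  qed (use S in auto)
qed


text \<open>The assumption \<open>3 + fst s 3 \<le> fst s 24\<close> keeps the writes away from the
  input list, from which later items are still to be computed.\<close>

lemma wp_fill:
  assumes S: "zone \<le> S" and b: "bounded w s"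
    and n: "fst s 25 = fst s 15 + fst s 16 + fst s 34 * fst s 3"
    and fit: "fst s 24 + 2 + fst s 25 < 2 ^ w"
    and N: "fst s 3 + 3 < 2 ^ w" "3 + fst s 3 \<le> fst s 24" and w: "3 \<le> w"
  shows "wp w S (fill S) (\<lambda>t s'. t \<le> 7 + 54 * fst s 25 \<and> bounded w s' \<and>
    (\<forall>x<zone. x \<notin> {27, 28, 33} \<longrightarrow> fst s' x = fst s x) \<and>
    snd s' = (\<lambda>x. if fst s 24 + 2 \<le> x \<and> x < fst s 24 + 2 + fst s 25
      then elem_val w s (x - (fst s 24 + 2)) else snd s x)) s"
proof -
  define M where "M l = (\<lambda>x. if fst s 24 + 2 \<le> x \<and> x < fst s 24 + 2 + l
      then elem_val w s (x - (fst s 24 + 2)) else snd s x)" for l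
  define I where "I t s' \<longleftrightarrow> bounded w s' \<and> (\<forall>x<zone. x \<notin> {27, 28, 33} \<longrightarrow> fst s' x = fst s x) \<and>
    fst s' 27 \<le> fst s 25 \<and> snd s' = M (fst s' 27) \<and> t \<le> 3 + 54 * fst s' 27" for t s'
  have tst: "aval w (Bin Less (Reg 27) (Reg 25)) s' \<noteq> 0 \<longleftrightarrow> fst s' 27 < fst s' 25" if "bounded w s'" for s'
    using w bounded_mod[OF that] by simp
  have ev: "elem_val w s' l = elem_val w s l" if I: "I t s'" and l: "l < fst s 25" for t s' l
  proof -
    have r: "fst s' x = fst s x" if "x \<in> {3, 15, 16, 17, 18, 19, 21, 22, 23}" for x
      using I that unfolding I_def by auto
    have "snd s' (3 + q mod fst s 3) = snd s (3 + q mod fst s 3)" if "0 < fst s 3" for q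
    proof -
      have "q mod fst s 3 < fst s 3" using that by simp
      then have "3 + q mod fst s 3 < fst s 24" using N(2) by linarith
      then show ?thesis using I unfolding I_def M_def by simp
    qed
    moreover have "0 < fst s 3" if "\<not> l < fst s 15 + fst s 16"
      using that l n by (cases "fst s 3 = 0") auto
    ultimately show ?thesis by (simp add: elem_val_def Let_def r)
  qed
  show ?thesis unfolding fill_def
  proof (rule wp_Seq, rule wp_assigns)
    let ?s0 = "upds w [(27, Lit 0)] s"
    have b0: "bounded w ?s0" by (rule bounded_upds[OF b])
    have M0: "snd s = M 0" by (simp add: M_def fun_eq_iff)
    show "wp w S (loop S (Bin Less (Reg 27) (Reg 25)) (fill_body S))
      (\<lambda>n' s'. upds_cost [(27, Lit 0)] + n' \<le> 7 + 54 * fst s 25 \<and> bounded w s' \<and>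
        (\<forall>x<zone. x \<notin> {27, 28, 33} \<longrightarrow> fst s' x = fst s x) \<and>
        snd s' = (\<lambda>x. if fst s 24 + 2 \<le> x \<and> x < fst s 24 + 2 + fst s 25
        then elem_val w s (x - (fst s 24 + 2)) else snd s x)) ?s0"
    proof (rule wp_loop[where I = I and \<mu> = "\<lambda>s'. fst s 25 - fst s' 27"])
      show "regs_below S (Bin Less (Reg 27) (Reg 25))" using S by simp
      show "I (cost (Bin Less (Reg 27) (Reg 25))) ?s0"
        using b0 M0 unfolding I_def by simp
    next
      fix t s' assume I: "I t s'" and tt: "aval w (Bin Less (Reg 27) (Reg 25)) s' \<noteq> 0"
      have r: "fst s' x = fst s x" if "x \<in> {3, 15, 16, 24, 25, 34}" for x
        using I that unfolding I_def by auto
      have b': "bounded w s'" using I unfolding I_def by blast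
      have l: "fst s' 27 < fst s 25" using tst[OF b'] tt r by simp
      show "wp w S (fill_body S) (\<lambda>m s''. I (t + (m + cost (Bin Less (Reg 27) (Reg 25)) + 1)) s'' \<and>
          fst s 25 - fst s'' 27 < fst s 25 - fst s' 27) s'"
      proof (rule wp_mono[OF wp_fill_body[OF S b']])
        show "fst s' 27 < fst s' 15 + fst s' 16 + fst s' 34 * fst s' 3" using l n r by simp
        show "fst s' 24 + 2 + (fst s' 15 + fst s' 16 + fst s' 34 * fst s' 3) < 2 ^ w" using fit n r by simp
        show "fst s' 3 + 3 < 2 ^ w" using N r by simp
        fix m :: nat and s'' :: state assume p: "m \<le> 50 \<and> bounded w s'' \<and>
          (\<forall>x<zone. x \<notin> {27, 28, 33} \<longrightarrow> fst s'' x = fst s' x) \<and> fst s'' 27 = fst s' 27 + 1 \<and>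
          snd s'' = (snd s')(fst s' 24 + 2 + fst s' 27 := elem_val w s' (fst s' 27))"
        have "snd s'' = M (fst s' 27 + 1)"
        proof -
          have "snd s'' = (M (fst s' 27))(fst s 24 + 2 + fst s' 27 := elem_val w s (fst s' 27))"
            using p I r ev[OF I l] unfolding I_def by auto
          then show ?thesis by (auto simp: M_def fun_eq_iff)
        qed
        then show "I (t + (m + cost (Bin Less (Reg 27) (Reg 25)) + 1)) s'' \<and>
          fst s 25 - fst s'' 27 < fst s 25 - fst s' 27"
          using p I l unfolding I_def by auto
      qed (rule w)
    next
      fix t s' assume I: "I t s'" and tt: "aval w (Bin Less (Reg 27) (Reg 25)) s' = 0"
      have b': "bounded w s'" using I unfolding I_def by blast
      have "fst s' 25 = fst s 25" using I unfolding I_def by auto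
      then have l: "fst s' 27 = fst s 25" using tst[OF b'] tt I unfolding I_def by simp
      then show "upds_cost [(27, Lit 0)] + (t + 1) \<le> 7 + 54 * fst s 25 \<and> bounded w s' \<and>
        (\<forall>x<zone. x \<notin> {27, 28, 33} \<longrightarrow> fst s' x = fst s x) \<and>
        snd s' = (\<lambda>x. if fst s 24 + 2 \<le> x \<and> x < fst s 24 + 2 + fst s 25
        then elem_val w s (x - (fst s 24 + 2)) else snd s x)"
        using I unfolding I_def M_def by simp
    qed
  qed (use S in auto)
qed

definition query :: "nat \<Rightarrow> com \<Rightarrow> com" where
  "query S p = Seq (assigns S [(26, target_exp), (25, size_exp)])
    (Seq (store S (Reg 24) (Reg 26)) (Seq (store S (Reg 24 \<oplus> Lit 1) (Reg 25))
    (Seq (fill S) (Seq (clear S (Suc (nregs p))) (Seq (assigns S [(29, Reg 6)]) (sim S p))))))"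

definition inst :: "nat \<Rightarrow> state \<Rightarrow> nat list" where
  "inst w s = (let n = fst s 15 + fst s 16 + fst s 34 * fst s 3 in
     [aval w target_exp s, n] @ map (elem_val w s) [0..<n])"

text \<open>Confinement and time are unconditional. Register \<open>zone\<close> holds the verdict
  of the true run only if the instance fits into \<open>v\<close> bits and the run into the step
  limit. By \<open>zero\<close>, the region behind the written instance looks like an initial
  memory.\<close>

lemma wp_query:
  fixes p :: com
  defines "S \<equiv> zone + Suc (nregs p)"
  assumes b: "bounded w s"
    and n: "n = fst s 15 + fst s 16 + fst s 34 * fst s 3" and nW: "n + 2 < W"
    and B: "B = fst s 24" "B + W \<le> 2 ^ w" "3 + fst s 3 \<le> B"
    and v: "fst s 20 = 2 ^ v" "2 ^ v \<le> W" "v < w" and w: "3 \<le> w"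
    and zero: "\<forall>x\<ge>B. snd s x = 0"
  shows "wp w S (query S p) (\<lambda>t s'.
    t \<le> (200 + 2 * nregs p + sim_cost p) * (n + fst s 6 + 1) \<and> bounded w s' \<and>
    (\<forall>x<zone. x \<notin> {25, 26, 27, 28, 29, 33} \<longrightarrow> fst s' x = fst s x) \<and>
    (\<forall>x. x < B \<or> B + W \<le> x \<longrightarrow> snd s' x = snd s x) \<and>
    (\<forall>k s0. exec v p (init_state (inst w s)) k s0 \<and> k \<le> fst s 6 \<and> (\<forall>x\<in>set (inst w s). x < 2 ^ v) \<and>
      n + 2 \<le> 2 ^ v \<longrightarrow> fst s' zone = fst s0 0 \<and> fst s0 0 < 2 ^ v)) s"
proof -
  define tt where "tt = aval w target_exp s"
  have S: "zone \<le> S" "zone + Suc (nregs p) \<le> S" by (auto simp: S_def)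
  note m = bounded_mod[OF b]
  have nw: "n < 2 ^ w" using nW B by linarith
  have sz: "aval w size_exp ((fst s)(26 := tt), snd s) = n"
  proof -
    have "fst s 15 + fst s 16 < 2 ^ w" "fst s 34 * fst s 3 < 2 ^ w" using nw n by linarith+
    then show ?thesis using nw unfolding n by (simp add: m)
  qed
  define s1 where "s1 = ((fst s)(26 := tt, 25 := n), snd s)"
  have u1: "upds w [(26, target_exp), (25, size_exp)] s = s1"
    by (simp only: upds.simps fst_conv snd_conv tt_def[symmetric] sz s1_def)
  have b1: "bounded w s1" unfolding u1[symmetric] by (rule bounded_upds[OF b])
  have a1: "aval w (Reg 24) s1 = B" "aval w (Reg 26) s1 = tt"
    using bounded_mod[OF b1, of 24] bounded_mod[OF b1, of 26] by (simp_all add: s1_def B)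
  define s2 where "s2 = (fst s1, (snd s1)(B := tt))"
  have "B + 1 < 2 ^ w" using B nW by linarith
  then have a2: "aval w (Reg 24 \<oplus> Lit 1) s2 = B + 1" "aval w (Reg 25) s2 = n"
    using m[of 24] nw w by (simp_all add: s1_def s2_def B mod_simps)
  define s3 where "s3 = (fst s1, (snd s1)(B := tt, B + 1 := n))"
  have b3: "bounded w s3" using b1 by (simp add: bounded_def s3_def)
  have r3: "fst s3 = (fst s)(26 := tt, 25 := n)" "snd s3 = (snd s)(B := tt, B + 1 := n)"
    by (simp_all add: s3_def s1_def)
  have B3: "fst s3 24 = B" "fst s3 25 = n" by (simp_all add: r3 B)
  have ev: "elem_val w s3 l = elem_val w s l" if l: "l < n" for l
  proof -
    have "snd s3 (3 + q mod fst s 3) = snd s (3 + q mod fst s 3)" if "0 < fst s 3" for q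
    proof -
      have "q mod fst s 3 < fst s 3" using that by simp
      then have "3 + q mod fst s 3 < B" using B(3) by linarith
      then show ?thesis by (simp add: r3)
    qed
    moreover have "0 < fst s 3" if "\<not> l < fst s 15 + fst s 16"
      using that l n by (cases "fst s 3 = 0") auto
    ultimately show ?thesis by (simp add: elem_val_def Let_def r3)
  qed
  define Q where "Q = (\<lambda>t s'.
    t \<le> (200 + 2 * nregs p + sim_cost p) * (n + fst s 6 + 1) \<and> bounded w s' \<and>
    (\<forall>x<zone. x \<notin> {25, 26, 27, 28, 29, 33} \<longrightarrow> fst s' x = fst s x) \<and>
    (\<forall>x. x < B \<or> B + W \<le> x \<longrightarrow> snd s' x = snd s x) \<and>
    (\<forall>k s0. exec v p (init_state (inst w s)) k s0 \<and> k \<le> fst s 6 \<and> (\<forall>x\<in>set (inst w s). x < 2 ^ v) \<and>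
      n + 2 \<le> 2 ^ v \<longrightarrow> fst s' zone = fst s0 0 \<and> fst s0 0 < 2 ^ v))"
  \<comment> \<open>The simulation itself, from any state in which the instance is written, the
    simulated registers are cleared and the fuel is loaded.\<close>
  have final: "wp w S (sim S p) (\<lambda>t. Q (t0 + t)) s5"
    if t0: "t0 \<le> 120 + 2 * nregs p + 54 * n" and b5: "bounded w s5"
      and r5: "\<forall>x<zone. x \<notin> {25, 26, 27, 28, 29, 33} \<longrightarrow> fst s5 x = fst s x"
      and f5: "fst s5 29 = fst s 6" "\<forall>r<Suc (nregs p). fst s5 (zone + r) = 0"
      and m5: "snd s5 = (\<lambda>x. if B + 2 \<le> x \<and> x < B + 2 + n then elem_val w s (x - (B + 2)) else snd s3 x)"
    for t0 s5
  proof -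
    have ok: "sim_ok w v B s5"
      using r5 f5 boundedD[OF b, of 6] by (simp add: sim_ok_def v B)
    have "wp w S (sim S p) (sim_post (Suc (nregs p)) v B p s5) s5"
      by (rule wp_sim[OF S(2) v(3) _ _ ok]) (use B(2) v(2) in auto)
    then show ?thesis
    proof (rule wp_mono)
      fix t s' assume p: "sim_post (Suc (nregs p)) v B p s5 t s'"
      have fr: "sim_frame v B s5 s'" using p unfolding sim_post_def by blast
      have "t \<le> sim_cost p * (1 + (fst s5 29 - fst s' 29))" using p unfolding sim_post_def by blast
      also have "\<dots> \<le> sim_cost p * (n + fst s 6 + 1)" using f5 by (intro mult_left_mono) auto
      finally have t: "t \<le> sim_cost p * (n + fst s 6 + 1)" .
      have "120 + 2 * nregs p + 54 * n \<le> (200 + 2 * nregs p) * (n + fst s 6 + 1)"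
        by (simp add: algebra_simps)
      then have 1: "t0 + t \<le> (200 + 2 * nregs p + sim_cost p) * (n + fst s 6 + 1)"
        using t t0 by (simp add: algebra_simps)
      have 2: "\<forall>x<zone. x \<notin> {25, 26, 27, 28, 29, 33} \<longrightarrow> fst s' x = fst s x"
        using fr r5 unfolding sim_frame_def by auto
      have 3: "bounded w s'" unfolding bounded_def
      proof (intro allI impI)
        fix x assume x: "x < zone"
        have "fst s' x \<le> fst s5 x" using fr x unfolding sim_frame_def by (cases "x = 29") auto
        then show "fst s' x < 2 ^ w" using boundedD[OF b5 x] by linarith
      qed
      have 4: "snd s' x = snd s x" if x: "x < B \<or> B + W \<le> x" for x
      proof -
        have "x < B \<or> B + 2 ^ v \<le> x" using x v(2) by linarith
        then have "snd s' x = snd s5 x" using fr unfolding sim_frame_def by blast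
        also have "\<dots> = snd s x" using x nW unfolding m5 by (auto simp: r3)
        finally show ?thesis .
      qed
      have 5: "fst s' zone = fst s0 0 \<and> fst s0 0 < 2 ^ v"
        if a: "exec v p (init_state (inst w s)) k s0" "k \<le> fst s 6" "\<forall>x\<in>set (inst w s). x < 2 ^ v"
          "n + 2 \<le> 2 ^ v" for k s0
      proof -
        have li: "length (inst w s) = n + 2" by (simp add: inst_def n Let_def)
        \<comment> \<open>The use of untouched memory: behind the input, an initial state of the
          simulated machine is zero.\<close>
        have mem: "snd s5 (B + x) = snd (init_state (inst w s)) x" for x
        proof (cases "x < n + 2")
          case True
          consider "x = 0" | "x = 1" | "2 \<le> x" by linarith
          then show ?thesis
          proof cases
            case 3
            have "snd s5 (B + x) = elem_val w s (x - 2)" using 3 True unfolding m5 by simp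
            also have "\<dots> = inst w s ! x"
              using 3 True by (cases x; cases "x - 1") (auto simp: inst_def Let_def n)
            finally show ?thesis using True li by (simp add: init_state_def)
          qed (use li in \<open>auto simp: m5 r3 init_state_def inst_def Let_def n tt_def\<close>)
        next
          case False
          then have "snd s5 (B + x) = snd s (B + x)" unfolding m5 by (auto simp: r3)
          then show ?thesis using False zero li by (simp add: init_state_def)
        qed
        have "snd (init_state (inst w s)) x < 2 ^ v" for x
          using a(3) by (auto simp: init_state_def)
        then have "sim_rel (Suc (nregs p)) v B (init_state (inst w s)) s5"
          using mem f5(2) by (auto simp: sim_rel_def init_state_def)
        then have "sim_rel (Suc (nregs p)) v B s0 s'" using sim_postD[OF p _ a(1)] a(2) f5(1) by auto
        then show ?thesis unfolding sim_rel_def by (metis add.right_neutral zero_less_Suc)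
      qed
      show "Q (t0 + t) s'" unfolding Q_def using 1 2 3 4 5 by blast
    qed
  qed
  show ?thesis unfolding query_def Q_def[symmetric]
  proof (rule wp_Seq, rule wp_assigns, use S target_exp_simps in simp, unfold u1, rule wp_Seq, rule wp_store, use S in simp, use S in simp,
      unfold a1 s2_def[symmetric], rule wp_Seq, rule wp_store, use S in simp, use S in simp, unfold a2)
    have s3': "(fst s2, (snd s2)(B + 1 := n)) = s3" by (simp add: s2_def s3_def)
    show "wp w S (Seq (fill S) (Seq (clear S (Suc (nregs p))) (Seq (assigns S [(29, Reg 6)]) (sim S p))))
      (\<lambda>n'. Q (upds_cost [(26, target_exp), (25, size_exp)] + (cost (Reg 24) + (cost (Reg 26) + 1) +
         (cost (Reg 24 \<oplus> Lit 1) + (cost (Reg 25) + 1) + n')))) (fst s2, (snd s2)(B + 1 := n))"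
      unfolding s3'
    proof (rule wp_Seq, rule wp_mono[OF wp_fill[OF S(1) b3]])
      fix t4 :: nat and s4 :: state
      assume p4: "t4 \<le> 7 + 54 * fst s3 25 \<and> bounded w s4 \<and>
        (\<forall>x<zone. x \<notin> {27, 28, 33} \<longrightarrow> fst s4 x = fst s3 x) \<and>
        snd s4 = (\<lambda>x. if fst s3 24 + 2 \<le> x \<and> x < fst s3 24 + 2 + fst s3 25
        then elem_val w s3 (x - (fst s3 24 + 2)) else snd s3 x)"
      have m4: "snd s4 = (\<lambda>x. if B + 2 \<le> x \<and> x < B + 2 + n then elem_val w s (x - (B + 2)) else snd s3 x)"
      proof -
        have "snd s4 = (\<lambda>x. if B + 2 \<le> x \<and> x < B + 2 + n then elem_val w s3 (x - (B + 2)) else snd s3 x)"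
          using p4 unfolding B3 by blast
        also have "\<dots> = (\<lambda>x. if B + 2 \<le> x \<and> x < B + 2 + n then elem_val w s (x - (B + 2)) else snd s3 x)"
        proof
          fix x
          show "(if B + 2 \<le> x \<and> x < B + 2 + n then elem_val w s3 (x - (B + 2)) else snd s3 x)
            = (if B + 2 \<le> x \<and> x < B + 2 + n then elem_val w s (x - (B + 2)) else snd s3 x)"
            using ev[of "x - (B + 2)"] by auto
        qed
        finally show ?thesis .
      qed
      show "wp w S (Seq (clear S (Suc (nregs p))) (Seq (assigns S [(29, Reg 6)]) (sim S p)))
        (\<lambda>n'. Q (upds_cost [(26, target_exp), (25, size_exp)] + (cost (Reg 24) + (cost (Reg 26) + 1) +
         (cost (Reg 24 \<oplus> Lit 1) + (cost (Reg 25) + 1) + (t4 + n'))))) s4"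
      proof (rule wp_Seq, rule wp_mono[OF wp_clear[OF S(2)]])
        fix t5 :: nat and s5 :: state
        assume p5: "t5 = 1 + 2 * Suc (nregs p) \<and> snd s5 = snd s4 \<and> (\<forall>x<zone. fst s5 x = fst s4 x) \<and>
          (\<forall>r<Suc (nregs p). fst s5 (zone + r) = 0)"
        have b5: "bounded w s5" using p4 p5 by (simp add: bounded_def)
        have "fst s5 6 = fst s4 6" "fst s4 6 = fst s3 6" using p4 p5 by simp_all
        then have "fst s5 6 = fst s 6" by (simp add: r3)
        then have a6: "aval w (Reg 6) s5 = fst s 6" using bounded_mod[OF b5, of 6] by simp
        have u6: "upds w [(29, Reg 6)] s5 = ((fst s5)(29 := fst s 6), snd s5)"
          by (simp only: upds.simps fst_conv snd_conv a6)
        show "wp w S (Seq (assigns S [(29, Reg 6)]) (sim S p))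
          (\<lambda>n'. Q (upds_cost [(26, target_exp), (25, size_exp)] + (cost (Reg 24) + (cost (Reg 26) + 1) +
           (cost (Reg 24 \<oplus> Lit 1) + (cost (Reg 25) + 1) + (t4 + (t5 + n')))))) s5"
        proof (rule wp_Seq, rule wp_assigns, use S in simp, unfold u6, rule wp_mono)
          define t0 where "t0 = upds_cost [(26, target_exp), (25, size_exp)] + (cost (Reg 24) + (cost (Reg 26) + 1) +
           (cost (Reg 24 \<oplus> Lit 1) + (cost (Reg 25) + 1) + (t4 + (t5 + upds_cost [(29, Reg 6)]))))"
          show "wp w S (sim S p) (\<lambda>t. Q (t0 + t)) ((fst s5)(29 := fst s 6), snd s5)"
          proof (rule final)
            show "t0 \<le> 120 + 2 * nregs p + 54 * n"
              using p4 p5 target_exp_simps(2) unfolding B3 t0_def by simp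
            show "bounded w ((fst s5)(29 := fst s 6), snd s5)"
              unfolding u6[symmetric] by (rule bounded_upds[OF b5])
            show "\<forall>x<zone. x \<notin> {25, 26, 27, 28, 29, 33} \<longrightarrow> fst ((fst s5)(29 := fst s 6), snd s5) x = fst s x"
            proof (intro allI impI)
              fix x assume x: "x < zone" "x \<notin> {25, 26, 27, 28, 29, 33::nat}"
              have "fst s5 x = fst s4 x" using p5 x by blast
              also have "\<dots> = fst s3 x" using p4 x by blast
              finally show "fst ((fst s5)(29 := fst s 6), snd s5) x = fst s x" using x by (simp add: r3)
            qed
            show "\<forall>r<Suc (nregs p). fst ((fst s5)(29 := fst s 6), snd s5) (zone + r) = 0" using p5 by simp
            show "snd ((fst s5)(29 := fst s 6), snd s5) =
              (\<lambda>x. if B + 2 \<le> x \<and> x < B + 2 + n then elem_val w s (x - (B + 2)) else snd s3 x)"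
              using p5 m4 unfolding snd_conv by (elim conjE) (rule trans)
          qed simp
          fix t s' assume "Q (t0 + t) s'"
          then show "Q (upds_cost [(26, target_exp), (25, size_exp)] + (cost (Reg 24) + (cost (Reg 26) + 1) +
           (cost (Reg 24 \<oplus> Lit 1) + (cost (Reg 25) + 1) + (t4 + (t5 + (upds_cost [(29, Reg 6)] + t)))))) s'"
            by (simp only: t0_def add.assoc)
        qed
      qed
    qed (use n B nW w in \<open>auto simp: r3\<close>)
  qed
qed

text \<open>The quotient of the round number by \<open>k * N\<close> is a guess; its digits in base
  \<open>Q\<close>, from the least significant on, are the exponents of m, s, \<open>\<phi>\<close>,
  E and a. Those of s, \<open>\<phi>\<close> and E stay in registers because the simulated word
  length depends on them.\<close>

definition digits :: "(nat \<times> aexp) list" where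
  "digits = [(14, Reg 9 \<oslash> Reg 36),
    (15, Bin Shl (Lit 1) (Bin Mod (Reg 14) (Reg 5))), (14, Reg 14 \<oslash> Reg 5),
    (30, Bin Mod (Reg 14) (Reg 5)), (14, Reg 14 \<oslash> Reg 5),
    (31, Bin Mod (Reg 14) (Reg 5)), (14, Reg 14 \<oslash> Reg 5),
    (32, Bin Mod (Reg 14) (Reg 5)), (14, Reg 14 \<oslash> Reg 5),
    (18, Bin Shl (Lit 1) (Bin Mod (Reg 14) (Reg 5)))]"

text \<open>Register 20 becomes \<open>2 ^ v\<close>, where \<open>v\<close> is the word length of
  the assumed algorithm for a right guess, as shown in \<open>good_of_gadget\<close>. Register 24
  becomes the base of region \<open>h + 1\<close> in round \<open>h\<close>; region 0 holds the
  input.\<close>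

definition scales :: "nat \<Rightarrow> (nat \<times> aexp) list" where
  "scales c = [(16, Bin Shl (Lit 1) (Reg 30)), (17, Bin Shl (Lit 1) (Reg 31)), (19, Bin Shl (Lit 1) (Reg 32)),
    (21, Lit 32 \<otimes> Reg 16 \<otimes> Reg 17), (22, Reg 19 \<otimes> Reg 17),
    (20, Bin Shl (Lit 1) (Lit c \<otimes> (Lit 2 \<otimes> Reg 30 \<oplus> Lit 2 \<otimes> Reg 31 \<oplus> Reg 32 \<oplus> Lit 6))),
    (13, Mem (Lit 3 \<oplus> Bin Mod (Reg 9) (Reg 3))),
    (24, (Reg 9 \<oplus> Lit 1) \<otimes> Reg 7)]"

text \<open>The bounds on m and s keep the cost of writing the instance linear in
  \<open>F + k * N\<close>; a wrong guess could otherwise ask for a huge instance.\<close>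

definition query_test :: aexp where
  "query_test = Bin Less (Reg 15) (Reg 6) \<otimes> Bin Less (Reg 16) (Reg 6) \<otimes> Bin Less (Lit 0) (Reg 11)
    \<otimes> Bin Less (Reg 13) (Reg 12 \<oplus> Lit 1)"

definition attempt :: "nat \<Rightarrow> com \<Rightarrow> com" where
  "attempt S p = Seq (assigns S [(34, Reg 11 \<ominus> Lit 1), (35, Reg 12 \<ominus> Reg 13)])
    (Seq (query S p) (ifte S (Reg zone) (assigns S [(11, Reg 34), (12, Reg 35)]) Skip))"

text \<open>Remainder 0 of the round number starts a new guess, and the greedy search restarts from
  \<open>(k, T)\<close>. The verdict in register 0 is only ever set, never cleared.\<close>

definition body :: "nat \<Rightarrow> com \<Rightarrow> nat \<Rightarrow> nat \<Rightarrow> com" where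
  "body S p c k = Seq (ifte S (Bin Mod (Reg 9) (Reg 36)) Skip (assigns S [(11, Lit k), (12, Reg 2)]))
    (Seq (assigns S digits) (Seq (assigns S (scales c))
    (Seq (ifte S query_test (attempt S p) Skip)
    (Seq (ifte S (Reg 11) Skip (ifte S (Reg 12) Skip (assigns S [(0, Lit 1)])))
      (assigns S [(9, Reg 9 \<oplus> Lit 1)])))))"

text \<open>The numbers of the gadget, free of its locale: the program computes them for guesses
  that may violate the gadget conditions.\<close>

definition target_val :: "nat \<Rightarrow> nat \<Rightarrow> nat \<Rightarrow> nat \<Rightarrow> nat \<Rightarrow> nat \<Rightarrow> nat" where
  "target_val s \<phi> E G \<kappa> T = s * (32 * s * \<phi> * (E * \<phi>) + 4 * \<phi>) + 32 * s * \<phi> * ((s * s - s) div 2)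
    + \<kappa> * (32 * s * \<phi> * E + 1) + 32 * s * \<phi> * (G * ((\<kappa> * \<kappa> - \<kappa>) div 2)) + 32 * s * \<phi> * T"

definition elem_at :: "nat \<Rightarrow> nat \<Rightarrow> nat \<Rightarrow> nat \<Rightarrow> nat \<Rightarrow> nat \<Rightarrow> nat list \<Rightarrow> nat \<Rightarrow> nat" where
  "elem_at m s \<phi> a E G zs l = (if l < m then pad (32 * s * \<phi>) a l
    else if l < m + s then filler (32 * s * \<phi>) (E * \<phi>) \<phi> (l - m)
    else item (32 * s * \<phi>) E G ((l - m - s) div length zs) (zs ! ((l - m - s) mod length zs)))"

definition instance_list :: "nat \<Rightarrow> nat \<Rightarrow> nat \<Rightarrow> nat \<Rightarrow> nat \<Rightarrow> nat \<Rightarrow> nat list \<Rightarrow> nat \<Rightarrow> nat \<Rightarrow> nat list" where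
  "instance_list m s \<phi> a E G zs \<kappa> T = (let n = m + s + \<kappa> * length zs in
    [target_val s \<phi> E G \<kappa> T, n] @ map (elem_at m s \<phi> a E G zs) [0..<n])"

text \<open>Reduction modulo \<open>2 ^ w\<close> commutes with sums and products, but not with the
  halving in the index sums; the bounds \<open>sq\<close> make those terms exact.\<close>

lemma inst_instance_list:
  assumes b: "bounded w s" and w: "3 \<le> w"
    and d: "fst s 21 = 32 * fst s 16 * fst s 17" and H: "fst s 22 = fst s 19 * fst s 17"
    and N: "fst s 3 = length zs" and mem: "\<And>i. i < length zs \<Longrightarrow> snd s (3 + i) = zs ! i"
    and sq: "fst s 16 * fst s 16 < 2 ^ w" "fst s 34 * fst s 34 < 2 ^ w"
    and small: "\<forall>x\<in>set (instance_list (fst s 15) (fst s 16) (fst s 17) (fst s 18) (fst s 19) (fst s 23) zs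
       (fst s 34) (fst s 35)). x < 2 ^ w"
  shows "inst w s = instance_list (fst s 15) (fst s 16) (fst s 17) (fst s 18) (fst s 19) (fst s 23) zs
       (fst s 34) (fst s 35)"
proof -
  let ?R = "fst s"
  define n where "n = ?R 15 + ?R 16 + ?R 34 * length zs"
  let ?t = "target_val (?R 16) (?R 17) (?R 19) (?R 23) (?R 34) (?R 35)"
  let ?e = "elem_at (?R 15) (?R 16) (?R 17) (?R 18) (?R 19) (?R 23) zs"
  have t: "?t < 2 ^ w" and e: "\<And>l. l < n \<Longrightarrow> ?e l < 2 ^ w"
    using small by (auto simp: instance_list_def Let_def n_def)
  note m = bounded_mod[OF b]
  have 2: "(2::nat) < 2 ^ w" using power_increasing[OF w, of "2::nat"] by simp
  have sub: "aval w ((Reg x \<otimes> Reg x \<ominus> Reg x) \<oslash> Lit 2) s = (?R x * ?R x - ?R x) div 2"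
    if "?R x * ?R x < 2 ^ w" "x < zone" for x
  proof -
    have "?R x \<le> ?R x * ?R x" by (cases "?R x") auto
    then have "aval w (Reg x \<otimes> Reg x \<ominus> Reg x) s = ?R x * ?R x - ?R x"
      using that m[of x] sub_mod_power[of "?R x" "?R x * ?R x" w] by simp
    moreover have "(?R x * ?R x - ?R x) div 2 < 2 ^ w"
      using that(1) by (meson div_le_dividend diff_le_self le_less_trans)
    ultimately show ?thesis using 2 by (simp only: aval.simps(3)[of w Div] aval.simps(1) binop_val.simps mod_less)
  qed
  have s16: "aval w ((Reg 16 \<otimes> Reg 16 \<ominus> Reg 16) \<oslash> Lit 2) s = (?R 16 * ?R 16 - ?R 16) div 2"
    by (rule sub[OF sq(1)]) simp
  have s34: "aval w ((Reg 34 \<otimes> Reg 34 \<ominus> Reg 34) \<oslash> Lit 2) s = (?R 34 * ?R 34 - ?R 34) div 2"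
    by (rule sub[OF sq(2)]) simp
  have "aval w target_exp s = ?t mod 2 ^ w"
    unfolding target_exp_def aval.simps(3)[of w Add] aval.simps(3)[of w Mul] s16 s34
    by (simp only: aval.simps(1,2) binop_val.simps mod_simps d H target_val_def)
  then have T: "aval w target_exp s = ?t" using t by simp
  have "elem_val w s l = ?e l" if l: "l < n" for l
  proof -
    have "elem_val w s l = ?e l mod 2 ^ w"
    proof (cases "l < ?R 15 + ?R 16")
      case True
      then show ?thesis
        unfolding elem_val_def Let_def elem_at_def pad_def filler_def d H by simp
    next
      case False
      then have "0 < length zs" using l by (cases "length zs = 0") (auto simp: n_def)
      then have "snd s (3 + (l - (?R 15 + ?R 16)) mod length zs) = zs ! ((l - (?R 15 + ?R 16)) mod length zs)"
        by (intro mem) simp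
      then show ?thesis using False
        unfolding elem_val_def Let_def elem_at_def item_def d N by simp
    qed
    then show ?thesis using e[OF l] by simp
  qed
  then show ?thesis unfolding inst_def instance_list_def Let_def N n_def[symmetric] T by simp
qed


text \<open>\<open>dec\<close> is the decision taken, whatever its origin; only the last clause ties
  it to the true run on the instance that remains after choosing the current element.\<close>

lemma wp_attempt:
  fixes p :: com
  defines "S \<equiv> zone + Suc (nregs p)"
  assumes b: "bounded w s" and w: "3 \<le> w"
    and \<kappa>: "1 \<le> fst s 11" "fst s 13 \<le> fst s 12" and k: "fst s 11 \<le> k" "k * k < 2 ^ w"
    and d: "fst s 21 = 32 * fst s 16 * fst s 17" "fst s 22 = fst s 19 * fst s 17"
    and N: "fst s 3 = length zs" and mem: "\<And>i. i < length zs \<Longrightarrow> snd s (3 + i) = zs ! i"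
    and sq: "fst s 16 * fst s 16 < 2 ^ w"
    and F: "fst s 15 < fst s 6" "fst s 16 < fst s 6" "2 * fst s 6 + k * length zs + 2 < W"
    and B: "B = fst s 24" "B + W \<le> 2 ^ w" "3 + length zs \<le> B"
    and v: "fst s 20 = 2 ^ v" "2 ^ v \<le> W" "v < w"
    and zero: "\<forall>x\<ge>B. snd s x = 0"
  shows "wp w S (attempt S p) (\<lambda>t s'.
    t \<le> 20 + (200 + 2 * nregs p + sim_cost p) * (3 * fst s 6 + k * length zs + 1) \<and> bounded w s' \<and>
    (\<forall>x<zone. x \<notin> {11, 12, 25, 26, 27, 28, 29, 33, 34, 35} \<longrightarrow> fst s' x = fst s x) \<and>
    (\<forall>x. x < B \<or> B + W \<le> x \<longrightarrow> snd s' x = snd s x) \<and>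
    (\<exists>dec. fst s' 11 = (if dec then fst s 11 - 1 else fst s 11) \<and>
      fst s' 12 = (if dec then fst s 12 - fst s 13 else fst s 12) \<and>
      (\<forall>xs j s0. xs = instance_list (fst s 15) (fst s 16) (fst s 17) (fst s 18) (fst s 19) (fst s 23) zs
           (fst s 11 - 1) (fst s 12 - fst s 13) \<and>
         exec v p (init_state xs) j s0 \<and> j \<le> fst s 6 \<and> (\<forall>x\<in>set xs. x < 2 ^ v) \<and>
         length xs \<le> 2 ^ v \<longrightarrow> dec = accepting s0))) s"
proof -
  have S: "zone \<le> S" by (simp add: S_def)
  note m = bounded_mod[OF b]
  define \<kappa>1 where "\<kappa>1 = fst s 11 - 1"
  define T1 where "T1 = fst s 12 - fst s 13"
  define s1 where "s1 = ((fst s)(34 := \<kappa>1, 35 := T1), snd s)"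
  have a1: "aval w (Reg 11 \<ominus> Lit 1) s = \<kappa>1"
    using \<kappa>(1) w m[of 11] boundedD[OF b, of 11] sub_mod_power[of 1 "fst s 11" w] by (simp add: \<kappa>1_def)
  have a2: "aval w (Reg 12 \<ominus> Reg 13) ((fst s)(34 := \<kappa>1), snd s) = T1"
    using \<kappa>(2) m[of 12] m[of 13] boundedD[OF b, of 12] sub_mod_power[of "fst s 13" "fst s 12" w] by (simp add: T1_def)
  have u1: "upds w [(34, Reg 11 \<ominus> Lit 1), (35, Reg 12 \<ominus> Reg 13)] s = s1"
    by (simp only: upds.simps fst_conv snd_conv a1 a2 s1_def)
  have b1: "bounded w s1" unfolding u1[symmetric] by (rule bounded_upds[OF b])
  have r1: "fst s1 x = fst s x" if "x \<noteq> 34" "x \<noteq> 35" for x using that by (simp add: s1_def)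
  have r2: "fst s1 34 = \<kappa>1" "fst s1 35 = T1" "snd s1 = snd s" by (simp_all add: s1_def)
  define n where "n = fst s 15 + fst s 16 + \<kappa>1 * length zs"
  have "\<kappa>1 * length zs \<le> k * length zs" using k by (intro mult_right_mono) (auto simp: \<kappa>1_def)
  then have nF: "n + 2 < W" "n + fst s 6 + 1 \<le> 3 * fst s 6 + k * length zs + 1" using F unfolding n_def by linarith+
  define Q where "Q = (\<lambda>t s'.
    t \<le> 20 + (200 + 2 * nregs p + sim_cost p) * (3 * fst s 6 + k * length zs + 1) \<and> bounded w s' \<and>
    (\<forall>x<zone. x \<notin> {11, 12, 25, 26, 27, 28, 29, 33, 34, 35} \<longrightarrow> fst s' x = fst s x) \<and>
    (\<forall>x. x < B \<or> B + W \<le> x \<longrightarrow> snd s' x = snd s x) \<and>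
    (\<exists>dec. fst s' 11 = (if dec then fst s 11 - 1 else fst s 11) \<and>
      fst s' 12 = (if dec then fst s 12 - fst s 13 else fst s 12) \<and>
      (\<forall>xs j s0. xs = instance_list (fst s 15) (fst s 16) (fst s 17) (fst s 18) (fst s 19) (fst s 23) zs
           (fst s 11 - 1) (fst s 12 - fst s 13) \<and>
         exec v p (init_state xs) j s0 \<and> j \<le> fst s 6 \<and> (\<forall>x\<in>set xs. x < 2 ^ v) \<and>
         length xs \<le> 2 ^ v \<longrightarrow> dec = accepting s0)))"
  show ?thesis unfolding attempt_def Q_def[symmetric]
  proof (rule wp_Seq, rule wp_assigns, use S in simp, unfold u1, rule wp_Seq, rule wp_mono)
    show "wp w S (query S p) (\<lambda>t s'.
      t \<le> (200 + 2 * nregs p + sim_cost p) * (n + fst s1 6 + 1) \<and> bounded w s' \<and>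
      (\<forall>x<zone. x \<notin> {25, 26, 27, 28, 29, 33} \<longrightarrow> fst s' x = fst s1 x) \<and>
      (\<forall>x. x < B \<or> B + W \<le> x \<longrightarrow> snd s' x = snd s1 x) \<and>
      (\<forall>k s0. exec v p (init_state (inst w s1)) k s0 \<and> k \<le> fst s1 6 \<and> (\<forall>x\<in>set (inst w s1). x < 2 ^ v) \<and>
        n + 2 \<le> 2 ^ v \<longrightarrow> fst s' zone = fst s0 0 \<and> fst s0 0 < 2 ^ v)) s1"
      unfolding S_def
      by (rule wp_query[OF b1 _ nF(1)]) (use B v w zero N in \<open>auto simp: r1 r2 n_def\<close>)
  next
    fix t s'
    assume q: "t \<le> (200 + 2 * nregs p + sim_cost p) * (n + fst s1 6 + 1) \<and> bounded w s' \<and>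
      (\<forall>x<zone. x \<notin> {25, 26, 27, 28, 29, 33} \<longrightarrow> fst s' x = fst s1 x) \<and>
      (\<forall>x. x < B \<or> B + W \<le> x \<longrightarrow> snd s' x = snd s1 x) \<and>
      (\<forall>k s0. exec v p (init_state (inst w s1)) k s0 \<and> k \<le> fst s1 6 \<and> (\<forall>x\<in>set (inst w s1). x < 2 ^ v) \<and>
        n + 2 \<le> 2 ^ v \<longrightarrow> fst s' zone = fst s0 0 \<and> fst s0 0 < 2 ^ v)"
    have q5: "fst s' zone = fst s0 0 \<and> fst s0 0 < 2 ^ v"
      if "exec v p (init_state (inst w s1)) j s0" "j \<le> fst s1 6" "\<forall>x\<in>set (inst w s1). x < 2 ^ v" "n + 2 \<le> 2 ^ v" for j s0
      using q that by blast
    have b': "bounded w s'" using q by blast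
    have r': "fst s' x = fst s1 x" if "x < zone" "x \<notin> {25, 26, 27, 28, 29, 33}" for x using q that by blast
    have "t \<le> (200 + 2 * nregs p + sim_cost p) * (n + fst s 6 + 1)" using q r1[of 6] by simp
    also have "\<dots> \<le> (200 + 2 * nregs p + sim_cost p) * (3 * fst s 6 + k * length zs + 1)"
      using nF(2) by (rule mult_left_mono) simp
    finally have t: "t \<le> (200 + 2 * nregs p + sim_cost p) * (3 * fst s 6 + k * length zs + 1)" .
    define dec where "dec \<longleftrightarrow> fst s' zone mod 2 ^ w \<noteq> 0"
    have dec: "dec = accepting s0" if a: "xs = instance_list (fst s 15) (fst s 16) (fst s 17) (fst s 18) (fst s 19) (fst s 23) zs
           (fst s 11 - 1) (fst s 12 - fst s 13)" "exec v p (init_state xs) j s0" "j \<le> fst s 6" "\<forall>x\<in>set xs. x < 2 ^ v"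
         "length xs \<le> 2 ^ v" for xs j s0
    proof -
      have vw: "(2::nat) ^ v < 2 ^ w" using v(3) by simp
      have "\<kappa>1 * \<kappa>1 \<le> k * k" using k(1) by (intro mult_mono) (auto simp: \<kappa>1_def)
      then have k2: "\<kappa>1 * \<kappa>1 < 2 ^ w" using k(2) by linarith
      have "inst w s1 = instance_list (fst s1 15) (fst s1 16) (fst s1 17) (fst s1 18) (fst s1 19) (fst s1 23) zs
           (fst s1 34) (fst s1 35)"
      proof (rule inst_instance_list[OF b1 w])
        show "\<forall>x\<in>set (instance_list (fst s1 15) (fst s1 16) (fst s1 17) (fst s1 18) (fst s1 19) (fst s1 23) zs
           (fst s1 34) (fst s1 35)). x < 2 ^ w"
          using a(4) vw unfolding a(1) by (auto simp: r1 r2 \<kappa>1_def T1_def intro: less_trans)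
      qed (use d N mem sq k2 in \<open>auto simp: r1 r2\<close>)
      then have i: "inst w s1 = xs" unfolding a(1) by (simp add: r1 r2 \<kappa>1_def T1_def)
      have "length xs = n + 2" unfolding a(1) by (simp add: instance_list_def Let_def n_def \<kappa>1_def)
      then have n2: "n + 2 \<le> 2 ^ v" using a(5) by simp
      have "fst s' zone = fst s0 0 \<and> fst s0 0 < 2 ^ v"
        by (rule q5) (use a(2-4) n2 in \<open>auto simp: i r1\<close>)
      then have "fst s' zone mod 2 ^ w = fst s0 0" using vw by (metis less_trans mod_less)
      then show ?thesis by (simp add: dec_def accepting_def)
    qed
    have mm: "\<forall>x. x < B \<or> B + W \<le> x \<longrightarrow> snd s' x = snd s x" using q r2(3) by simp
    have c: "upds_cost [(34, Reg 11 \<ominus> Lit 1), (35, Reg 12 \<ominus> Reg 13)] = 9" by simp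
    show "wp w S (ifte S (Reg zone) (assigns S [(11, Reg 34), (12, Reg 35)]) Skip)
      (\<lambda>n'. Q (upds_cost [(34, Reg 11 \<ominus> Lit 1), (35, Reg 12 \<ominus> Reg 13)] + (t + n'))) s'"
      unfolding c
    proof (rule wp_ifte)
      show "regs_below S (Reg zone)" by (simp add: S_def)
      assume "aval w (Reg zone) s' \<noteq> 0"
      then have de: "dec" by (simp add: dec_def)
      have v3: "fst s' 34 = \<kappa>1" "fst s' 35 = T1" using r'[of 34] r'[of 35] r2 by simp_all
      have u: "upds w [(11, Reg 34), (12, Reg 35)] s' = ((fst s')(11 := \<kappa>1, 12 := T1), snd s')"
        using bounded_mod[OF b', of 34] bounded_mod[OF b', of 35] by (simp add: v3)
      show "wp w S (assigns S [(11, Reg 34), (12, Reg 35)]) (\<lambda>n. Q (9 + (t + (cost (Reg zone) + Suc n)))) s'"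
      proof (rule wp_assigns)
        have "bounded w (upds w [(11, Reg 34), (12, Reg 35)] s')" by (rule bounded_upds[OF b'])
        then have "bounded w ((fst s')(11 := \<kappa>1, 12 := T1), snd s')" unfolding u .
        moreover have "\<forall>x<zone. x \<notin> {11, 12, 25, 26, 27, 28, 29, 33, 34, 35} \<longrightarrow>
          fst ((fst s')(11 := \<kappa>1, 12 := T1), snd s') x = fst s x"
          using r' r1 by auto
        ultimately show "Q (9 + (t + (cost (Reg zone) + Suc (upds_cost [(11, Reg 34), (12, Reg 35)]))))
          (upds w [(11, Reg 34), (12, Reg 35)] s')"
          unfolding u Q_def using t mm dec de
          by (intro conjI exI[of _ True]) (auto simp: \<kappa>1_def T1_def)
      qed (use S in auto)
    next
      assume "aval w (Reg zone) s' = 0"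
      then have de: "\<not> dec" by (simp add: dec_def)
      show "wp w S Skip (\<lambda>n. Q (9 + (t + (cost (Reg zone) + Suc n)))) s'"
      proof (rule wp_Skip)
        have "\<forall>x<zone. x \<notin> {11, 12, 25, 26, 27, 28, 29, 33, 34, 35} \<longrightarrow> fst s' x = fst s x"
          "fst s' 11 = fst s 11" "fst s' 12 = fst s 12"
          using r' r1 by auto
        then show "Q (9 + (t + (cost (Reg zone) + Suc 1))) s'"
          unfolding Q_def using t mm dec de b'
          by (intro conjI exI[of _ False]) auto
      qed
    qed
  qed
qed

section \<open>Guessing and greedy search\<close>

text \<open>A purely operational condition: on all instances that the search can ask about, the
  assumed algorithm answers correctly within the step limit, and the instance fits its word length.
  It demands only \<open>\<kappa> < k\<close> because a query concerns the state after one more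
  choice.\<close>

definition good_guess ::
    "com \<Rightarrow> nat \<Rightarrow> nat \<Rightarrow> nat \<Rightarrow> nat \<Rightarrow> nat \<Rightarrow> nat \<Rightarrow> nat list \<Rightarrow> (nat \<Rightarrow> nat \<Rightarrow> bool) \<Rightarrow> nat \<Rightarrow> bool" where
  "good_guess p c k Q F T G zs ans g \<longleftrightarrow>
    (let em = g mod Q; es = g div Q mod Q; ef = g div Q div Q mod Q; eE = g div Q div Q div Q mod Q;
      ea = g div Q div Q div Q div Q mod Q; v = c * (2 * es + 2 * ef + eE + 6) in
    2 ^ em < F \<and> 2 ^ es < F \<and> (\<forall>\<kappa><k. \<forall>T'\<le>T.
      let xs = instance_list (2 ^ em) (2 ^ es) (2 ^ ef) (2 ^ ea) (2 ^ eE) G zs \<kappa> T' in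
      (\<exists>j s0. exec v p (init_state xs) j s0 \<and> j \<le> F \<and> (accepting s0 \<longleftrightarrow> ans \<kappa> T')) \<and>
      (\<forall>x\<in>set xs. x < 2 ^ v) \<and> length xs \<le> 2 ^ v))"

text \<open>For exponents below \<open>Q\<close>, the number \<open>2 * es + 2 * ef + eE + 6\<close>
  is at most \<open>5 * Q + 6\<close>, so \<open>cap\<close> covers every guessed word length. The
  conditions \<open>W\<close> let a region hold the input or a written instance and let the regions
  of all rounds fit into the address space.\<close>

locale search =
  fixes p :: com and c k w Q F W T G :: nat and zs :: "nat list" and ans :: "nat \<Rightarrow> nat \<Rightarrow> bool"
  assumes w: "3 \<le> w" and N: "1 \<le> length zs" and k: "1 \<le> k" "k * k < 2 ^ w" and Q: "1 \<le> Q" and c: "1 \<le> c"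
    and cap: "c * (5 * Q + 6) < w" "2 ^ (c * (5 * Q + 6)) \<le> W"
    and W: "3 + length zs \<le> W" "2 * F + k * length zs + 2 < W" "(Q ^ 5 * (k * length zs) + 1) * W \<le> 2 ^ w"
    and T: "T + 1 < 2 ^ w" and zs: "\<And>i. i < length zs \<Longrightarrow> zs ! i < 2 ^ w"
begin

abbreviation "S \<equiv> zone + Suc (nregs p)"
abbreviation "N \<equiv> length zs"

text \<open>\<open>b\<close> counts the regions that may have been used, the input region included:
  everything from \<open>b * W\<close> on is still zero.\<close>

definition st :: "nat \<Rightarrow> nat \<Rightarrow> nat \<Rightarrow> nat \<Rightarrow> nat \<Rightarrow> state \<Rightarrow> bool" where
  "st b h \<kappa> T' r s \<longleftrightarrow> bounded w s \<and> fst s 0 = r \<and> fst s 2 = T \<and> fst s 3 = N \<and> fst s 5 = Q \<and> fst s 6 = F \<and>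
    fst s 7 = W \<and> fst s 9 = h \<and> fst s 10 = Q ^ 5 * (k * N) \<and> fst s 11 = \<kappa> \<and> fst s 12 = T' \<and> fst s 23 = G \<and>
    fst s 36 = k * N \<and> (\<forall>i<N. snd s (3 + i) = zs ! i) \<and> (\<forall>x\<ge>b * W. snd s x = 0)"

abbreviation "good \<equiv> good_guess p c k Q F T G zs ans"

abbreviation "cost_bound \<equiv> (500 + 2 * nregs p + sim_cost p) * (3 * F + k * N + 1)"

lemma upds_digits:
  assumes s: "st b h \<kappa> T' r s"
  defines "g \<equiv> h div (k * N)"
  shows "upds w digits s = ((fst s)(14 := g div Q div Q div Q div Q, 15 := 2 ^ (g mod Q),
    30 := g div Q mod Q, 31 := g div Q div Q mod Q, 32 := g div Q div Q div Q mod Q,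
    18 := 2 ^ (g div Q div Q div Q div Q mod Q)), snd s)"
proof -
  define g1 where "g1 = g div Q" 
  define g2 where "g2 = g1 div Q"
  define g3 where "g3 = g2 div Q"
  define g4 where "g4 = g3 div Q"
  have h: "h < 2 ^ w" "Q < 2 ^ w" "k * N < 2 ^ w" using s boundedD[of w s 9] boundedD[of w s 5] boundedD[of w s 36] unfolding st_def by auto
  have gb: "g < 2 ^ w" unfolding g_def using h(1) by (rule le_less_trans[OF div_le_dividend])
  have g1b: "g1 < 2 ^ w" unfolding g1_def using gb by (rule le_less_trans[OF div_le_dividend])
  have g2b: "g2 < 2 ^ w" unfolding g2_def using g1b by (rule le_less_trans[OF div_le_dividend])
  have g3b: "g3 < 2 ^ w" unfolding g3_def using g2b by (rule le_less_trans[OF div_le_dividend])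
  have g4b: "g4 < 2 ^ w" unfolding g4_def using g3b by (rule le_less_trans[OF div_le_dividend])
  have "5 * Q + 6 \<le> c * (5 * Q + 6)" using c by simp
  then have "Q < w" using cap(1) by linarith
  then have e: "x mod Q < w" for x using Q by (meson less_le_trans less_trans mod_less_divisor zero_less_one)
  have me: "x mod Q mod 2 ^ w = x mod Q" for x
    using e[of x] less_exp[of w] by (meson less_trans mod_less)
  have r: "fst s 9 = h" "fst s 36 = k * N" "fst s 5 = Q" using s unfolding st_def by auto
  have w0: "0 < w" using w by simp
  show ?thesis
    unfolding g1_def[symmetric] g2_def[symmetric] g3_def[symmetric] g4_def[symmetric]
    using h gb g1b g2b g3b g4b e w0
    by (simp add: digits_def r me g_def[symmetric] g1_def[symmetric] g2_def[symmetric] g3_def[symmetric] g4_def[symmetric] fun_upd_twist)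
qed

lemma upds_scales:
  assumes s: "bounded w s" "fst s 3 = N" "fst s 9 = h" "fst s 7 = W" "\<forall>i<N. snd s (3 + i) = zs ! i"
    and h: "h < Q ^ 5 * (k * N)"
    and e: "fst s 30 = es" "fst s 31 = ef" "fst s 32 = eE" "es < Q" "ef < Q" "eE < Q"
  shows "upds w (scales c) s = ((fst s)(16 := 2 ^ es, 17 := 2 ^ ef, 19 := 2 ^ eE, 21 := 32 * 2 ^ es * 2 ^ ef,
    22 := 2 ^ eE * 2 ^ ef, 20 := 2 ^ (c * (2 * es + 2 * ef + eE + 6)), 13 := zs ! (h mod N), 24 := (h + 1) * W), snd s)"
proof -
  define v where "v = c * (2 * es + 2 * ef + eE + 6)"
  have cc: "5 * Q + 6 \<le> c * (5 * Q + 6)" "c * 1 \<le> c * (5 * Q + 6)" using c by simp_all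
  have "v \<le> c * (5 * Q + 6)" unfolding v_def using e by (intro mult_left_mono) auto
  then have v: "v < w" using cap(1) by linarith
  have ew: "es < w" "ef < w" "eE < w" "c < w" "5 + es + ef < w" "eE + ef < w" using cap(1) cc e by linarith+
  have w2: "x < w \<Longrightarrow> x < 2 ^ w" for x :: nat using less_exp[of w] by linarith
  have dd: "32 * 2 ^ es * 2 ^ ef = (2::nat) ^ (5 + es + ef)" "(2::nat) ^ eE * 2 ^ ef = 2 ^ (eE + ef)"
    by (simp_all add: power_add)
  have "(2::nat) ^ (5 + es + ef) < 2 ^ w" "(2::nat) ^ (eE + ef) < 2 ^ w" using ew by simp_all
  then have d: "32 * 2 ^ es * 2 ^ ef < (2::nat) ^ w" "(2::nat) ^ eE * 2 ^ ef < 2 ^ w" unfolding dd by blast+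
  have "(32::nat) * 2 ^ es = 2 ^ (5 + es)" by (simp add: power_add)
  then have d32: "32 * 2 ^ es < (2::nat) ^ w" using ew by simp
  have w0: "0 < w" using w by simp
  have "5 * Q + 6 < w" using cap(1) cc by linarith
  then have w5: "11 < w" using Q by linarith
  have "32 < (2::nat) ^ w" using power_strict_increasing[OF w5, of "2::nat"] by simp
  note w32 = this
  have hN: "h mod N < N" using N by (intro mod_less_divisor) linarith
  have hw: "h < 2 ^ w" using boundedD[OF s(1), of 9] s(3) by simp
  have Nw: "N < 2 ^ w" using boundedD[OF s(1), of 3] s(2) by simp
  have W1: "1 * W \<le> (Q ^ 5 * (k * N) + 1) * W" by (rule mult_right_mono) auto
  have h3: "3 + h mod N < 2 ^ w" using hN W(1,3) W1 by linarith
  have "(h + 1) * W \<le> (Q ^ 5 * (k * N)) * W" using h by (intro mult_right_mono) auto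
  moreover have "0 < W" using W(1) by linarith
  ultimately have B: "(h + 1) * W < 2 ^ w" using W(3) by (simp add: algebra_simps)
  have z: "snd s (3 + h mod N) mod 2 ^ w = zs ! (h mod N)" using s(5) hN zs[OF hN] by simp
  have a1: "aval w (Bin Shl (Lit 1) (Reg x)) s' = 2 ^ fst s' x" if "fst s' x < w" for x s'
    using that w2[OF that] w0 by simp
  have "2 * es + 2 * ef + eE + 6 < 2 ^ w" using \<open>5 * Q + 6 < w\<close> e by (intro w2) linarith
  have vx: "aval w (Lit c \<otimes> (Lit 2 \<otimes> Reg 30 \<oplus> Lit 2 \<otimes> Reg 31 \<oplus> Reg 32 \<oplus> Lit 6)) s' = v"
    if "fst s' 30 = es" "fst s' 31 = ef" "fst s' 32 = eE" for s'
    using w2[OF v] that by (simp add: mod_simps v_def)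
  have a2: "aval w (Bin Shl (Lit 1) (Lit c \<otimes> (Lit 2 \<otimes> Reg 30 \<oplus> Lit 2 \<otimes> Reg 31 \<oplus> Reg 32 \<oplus> Lit 6))) s' = 2 ^ v"
    if "fst s' 30 = es" "fst s' 31 = ef" "fst s' 32 = eE" for s'
    unfolding aval.simps(3)[of w Shl] vx[OF that] using v w0 by simp
  have a3: "aval w (Lit 32 \<otimes> Reg 16 \<otimes> Reg 17) s' = 32 * 2 ^ es * 2 ^ ef"
    if "fst s' 16 = 2 ^ es" "fst s' 17 = 2 ^ ef" for s'
    using d d32 w32 ew that by simp
  have a4: "aval w (Reg 19 \<otimes> Reg 17) s' = 2 ^ eE * 2 ^ ef"
    if "fst s' 19 = 2 ^ eE" "fst s' 17 = 2 ^ ef" for s'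
    using d ew that by simp
  have a5: "aval w (Mem (Lit 3 \<oplus> Bin Mod (Reg 9) (Reg 3))) s' = zs ! (h mod N)"
    if "fst s' 9 = h" "fst s' 3 = N" "snd s' = snd s" for s'
  proof -
    have "aval w (Lit 3 \<oplus> Bin Mod (Reg 9) (Reg 3)) s' = 3 + h mod N"
      using that hw Nw h3 w32 by simp
    then show ?thesis using z that by (simp only: aval.simps(4))
  qed
  have a6: "aval w ((Reg 9 \<oplus> Lit 1) \<otimes> Reg 7) s' = (h + 1) * W"
    if "fst s' 9 = h" "fst s' 7 = W" for s'
    using B w0 that by (simp add: mod_simps)
  define R1 where "R1 = (fst s)(16 := 2 ^ es)"
  define R2 where "R2 = R1(17 := 2 ^ ef)"
  define R3 where "R3 = R2(19 := 2 ^ eE)"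
  define R4 where "R4 = R3(21 := 32 * 2 ^ es * 2 ^ ef)"
  define R5 where "R5 = R4(22 := 2 ^ eE * 2 ^ ef)"
  define R6 where "R6 = R5(20 := 2 ^ v)"
  define R7 where "R7 = R6(13 := zs ! (h mod N))"
  note R = R1_def R2_def R3_def R4_def R5_def R6_def R7_def
  have A1: "aval w (Bin Shl (Lit 1) (Reg 30)) s = 2 ^ es" by (subst a1) (use ew e in simp_all)
  have A2: "aval w (Bin Shl (Lit 1) (Reg 31)) (R1, snd s) = 2 ^ ef" by (subst a1) (use ew e in \<open>simp_all add: R\<close>)
  have A3: "aval w (Bin Shl (Lit 1) (Reg 32)) (R2, snd s) = 2 ^ eE" by (subst a1) (use ew e in \<open>simp_all add: R\<close>)
  have A4: "aval w (Lit 32 \<otimes> Reg 16 \<otimes> Reg 17) (R3, snd s) = 32 * 2 ^ es * 2 ^ ef" by (rule a3) (simp_all add: R)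
  have A5: "aval w (Reg 19 \<otimes> Reg 17) (R4, snd s) = 2 ^ eE * 2 ^ ef" by (rule a4) (simp_all add: R)
  have A6: "aval w (Bin Shl (Lit 1) (Lit c \<otimes> (Lit 2 \<otimes> Reg 30 \<oplus> Lit 2 \<otimes> Reg 31 \<oplus> Reg 32 \<oplus> Lit 6))) (R5, snd s) = 2 ^ v"
    by (rule a2) (simp_all add: R e)
  have A7: "aval w (Mem (Lit 3 \<oplus> Bin Mod (Reg 9) (Reg 3))) (R6, snd s) = zs ! (h mod N)"
    by (rule a5) (simp_all add: R s)
  have A8: "aval w ((Reg 9 \<oplus> Lit 1) \<otimes> Reg 7) (R7, snd s) = (h + 1) * W" by (rule a6) (simp_all add: R s)
  have "upds w (scales c) s = (R7(24 := (h + 1) * W), snd s)"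
    unfolding scales_def upds.simps fst_conv snd_conv A1 R1_def[symmetric] A2 R2_def[symmetric] A3 R3_def[symmetric]
      A4 R4_def[symmetric] A5 R5_def[symmetric] A6 R6_def[symmetric] A7 R7_def[symmetric] A8 by (rule refl)
  then show ?thesis unfolding R v_def .
qed

definition finish :: com where
  "finish = Seq (ifte S (Reg 11) Skip (ifte S (Reg 12) Skip (assigns S [(0, Lit 1)])))
      (assigns S [(9, Reg 9 \<oplus> Lit 1)])"

lemma st_upd_0: "st b h \<kappa> T' r s \<Longrightarrow> x < 2 ^ w \<Longrightarrow> st b h \<kappa> T' x ((fst s)(0 := x), snd s)"
  unfolding st_def by (simp add: bounded_upd)

lemma st_upd_9: "st b h \<kappa> T' r s \<Longrightarrow> x < 2 ^ w \<Longrightarrow> st b x \<kappa> T' r ((fst s)(9 := x), snd s)"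
  unfolding st_def by (simp add: bounded_upd)

lemma wp_inc:
  assumes s: "st b h \<kappa> T' r s" and h: "h < Q ^ 5 * (k * N)"
  shows "wp w S (assigns S [(9, Reg 9 \<oplus> Lit 1)]) (\<lambda>t s'. t \<le> 5 \<and> st b (h + 1) \<kappa> T' r s') s"
proof (rule wp_assigns)
  have b: "bounded w s" "fst s 9 = h" "fst s 10 = Q ^ 5 * (k * N)" using s unfolding st_def by blast+
  have "Q ^ 5 * (k * N) < 2 ^ w" using boundedD[OF b(1), of 10] b(3) by simp
  then have hw: "h + 1 < 2 ^ w" using h by linarith
  have a: "aval w (Reg 9 \<oplus> Lit 1) s = h + 1" using b(2) hw w by (simp add: mod_simps)
  have u: "upds w [(9, Reg 9 \<oplus> Lit 1)] s = ((fst s)(9 := h + 1), snd s)"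
    by (simp only: upds.simps fst_conv snd_conv a)
  show "upds_cost [(9, Reg 9 \<oplus> Lit 1)] \<le> 5 \<and> st b (h + 1) \<kappa> T' r (upds w [(9, Reg 9 \<oplus> Lit 1)] s)"
    unfolding u using st_upd_9[OF s hw] by simp
qed simp

lemma wp_finish:
  assumes s: "st b h \<kappa> T' r s" and h: "h < Q ^ 5 * (k * N)"
  shows "wp w S finish (\<lambda>t s'. t \<le> 20 \<and> st b (h + 1) \<kappa> T' (if \<kappa> = 0 \<and> T' = 0 then 1 else r) s') s"
proof -
  have b: "bounded w s" "fst s 11 = \<kappa>" "fst s 12 = T'" using s unfolding st_def by blast+
  have m: "\<kappa> mod 2 ^ w = \<kappa>" "T' mod 2 ^ w = T'" using bounded_mod[OF b(1), of 11] bounded_mod[OF b(1), of 12] b by auto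
  have w1: "(1::nat) < 2 ^ w" using w by (intro one_less_power) auto
  have nx: "wp w S (assigns S [(9, Reg 9 \<oplus> Lit 1)])
      (\<lambda>n' s'. t0 + n' \<le> 20 \<and> st b (h + 1) \<kappa> T' (if \<kappa> = 0 \<and> T' = 0 then 1 else r) s') s1"
    if "st b h \<kappa> T' (if \<kappa> = 0 \<and> T' = 0 then 1 else r) s1" "t0 \<le> 15" for t0 s1
    by (rule wp_mono[OF wp_inc[OF that(1) h]]) (use that(2) in auto)
  show ?thesis unfolding finish_def
  proof (rule wp_Seq, rule wp_ifte, simp)
    assume "aval w (Reg 11) s \<noteq> 0"
    then have "\<kappa> \<noteq> 0" using b m by simp
    then show "wp w S Skip (\<lambda>n s'. wp w S (assigns S [(9, Reg 9 \<oplus> Lit 1)])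
      (\<lambda>n' s'. cost (Reg 11) + Suc n + n' \<le> 20 \<and> st b (h + 1) \<kappa> T' (if \<kappa> = 0 \<and> T' = 0 then 1 else r) s') s') s"
      by (intro wp_Skip nx) (use s in auto)
  next
    assume "aval w (Reg 11) s = 0"
    then have k0: "\<kappa> = 0" using b m by simp
    show "wp w S (ifte S (Reg 12) Skip (assigns S [(0, Lit 1)])) (\<lambda>n s'. wp w S (assigns S [(9, Reg 9 \<oplus> Lit 1)])
      (\<lambda>n' s'. cost (Reg 11) + Suc n + n' \<le> 20 \<and> st b (h + 1) \<kappa> T' (if \<kappa> = 0 \<and> T' = 0 then 1 else r) s') s') s"
    proof (rule wp_ifte, simp)
      assume "aval w (Reg 12) s \<noteq> 0"
      then have "T' \<noteq> 0" using b m by simp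
      then show "wp w S Skip (\<lambda>n s'. wp w S (assigns S [(9, Reg 9 \<oplus> Lit 1)])
        (\<lambda>n' s'. cost (Reg 11) + Suc (cost (Reg 12) + Suc n) + n' \<le> 20 \<and> st b (h + 1) \<kappa> T' (if \<kappa> = 0 \<and> T' = 0 then 1 else r) s') s') s"
        by (intro wp_Skip nx) (use s in auto)
    next
      assume "aval w (Reg 12) s = 0"
      then have T0: "T' = 0" using b m by simp
      have u: "upds w [(0, Lit 1)] s = ((fst s)(0 := 1), snd s)" using w by simp
      show "wp w S (assigns S [(0, Lit 1)]) (\<lambda>n s'. wp w S (assigns S [(9, Reg 9 \<oplus> Lit 1)])
        (\<lambda>n' s'. cost (Reg 11) + Suc (cost (Reg 12) + Suc n) + n' \<le> 20 \<and> st b (h + 1) \<kappa> T' (if \<kappa> = 0 \<and> T' = 0 then 1 else r) s') s') s"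
        by (rule wp_assigns, simp, unfold u, rule nx) (use st_upd_0[OF s w1] k0 T0 in simp_all)
    qed
  qed
qed

text \<open>A round uses up one region and one list element, even without a query. Under any guess,
  a positive decision removes an admissible element, which suffices for soundness; under a right
  guess the decision is exact.\<close>

lemma wp_body:
  assumes s: "st (h + 1) h \<kappa> T' r s" and h: "h < Q ^ 5 * (k * N)" and \<kappa>: "\<kappa> \<le> k" "T' \<le> T"
  defines "\<kappa>0 \<equiv> (if h mod (k * N) = 0 then k else \<kappa>)" and "T0 \<equiv> (if h mod (k * N) = 0 then T else T')"
    and "z \<equiv> zs ! (h mod N)"
  shows "wp w S (body S p c k) (\<lambda>t s'. t \<le> cost_bound \<and> (\<exists>dec \<kappa>1 T1.
    \<kappa>1 = (if dec then \<kappa>0 - 1 else \<kappa>0) \<and> T1 = (if dec then T0 - z else T0) \<and>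
    st (h + 2) (h + 1) \<kappa>1 T1 (if \<kappa>1 = 0 \<and> T1 = 0 then 1 else r) s' \<and> (dec \<longrightarrow> 0 < \<kappa>0 \<and> z \<le> T0) \<and>
    (good (h div (k * N)) \<longrightarrow> dec = (0 < \<kappa>0 \<and> z \<le> T0 \<and> ans (\<kappa>0 - 1) (T0 - z))))) s"
proof -
  define g where "g = h div (k * N)"
  define em where "em = g mod Q"
  define es where "es = g div Q mod Q"
  define ef where "ef = g div Q div Q mod Q"
  define eE where "eE = g div Q div Q div Q mod Q"
  define ea where "ea = g div Q div Q div Q div Q mod Q"
  have eQ: "em < Q" "es < Q" "ef < Q" "eE < Q" "ea < Q" using Q by (simp_all add: em_def es_def ef_def eE_def ea_def)
  define v where "v = c * (2 * es + 2 * ef + eE + 6)"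
  define P where "P = (\<lambda>t s'. t \<le> cost_bound \<and> (\<exists>dec \<kappa>1 T1.
    \<kappa>1 = (if dec then \<kappa>0 - 1 else \<kappa>0) \<and> T1 = (if dec then T0 - z else T0) \<and>
    st (h + 2) (h + 1) \<kappa>1 T1 (if \<kappa>1 = 0 \<and> T1 = 0 then 1 else r) s' \<and> (dec \<longrightarrow> 0 < \<kappa>0 \<and> z \<le> T0) \<and>
    (good (h div (k * N)) \<longrightarrow> dec = (0 < \<kappa>0 \<and> z \<le> T0 \<and> ans (\<kappa>0 - 1) (T0 - z)))))"
  have k0: "\<kappa>0 \<le> k" "T0 \<le> T" using \<kappa> by (auto simp: \<kappa>0_def T0_def)
  have cc: "5 * Q + 6 \<le> c * (5 * Q + 6)" using c by simp
  have vle: "v \<le> c * (5 * Q + 6)" unfolding v_def using eQ by (intro mult_left_mono) auto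
  have vw: "v < w" using cap(1) vle by linarith
  have vW: "2 ^ v \<le> W" using cap(2) power_increasing[OF vle, of "2::nat"] by linarith
  have kw: "k < 2 ^ w" using k by (metis le_less_trans le_square)
  have fin: "wp w S finish (\<lambda>t'. P (t0 + t')) s4"
    if "st (h + 2) h \<kappa>1 T1 r s4" "t0 + 20 \<le> cost_bound" "\<kappa>1 = (if dec then \<kappa>0 - 1 else \<kappa>0)" "T1 = (if dec then T0 - z else T0)"
      "dec \<longrightarrow> 0 < \<kappa>0 \<and> z \<le> T0" "good g \<longrightarrow> dec = (0 < \<kappa>0 \<and> z \<le> T0 \<and> ans (\<kappa>0 - 1) (T0 - z))"
    for t0 s4 dec \<kappa>1 T1
  proof (rule wp_mono[OF wp_finish[OF that(1) h]])
    fix t :: nat and s' :: state assume f: "t \<le> 20 \<and> st (h + 2) (h + 1) \<kappa>1 T1 (if \<kappa>1 = 0 \<and> T1 = 0 then 1 else r) s'"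
    show "P (t0 + t) s'" unfolding P_def g_def[symmetric]
    proof (intro conjI exI)
      show "t0 + t \<le> cost_bound" using f that(2) by linarith
      show "\<kappa>1 = (if dec then \<kappa>0 - 1 else \<kappa>0)" "T1 = (if dec then T0 - z else T0)" by (rule that(3), rule that(4))
      show "st (h + 2) (h + 1) \<kappa>1 T1 (if \<kappa>1 = 0 \<and> T1 = 0 then 1 else r) s'" using f by blast
    qed (rule that(5), rule that(6))
  qed
  have main: "wp w S (Seq (assigns S digits) (Seq (assigns S (scales c)) (Seq (ifte S query_test (attempt S p) Skip) finish)))
      (\<lambda>t'. P (t0 + t')) s1" if s1: "st (h + 1) h \<kappa>0 T0 r s1" and t0: "t0 \<le> 20" for t0 s1
  proof -
    define s2 where "s2 = upds w digits s1"
    have b1: "bounded w s1" using s1 unfolding st_def by blast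
    have b2: "bounded w s2" unfolding s2_def by (rule bounded_upds[OF b1])
    have s2: "s2 = ((fst s1)(14 := g div Q div Q div Q div Q, 15 := 2 ^ em, 30 := es, 31 := ef, 32 := eE, 18 := 2 ^ ea), snd s1)"
      unfolding s2_def em_def es_def ef_def eE_def ea_def g_def by (rule upds_digits[OF s1])
    define s3 where "s3 = upds w (scales c) s2"
    have b3: "bounded w s3" unfolding s3_def by (rule bounded_upds[OF b2])
    have s3: "s3 = ((fst s2)(16 := 2 ^ es, 17 := 2 ^ ef, 19 := 2 ^ eE, 21 := 32 * 2 ^ es * 2 ^ ef,
      22 := 2 ^ eE * 2 ^ ef, 20 := 2 ^ v, 13 := z, 24 := (h + 1) * W), snd s2)"
      unfolding s3_def v_def z_def
      by (rule upds_scales[OF b2]) (use s1 h eQ in \<open>auto simp: s2 st_def\<close>)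
    have st3: "st (h + 1) h \<kappa>0 T0 r s3" using s1 b3 unfolding st_def by (simp add: s3 s2)
    have r3: "fst s3 15 = 2 ^ em" "fst s3 16 = 2 ^ es" "fst s3 17 = 2 ^ ef" "fst s3 18 = 2 ^ ea" "fst s3 19 = 2 ^ eE"
      "fst s3 21 = 32 * 2 ^ es * 2 ^ ef" "fst s3 22 = 2 ^ eE * 2 ^ ef" "fst s3 20 = 2 ^ v" "fst s3 13 = z"
      "fst s3 24 = (h + 1) * W" by (simp_all add: s3 s2)
    have rr: "fst s3 6 = F" "fst s3 11 = \<kappa>0" "fst s3 12 = T0" "fst s3 3 = N" "fst s3 23 = G"
      "\<forall>i<N. snd s3 (3 + i) = zs ! i" "\<forall>x\<ge>(h + 1) * W. snd s3 x = 0"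
      using st3 unfolding st_def by blast+
    have m: "x < zone \<Longrightarrow> fst s3 x mod 2 ^ w = fst s3 x" for x by (rule bounded_mod[OF b3])
    have T1: "T0 + 1 < 2 ^ w" using k0 T by linarith
    have tst: "aval w query_test s3 \<noteq> 0 \<longleftrightarrow> 2 ^ em < F \<and> 2 ^ es < F \<and> 0 < \<kappa>0 \<and> z \<le> T0"
    proof -
      have a: "aval w (Reg 12 \<oplus> Lit 1) s3 = T0 + 1" using T1 rr(3) w by (simp add: mod_simps)
      have b: "aval w (Reg 15) s3 = 2 ^ em" "aval w (Reg 6) s3 = F" "aval w (Reg 16) s3 = 2 ^ es" "aval w (Reg 11) s3 = \<kappa>0"
        "aval w (Reg 13) s3 = z"
        using m[of 15] m[of 6] m[of 16] m[of 11] m[of 13] r3 rr by simp_all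
      have o: "(of_bool x :: nat) mod 2 ^ w = of_bool x" for x using w by (cases x) simp_all
      show ?thesis unfolding query_test_def aval.simps(3)[of w Mul] aval.simps(3)[of w Less] a b
        using w by (simp add: o less_Suc_eq_le)
    qed
    have cost: "t0 + upds_cost digits + upds_cost (scales c) \<le> 150" "cost query_test \<le> 30"
      using t0 by (simp_all add: digits_def scales_def query_test_def)
    define Y where "Y = (200 + 2 * nregs p + sim_cost p) * (3 * F + k * N + 1)"
    have cbig: "300 + Y \<le> cost_bound"
    proof -
      have "cost_bound = 300 * (3 * F + k * N + 1) + Y"
        unfolding Y_def by (simp add: algebra_simps)
      then show ?thesis by simp
    qed
    have reg: "\<forall>u\<in>set digits. fst u < S \<and> regs_below S (snd u)" "\<forall>u\<in>set (scales c). fst u < S \<and> regs_below S (snd u)"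
      "regs_below S query_test"
      by (simp_all add: digits_def scales_def query_test_def)
    show ?thesis
    proof (rule wp_Seq, rule wp_assigns[OF reg(1)], unfold s2_def[symmetric], rule wp_Seq, rule wp_assigns[OF reg(2)],
        unfold s3_def[symmetric], rule wp_Seq, rule wp_ifte[OF reg(3)])
      assume "aval w query_test s3 \<noteq> 0"
      then have t: "2 ^ em < F" "2 ^ es < F" "0 < \<kappa>0" "z \<le> T0" using tst by blast+
      have "2 ^ es * 2 ^ es = (2::nat) ^ (es + es)" by (simp add: power_add)
      moreover have "es + es < w" using eQ cap(1) cc by linarith
      then have "(2::nat) ^ (es + es) < 2 ^ w" by simp
      ultimately have sq: "2 ^ es * 2 ^ es < (2::nat) ^ w" by metis
      have "(h + 2) * W \<le> (Q ^ 5 * (k * N) + 1) * W" using h by (intro mult_right_mono) auto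
      then have BW: "(h + 1) * W + W \<le> 2 ^ w" using W(3) by (simp add: algebra_simps)
      have "1 * W \<le> (h + 1) * W" by (intro mult_right_mono) auto
      then have B3: "3 + N \<le> (h + 1) * W" using W(1) by linarith
      show "wp w S (attempt S p) (\<lambda>n s'. wp w S finish (\<lambda>n'. P (t0 + (upds_cost digits +
         (upds_cost (scales c) + (cost query_test + Suc n + n'))))) s') s3"
      proof (rule wp_mono[OF wp_attempt[where k = k and zs = zs and W = W and B = "(h + 1) * W" and v = v]])
        fix t :: nat and s4 :: state
        assume q: "t \<le> 20 + (200 + 2 * nregs p + sim_cost p) * (3 * fst s3 6 + k * N + 1) \<and> bounded w s4 \<and>
          (\<forall>x<zone. x \<notin> {11, 12, 25, 26, 27, 28, 29, 33, 34, 35} \<longrightarrow> fst s4 x = fst s3 x) \<and>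
          (\<forall>x. x < (h + 1) * W \<or> (h + 1) * W + W \<le> x \<longrightarrow> snd s4 x = snd s3 x) \<and>
          (\<exists>dec. fst s4 11 = (if dec then fst s3 11 - 1 else fst s3 11) \<and>
            fst s4 12 = (if dec then fst s3 12 - fst s3 13 else fst s3 12) \<and>
            (\<forall>xs j s0. xs = instance_list (fst s3 15) (fst s3 16) (fst s3 17) (fst s3 18) (fst s3 19) (fst s3 23) zs
                 (fst s3 11 - 1) (fst s3 12 - fst s3 13) \<and>
               exec v p (init_state xs) j s0 \<and> j \<le> fst s3 6 \<and> (\<forall>x\<in>set xs. x < 2 ^ v) \<and>
               length xs \<le> 2 ^ v \<longrightarrow> dec = accepting s0))"
        then obtain dec where d: "fst s4 11 = (if dec then \<kappa>0 - 1 else \<kappa>0)" "fst s4 12 = (if dec then T0 - z else T0)"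
          "\<forall>xs j s0. xs = instance_list (2 ^ em) (2 ^ es) (2 ^ ef) (2 ^ ea) (2 ^ eE) G zs
                 (\<kappa>0 - 1) (T0 - z) \<and>
               exec v p (init_state xs) j s0 \<and> j \<le> F \<and> (\<forall>x\<in>set xs. x < 2 ^ v) \<and>
               length xs \<le> 2 ^ v \<longrightarrow> dec = accepting s0"
          unfolding r3 rr by blast
        have r4: "fst s4 x = fst s3 x" if "x < zone" "x \<notin> {11, 12, 25, 26, 27, 28, 29, 33, 34, 35}" for x
          using q that by blast
        have m4: "snd s4 x = snd s3 x" if "x < (h + 1) * W \<or> (h + 1) * W + W \<le> x" for x using q that by blast
        have b4: "bounded w s4" using q by blast
        have low: "\<forall>i<N. snd s4 (3 + i) = zs ! i"
        proof (intro allI impI)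
          fix i assume i: "i < N"
          then have "snd s4 (3 + i) = snd s3 (3 + i)" using B3 by (intro m4) linarith
          then show "snd s4 (3 + i) = zs ! i" using rr(6) i by simp
        qed
        have high: "\<forall>x\<ge>(h + 2) * W. snd s4 x = 0"
        proof (intro allI impI)
          fix x assume x: "(h + 2) * W \<le> x"
          then have "(h + 1) * W + W \<le> x" by (simp add: algebra_simps)
          then have "snd s4 x = snd s3 x" "(h + 1) * W \<le> x" using m4 by auto
          then show "snd s4 x = 0" using rr(7) by simp
        qed
        have "st (h + 2) h (if dec then \<kappa>0 - 1 else \<kappa>0) (if dec then T0 - z else T0) r s4"
          using st3 d(1,2) b4 low high r4[of 0] r4[of 2] r4[of 3] r4[of 5] r4[of 6] r4[of 7] r4[of 9] r4[of 10] r4[of 23] r4[of 36]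
          unfolding st_def by simp
        note st4 = this
        have gd: "dec = (0 < \<kappa>0 \<and> z \<le> T0 \<and> ans (\<kappa>0 - 1) (T0 - z))" if "good g"
        proof -
          have "\<kappa>0 - 1 < k" "T0 - z \<le> T" using t k0 by linarith+
          with \<open>good g\<close> obtain j s0 where
            e: "exec v p (init_state (instance_list (2 ^ em) (2 ^ es) (2 ^ ef) (2 ^ ea) (2 ^ eE) G zs (\<kappa>0 - 1) (T0 - z))) j s0"
              "j \<le> F" "accepting s0 \<longleftrightarrow> ans (\<kappa>0 - 1) (T0 - z)"
              "\<forall>x\<in>set (instance_list (2 ^ em) (2 ^ es) (2 ^ ef) (2 ^ ea) (2 ^ eE) G zs (\<kappa>0 - 1) (T0 - z)). x < 2 ^ v"
              "length (instance_list (2 ^ em) (2 ^ es) (2 ^ ef) (2 ^ ea) (2 ^ eE) G zs (\<kappa>0 - 1) (T0 - z)) \<le> 2 ^ v"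
            unfolding good_guess_def Let_def em_def es_def ef_def eE_def ea_def v_def by blast
          have "dec = accepting s0" using d(3) e by blast
          then show ?thesis using e(3) t by blast
        qed
        have "t0 + (upds_cost digits + (upds_cost (scales c) + (cost query_test + Suc t))) + 20 \<le> cost_bound"
        proof (rule order_trans[OF _ cbig])
          have "t \<le> 20 + Y" using q unfolding rr Y_def by blast
          then show "t0 + (upds_cost digits + (upds_cost (scales c) + (cost query_test + Suc t))) + 20 \<le> 300 + Y"
            using cost by linarith
        qed
        from fin[OF st4 this refl refl] show "wp w S finish (\<lambda>n'. P (t0 + (upds_cost digits +
         (upds_cost (scales c) + (cost query_test + Suc t + n'))))) s4"
          using t gd by (simp add: add.assoc)
      qed (use b3 w t k k0 rr r3 sq W BW B3 vW vw in auto)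
    next
      assume "aval w query_test s3 = 0"
      then have t: "\<not> (2 ^ em < F \<and> 2 ^ es < F \<and> 0 < \<kappa>0 \<and> z \<le> T0)" using tst by blast
      have "(h + 1) * W \<le> (h + 2) * W" by (intro mult_right_mono) auto
      then have st4: "st (h + 2) h (if False then \<kappa>0 - 1 else \<kappa>0) (if False then T0 - z else T0) r s3"
        using st3 unfolding st_def by auto
      have gd: "False = (0 < \<kappa>0 \<and> z \<le> T0 \<and> ans (\<kappa>0 - 1) (T0 - z))" if "good g"
        using that t unfolding good_guess_def Let_def em_def es_def by blast
      have "t0 + (upds_cost digits + (upds_cost (scales c) + (cost query_test + Suc 1))) + 20 \<le> cost_bound"
        by (rule order_trans[OF _ cbig]) (use cost in linarith)
      from fin[OF st4 this refl refl] show "wp w S Skip (\<lambda>n s'. wp w S finish (\<lambda>n'. P (t0 + (upds_cost digits +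
         (upds_cost (scales c) + (cost query_test + Suc n + n'))))) s') s3"
        using gd by (intro wp_Skip) (simp add: add.assoc)
    qed
  qed
  have b: "bounded w s" "fst s 9 = h" "fst s 36 = k * N" "fst s 2 = T" using s unfolding st_def by blast+
  have hm: "aval w (Bin Mod (Reg 9) (Reg 36)) s = h mod (k * N)"
  proof -
    have "h < 2 ^ w" "k * N < 2 ^ w" using boundedD[OF b(1), of 9] boundedD[OF b(1), of 36] b by simp_all
    moreover from this have "h mod (k * N) < 2 ^ w" by (meson le_less_trans mod_less_eq_dividend)
    ultimately show ?thesis using b by simp
  qed
  show ?thesis unfolding body_def P_def[symmetric] finish_def[symmetric]
  proof (rule wp_Seq, rule wp_ifte, simp)
    assume "aval w (Bin Mod (Reg 9) (Reg 36)) s \<noteq> 0"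
    then have "h mod (k * N) \<noteq> 0" using hm by simp
    then have "\<kappa>0 = \<kappa>" "T0 = T'" by (simp_all add: \<kappa>0_def T0_def)
    then show "wp w S Skip (\<lambda>n s'. wp w S (Seq (assigns S digits) (Seq (assigns S (scales c)) (Seq (ifte S query_test (attempt S p) Skip) finish)))
       (\<lambda>n'. P (cost (Bin Mod (Reg 9) (Reg 36)) + Suc n + n')) s') s"
      using s by (intro wp_Skip main) auto
  next
    assume "aval w (Bin Mod (Reg 9) (Reg 36)) s = 0"
    then have "h mod (k * N) = 0" using hm by simp
    then have k0: "\<kappa>0 = k" "T0 = T" by (simp_all add: \<kappa>0_def T0_def)
    have Tw: "T < 2 ^ w" using T by linarith
    have u: "upds w [(11, Lit k), (12, Reg 2)] s = ((fst s)(11 := k, 12 := T), snd s)"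
      using kw Tw b by simp
    have b1: "bounded w (upds w [(11, Lit k), (12, Reg 2)] s)" by (rule bounded_upds[OF b(1)])
    have st1: "st (h + 1) h \<kappa>0 T0 r ((fst s)(11 := k, 12 := T), snd s)"
      using s b1 unfolding u st_def by (simp add: k0)
    show "wp w S (assigns S [(11, Lit k), (12, Reg 2)]) (\<lambda>n s'. wp w S (Seq (assigns S digits) (Seq (assigns S (scales c)) (Seq (ifte S query_test (attempt S p) Skip) finish)))
       (\<lambda>n'. P (cost (Bin Mod (Reg 9) (Reg 36)) + Suc n + n')) s') s"
      by (rule wp_assigns, simp, unfold u, rule main[OF st1]) simp
  qed
qed

end

context search
begin

text \<open>
  Progress of the greedy search under a right guess: each pass over the list \<open>zs\<close> decreases \<open>\<kappa>\<close>, since the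
  state stays solvable and hence some element of the list leads to a solvable state.
\<close>

definition phase :: "nat \<Rightarrow> nat \<Rightarrow> nat \<Rightarrow> nat \<Rightarrow> bool" where
  "phase j \<kappa> T' r \<longleftrightarrow> ans \<kappa> T' \<and> (\<kappa> = 0 \<longrightarrow> r \<noteq> 0) \<and> \<kappa> \<le> k - j div N \<and>
    (0 < \<kappa> \<and> \<kappa> = k - j div N \<longrightarrow> (\<forall>i<j mod N. zs ! i \<le> T' \<longrightarrow> \<not> ans (\<kappa> - 1) (T' - zs ! i)))"

text \<open>A success puts \<open>\<kappa>\<close> strictly below the budget
  \<open>k - j div N\<close>. While \<open>\<kappa>\<close> equals the budget, all elements tried in
  the current pass have failed; a whole pass of failures contradicts \<open>split\<close>, which
  provides an element leading to a solvable state.\<close>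

lemma phase_step:
  assumes ph: "phase j \<kappa> T' r"
    and split: "\<And>\<kappa> T'. ans (Suc \<kappa>) T' \<Longrightarrow> \<exists>i<N. zs ! i \<le> T' \<and> ans \<kappa> (T' - zs ! i)"
    and zero: "\<And>T'. ans 0 T' \<Longrightarrow> T' = 0"
    and dec: "dec = (0 < \<kappa> \<and> zs ! (j mod N) \<le> T' \<and> ans (\<kappa> - 1) (T' - zs ! (j mod N)))"
    and new: "\<kappa>1 = (if dec then \<kappa> - 1 else \<kappa>)" "T1 = (if dec then T' - zs ! (j mod N) else T')"
  shows "phase (j + 1) \<kappa>1 T1 (if \<kappa>1 = 0 \<and> T1 = 0 then 1 else r)"
proof -
  have N0: "0 < N" using N by linarith
  have p: "ans \<kappa> T'" "\<kappa> = 0 \<longrightarrow> r \<noteq> 0" "\<kappa> \<le> k - j div N"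
    "0 < \<kappa> \<Longrightarrow> \<kappa> = k - j div N \<Longrightarrow> i < j mod N \<Longrightarrow> zs ! i \<le> T' \<Longrightarrow> \<not> ans (\<kappa> - 1) (T' - zs ! i)" for i
    using ph unfolding phase_def by blast+
  have dm: "(j + 1) mod N = 0 \<Longrightarrow> (j + 1) div N = j div N + 1 \<and> j mod N = N - 1"
    "(j + 1) mod N \<noteq> 0 \<Longrightarrow> (j + 1) div N = j div N \<and> (j + 1) mod N = j mod N + 1"
    using N0 by (auto simp: div_Suc mod_Suc split: if_splits)
  show ?thesis
  proof (cases dec)
    case True
    then have d: "0 < \<kappa>" "ans \<kappa>1 T1" "\<kappa>1 = \<kappa> - 1" using dec new by auto
    have "(j + 1) div N \<le> j div N + 1" using dm by (cases "(j + 1) mod N = 0") auto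
    then have 1: "\<kappa>1 \<le> k - (j + 1) div N" using d p(3) by linarith
    \<comment> \<open>After a success, the budget can be met exactly only at the start of a new
      pass, where no failures have to be recorded.\<close>
    have 2: "(j + 1) mod N = 0" if "\<kappa>1 = k - (j + 1) div N"
    proof (rule ccontr)
      assume "(j + 1) mod N \<noteq> 0"
      then have "(j + 1) div N = j div N" using dm(2) by simp
      then show False using that d p(3) by linarith
    qed
    show ?thesis unfolding phase_def using d(2) 1 2 zero by auto
  next
    case False
    then have d: "\<kappa>1 = \<kappa>" "T1 = T'" using new by auto
    show ?thesis
    proof (cases "\<kappa> = 0")
      case True
      then show ?thesis using p d unfolding phase_def by auto
    next
      case pos: False
      have nd: "zs ! (j mod N) \<le> T' \<Longrightarrow> \<not> ans (\<kappa> - 1) (T' - zs ! (j mod N))" using False dec pos by auto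
      show ?thesis
      proof (cases "(j + 1) mod N = 0")
        case True
        \<comment> \<open>The pass ends here; at equality, every element of the list would have
          failed.\<close>
        have "\<kappa> \<noteq> k - j div N"
        proof
          assume e: "\<kappa> = k - j div N"
          obtain i where i: "i < N" "zs ! i \<le> T'" "ans (\<kappa> - 1) (T' - zs ! i)"
            using split[of "\<kappa> - 1" T'] p(1) pos by auto
          have "i < j mod N \<or> i = j mod N" using dm(1)[OF True] i(1) by linarith
          then show False using p(4)[of i] nd i e pos by auto
        qed
        then have "\<kappa> \<le> k - (j + 1) div N" using p(3) dm(1)[OF True] by linarith
        then show ?thesis unfolding phase_def using p(1,2) d True pos by auto
      next
        case False
        have "\<not> ans (\<kappa> - 1) (T' - zs ! i)" if "\<kappa> = k - j div N" "i < j mod N + 1" "zs ! i \<le> T'" for i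
          using that p(4)[of i] nd pos by (cases "i = j mod N") auto
        then show ?thesis unfolding phase_def using p(1-3) d dm(2)[OF False] pos by auto
      qed
    qed
  qed
qed

lemma phase_end: "phase (k * N) \<kappa> T' r \<Longrightarrow> r \<noteq> 0"
proof -
  have "k * N div N = k" using N by (intro nonzero_mult_div_cancel_right) linarith
  then show "phase (k * N) \<kappa> T' r \<Longrightarrow> r \<noteq> 0" unfolding phase_def by auto
qed

text \<open>Soundness holds under every guess: the chosen elements belong to the list and account
  for the difference to \<open>(k, T)\<close>. Completeness looks only at the rounds of
  \<open>g0\<close>; later rounds cannot revoke the verdict.\<close>

lemma wp_search:
  assumes ans: "\<And>\<kappa> T'. ans \<kappa> T' \<longleftrightarrow> ksum_yes \<kappa> (set zs, T', U)"
    and s: "st 1 0 k T 0 s" and g0: "g0 < Q ^ 5" "good g0"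
  shows "wp w S (loop S (Bin Less (Reg 9) (Reg 10)) (body S p c k))
    (\<lambda>t s'. t \<le> 4 + Q ^ 5 * (k * N) * (cost_bound + 4) \<and> (fst s' 0 \<noteq> 0 \<longleftrightarrow> ans k T)) s"
proof -
  define HN where "HN = Q ^ 5 * (k * N)"
  have split: "\<exists>i<N. zs ! i \<le> T' \<and> ans \<kappa> (T' - zs ! i)" if a: "ans (Suc \<kappa>) T'" for \<kappa> T'
  proof -
    obtain ys where ys: "length ys = Suc \<kappa>" "set ys \<subseteq> set zs" "sum_list ys = T'"
      using a unfolding ans ksum_yes_def by auto
    then obtain y ys' where y: "ys = y # ys'" by (cases ys) auto
    obtain i where i: "i < N" "zs ! i = y" using ys y by (metis in_set_conv_nth list.set_intros(1) subsetD)
    have "ans \<kappa> (T' - y)" unfolding ans ksum_yes_def using ys y by (auto intro!: exI[of _ ys'])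
    then show ?thesis using i ys y by (intro exI[of _ i]) auto
  qed
  have zero: "T' = 0" if "ans 0 T'" for T' using that unfolding ans ksum_yes_def by auto
  define sound where "sound \<kappa> T' r \<longleftrightarrow> (\<exists>ys. set ys \<subseteq> set zs \<and> length ys + \<kappa> = k \<and> sum_list ys + T' = T) \<and> (r \<noteq> 0 \<longrightarrow> ans k T)"
    for \<kappa> T' r :: nat
  define compl where "compl h \<kappa> T' r \<longleftrightarrow> (ans k T \<longrightarrow> (g0 * (k * N) < h \<and> h \<le> (g0 + 1) * (k * N) \<longrightarrow>
      phase (h - g0 * (k * N)) \<kappa> T' r) \<and> ((g0 + 1) * (k * N) \<le> h \<longrightarrow> r \<noteq> 0))" for h \<kappa> T' r :: nat
  define I where "I t s' \<longleftrightarrow> (\<exists>h \<kappa> T' r. st (h + 1) h \<kappa> T' r s' \<and> h \<le> HN \<and> \<kappa> \<le> k \<and> T' \<le> T \<and>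
     t \<le> 3 + h * (cost_bound + 4) \<and> sound \<kappa> T' r \<and> compl h \<kappa> T' r)" for t s'
  have kN: "0 < k * N" using mult_le_mono[OF k(1) N] by linarith
  have tst: "aval w (Bin Less (Reg 9) (Reg 10)) s' \<noteq> 0 \<longleftrightarrow> h < HN" if "st b h \<kappa> T' r s'" for b h \<kappa> T' r s'
  proof -
    have b: "bounded w s'" "fst s' 9 = h" "fst s' 10 = HN" using that unfolding st_def HN_def by blast+
    then show ?thesis using bounded_mod[OF b(1), of 9] bounded_mod[OF b(1), of 10] w by simp
  qed
  show ?thesis unfolding HN_def[symmetric]
  proof (rule wp_loop[where I = I and \<mu> = "\<lambda>s'. HN - fst s' 9"])
    have "sound k T 0" unfolding sound_def by (auto intro: exI[of _ "[]"])
    moreover have "compl 0 k T 0" unfolding compl_def using kN by auto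
    ultimately show "I (cost (Bin Less (Reg 9) (Reg 10))) s"
      unfolding I_def using s by (intro exI[of _ 0] exI[of _ k] exI[of _ T] exI[of _ 0]) simp
  next
    fix t s' assume "I t s'" and tt: "aval w (Bin Less (Reg 9) (Reg 10)) s' \<noteq> 0"
    then obtain h \<kappa> T' r where st: "st (h + 1) h \<kappa> T' r s'" and i: "\<kappa> \<le> k" "T' \<le> T"
      "t \<le> 3 + h * (cost_bound + 4)" "sound \<kappa> T' r" "compl h \<kappa> T' r"
      unfolding I_def by blast
    have h: "h < HN" using tst[OF st] tt by simp
    have h9: "fst s' 9 = h" using st unfolding st_def by blast
    define \<kappa>0 where "\<kappa>0 = (if h mod (k * N) = 0 then k else \<kappa>)"
    define T0 where "T0 = (if h mod (k * N) = 0 then T else T')"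
    define z where "z = zs ! (h mod N)"
    have z: "z \<in> set zs" unfolding z_def using N by (intro nth_mem mod_less_divisor) linarith
    have s0: "sound \<kappa>0 T0 r" using i(4) unfolding sound_def \<kappa>0_def T0_def by (auto intro: exI[of _ "[]"])
    have k0: "\<kappa>0 \<le> k" "T0 \<le> T" using i unfolding \<kappa>0_def T0_def by auto
    show "wp w S (body S p c k) (\<lambda>m s''. I (t + (m + cost (Bin Less (Reg 9) (Reg 10)) + 1)) s'' \<and>
        HN - fst s'' 9 < HN - fst s' 9) s'"
    proof (rule wp_mono[OF wp_body[OF st h[unfolded HN_def] i(1,2)]], unfold \<kappa>0_def[symmetric] T0_def[symmetric] z_def[symmetric])
      fix m s''
      assume "m \<le> cost_bound \<and> (\<exists>dec \<kappa>1 T1.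
        \<kappa>1 = (if dec then \<kappa>0 - 1 else \<kappa>0) \<and> T1 = (if dec then T0 - z else T0) \<and>
        st (h + 2) (h + 1) \<kappa>1 T1 (if \<kappa>1 = 0 \<and> T1 = 0 then 1 else r) s'' \<and> (dec \<longrightarrow> 0 < \<kappa>0 \<and> z \<le> T0) \<and>
        (good (h div (k * N)) \<longrightarrow> dec = (0 < \<kappa>0 \<and> z \<le> T0 \<and> ans (\<kappa>0 - 1) (T0 - z))))"
      then obtain dec \<kappa>1 T1 where m: "m \<le> cost_bound" and d: "\<kappa>1 = (if dec then \<kappa>0 - 1 else \<kappa>0)"
        "T1 = (if dec then T0 - z else T0)" "st (h + 2) (h + 1) \<kappa>1 T1 (if \<kappa>1 = 0 \<and> T1 = 0 then 1 else r) s''"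
        "dec \<Longrightarrow> 0 < \<kappa>0 \<and> z \<le> T0"
        "good (h div (k * N)) \<Longrightarrow> dec = (0 < \<kappa>0 \<and> z \<le> T0 \<and> ans (\<kappa>0 - 1) (T0 - z))" by blast
      define r1 where "r1 = (if \<kappa>1 = 0 \<and> T1 = 0 then 1 else r)"
      obtain ys where ys: "set ys \<subseteq> set zs" "length ys + \<kappa>0 = k" "sum_list ys + T0 = T" and rr: "r \<noteq> 0 \<longrightarrow> ans k T"
        using s0 unfolding sound_def by blast
      have ys1: "\<exists>ys. set ys \<subseteq> set zs \<and> length ys + \<kappa>1 = k \<and> sum_list ys + T1 = T"
      proof (cases dec)
        case True
        then show ?thesis using ys d(1,2) d(4)[OF True] z by (intro exI[of _ "z # ys"]) auto
      next
        case False
        then show ?thesis using ys d(1,2) by auto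
      qed
      have "ans k T" if "\<kappa>1 = 0" "T1 = 0" using ys1 that unfolding ans ksum_yes_def by auto
      then have snd1: "sound \<kappa>1 T1 r1" using ys1 rr unfolding sound_def r1_def by auto
      have cm: "compl (h + 1) \<kappa>1 T1 r1"
        unfolding compl_def
      proof (intro impI conjI)
        assume y: "ans k T"
        have step: "phase (h + 1 - g0 * (k * N)) \<kappa>1 T1 r1" if hh: "g0 * (k * N) \<le> h" "h < (g0 + 1) * (k * N)"
        proof -
          define j where "j = h - g0 * (k * N)"
          have hj: "h = g0 * (k * N) + j" "j < k * N" using hh by (auto simp: j_def)
          have hd: "h div (k * N) = g0" unfolding hj(1) using hj(2) kN by simp
          have hm: "h mod (k * N) = j" unfolding hj(1) using hj(2) by simp
          \<comment> \<open>Since \<open>N\<close> divides \<open>k * N\<close>, every guess starts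
            at the head of the list although the element is picked by
            \<open>h mod N\<close>.\<close>
          have "h = N * (g0 * k) + j" unfolding hj(1) by simp
          then have hN: "h mod N = j mod N" by simp
          have ph: "phase j \<kappa>0 T0 r"
          proof (cases "j = 0")
            case True
            then show ?thesis unfolding phase_def \<kappa>0_def T0_def hm using y k by simp
          next
            case False
            then have "phase j \<kappa> T' r" using i(5) y hh unfolding compl_def j_def by auto
            then show ?thesis unfolding \<kappa>0_def T0_def hm using False by simp
          qed
          have j1: "h + 1 - g0 * (k * N) = j + 1" using hh(1) unfolding j_def by linarith
          show ?thesis unfolding j1 r1_def
            by (rule phase_step[OF ph split zero _ d(1)]) (use d(2,5) g0 hd hN in \<open>auto simp: z_def\<close>)
        qed
        {
          assume "g0 * (k * N) < h + 1 \<and> h + 1 \<le> (g0 + 1) * (k * N)"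
          then show "phase (h + 1 - g0 * (k * N)) \<kappa>1 T1 r1" by (intro step) linarith+
        }
        {
          assume a: "(g0 + 1) * (k * N) \<le> h + 1"
          show "r1 \<noteq> 0"
          proof (cases "(g0 + 1) * (k * N) = h + 1")
            case True
            have e: "(g0 + 1) * (k * N) = g0 * (k * N) + k * N" by simp
            have "g0 * (k * N) \<le> h" "h < (g0 + 1) * (k * N)" "h + 1 - g0 * (k * N) = k * N"
              using True kN unfolding e by linarith+
            then show ?thesis using step phase_end by metis
          next
            case False
            then have "r \<noteq> 0" using a i(5) y unfolding compl_def by auto
            then show ?thesis by (simp add: r1_def)
          qed
        }
      qed
      have k1: "\<kappa>1 \<le> k" "T1 \<le> T" using d(1,2) k0 by auto
      have h91: "fst s'' 9 = h + 1" using d(3) unfolding st_def by blast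
      have "t + (m + 3 + 1) \<le> 3 + h * (cost_bound + 4) + (cost_bound + 4)" using m i(3) by linarith
      also have "\<dots> = 3 + (h + 1) * (cost_bound + 4)" by (simp add: add_mult_distrib)
      finally have tt: "t + (m + cost (Bin Less (Reg 9) (Reg 10)) + 1) \<le> 3 + (h + 1) * (cost_bound + 4)" by simp
      have st1: "st ((h + 1) + 1) (h + 1) \<kappa>1 T1 r1 s''" using d(3) unfolding r1_def by (simp add: numeral_2_eq_2)
      have hH: "h + 1 \<le> HN" using h by linarith
      have "I (t + (m + cost (Bin Less (Reg 9) (Reg 10)) + 1)) s''"
        unfolding I_def by (rule exI, rule exI, rule exI, rule exI, intro conjI, rule st1, rule hH, rule k1, rule k1, rule tt, rule snd1, rule cm)
      then show "I (t + (m + cost (Bin Less (Reg 9) (Reg 10)) + 1)) s'' \<and> HN - fst s'' 9 < HN - fst s' 9"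
        using h91 h9 h by simp
    qed
  next
    fix t s' assume "I t s'" and tt: "aval w (Bin Less (Reg 9) (Reg 10)) s' = 0"
    then obtain h \<kappa> T' r where st: "st (h + 1) h \<kappa> T' r s'" and i: "h \<le> HN"
      "t \<le> 3 + h * (cost_bound + 4)" "sound \<kappa> T' r" "compl h \<kappa> T' r"
      unfolding I_def by blast
    have h: "h = HN" using tst[OF st] tt i(1) by simp
    have r: "fst s' 0 = r" using st unfolding st_def by blast
    have "(g0 + 1) * (k * N) \<le> Q ^ 5 * (k * N)" using g0(1) by (intro mult_right_mono) auto
    then have "(g0 + 1) * (k * N) \<le> h" unfolding h HN_def .
    then have "r \<noteq> 0 \<longleftrightarrow> ans k T" using i(3,4) unfolding sound_def compl_def by blast
    then show "t + 1 \<le> 4 + HN * (cost_bound + 4) \<and> (fst s' 0 \<noteq> 0 \<longleftrightarrow> ans k T)"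
      using i(2) h r by simp
  qed simp
qed

end


section \<open>The complete k-Sum program and its initialisation\<close>

definition setup_regs :: "nat \<Rightarrow> nat \<Rightarrow> nat \<Rightarrow> nat \<Rightarrow> nat \<Rightarrow> nat \<Rightarrow> (nat \<times> aexp) list" where
  "setup_regs k c0 c1 K qa qb = [(5, Lit c0 \<otimes> Reg 4),
    (6, Lit K \<otimes> Bin Shl (Lit 1) ((Lit qa \<otimes> Reg 4) \<oslash> Lit qb)),
    (7, Bin Shl (Lit 1) (Lit c1 \<otimes> Reg 4)), (36, Lit k \<otimes> Reg 3),
    (10, Reg 5 \<otimes> Reg 5 \<otimes> Reg 5 \<otimes> Reg 5 \<otimes> Reg 5 \<otimes> Reg 36),
    (23, Lit k \<otimes> Reg 1 \<oplus> Lit 1), (0, Lit 0), (9, Lit 0), (11, Lit k), (12, Reg 2)]"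

definition read_input :: "(nat \<times> aexp) list" where
  "read_input = [(1, Mem (Lit 0)), (2, Mem (Lit 1)), (3, Mem (Lit 2)), (8, Reg 1), (4, Lit 0)]"

definition log_loop :: "nat \<Rightarrow> com" where
  "log_loop S = loop S (Reg 8) (assigns S [(8, Reg 8 \<oslash> Lit 2), (4, Reg 4 \<oplus> Lit 1)])"

text \<open>The step limit \<open>K * 2 ^ (qa * L div qb)\<close>, with \<open>L\<close> the bit
  length of U, approximates a constant times \<open>U powr (qa / qb)\<close>; a rational exponent
  needs integer arithmetic only. Targets above \<open>k * U\<close> are rejected at once: they have
  no solution and lie outside the range in which the gadget is correct. Register 23, which holds
  \<open>G\<close>, serves as the bound.\<close>

definition ksum_program :: "com \<Rightarrow> nat \<Rightarrow> nat \<Rightarrow> nat \<Rightarrow> nat \<Rightarrow> nat \<Rightarrow> nat \<Rightarrow> nat \<Rightarrow> com" where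
  "ksum_program p c k c0 c1 K qa qb = (let S = zone + Suc (nregs p) in
    Seq (assigns S read_input) (Seq (log_loop S) (Seq (assigns S (setup_regs k c0 c1 K qa qb))
      (ifte S (Bin Less (Reg 2) (Reg 23)) (loop S (Bin Less (Reg 9) (Reg 10)) (body S p c k)) Skip))))"

lemma wp_log_loop:
  assumes S: "zone \<le> S" and b: "bounded w s" "fst s 8 = U" "fst s 4 = 0" and w: "3 \<le> w"
    and L: "2 ^ (L - 1) \<le> U" "U < 2 ^ L" "1 \<le> L" "L < 2 ^ w"
  shows "wp w S (log_loop S) (\<lambda>t s'. t \<le> 2 + 12 * L \<and> bounded w s' \<and> snd s' = snd s \<and> fst s' 4 = L \<and>
    (\<forall>x. x \<noteq> 4 \<and> x \<noteq> 8 \<longrightarrow> fst s' x = fst s x)) s"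
proof -
  define I where "I t s' \<longleftrightarrow> (\<exists>i\<le>L. t \<le> 1 + 12 * i \<and> bounded w s' \<and> snd s' = snd s \<and> fst s' 4 = i \<and>
    fst s' 8 = U div 2 ^ i \<and> (\<forall>x. x \<noteq> 4 \<and> x \<noteq> 8 \<longrightarrow> fst s' x = fst s x))" for t s'
  have 2: "(2::nat) < 2 ^ w" using power_increasing[OF w, of "2::nat"] by simp
  have Ui: "U div 2 ^ i \<noteq> 0 \<longleftrightarrow> i < L" for i
  proof
    assume "U div 2 ^ i \<noteq> 0"
    then have "2 ^ i \<le> U" by (metis div_less not_le)
    then have "(2::nat) ^ i < 2 ^ L" using L(2) by linarith
    then show "i < L" by simp
  next
    assume "i < L"
    then have "(2::nat) ^ i \<le> 2 ^ (L - 1)" by (intro power_increasing) auto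
    then have "2 ^ i \<le> U" using L(1) by linarith
    then show "U div 2 ^ i \<noteq> 0" by (simp add: div_eq_0_iff)
  qed
  show ?thesis unfolding log_loop_def
  proof (rule wp_loop[where I = I and \<mu> = "\<lambda>s'. L - fst s' 4"])
    show "I (cost (Reg 8)) s" unfolding I_def using b by (intro exI[of _ 0]) auto
  next
    fix t s' assume "I t s'" and tt: "aval w (Reg 8) s' \<noteq> 0"
    then obtain i where i: "i \<le> L" "t \<le> 1 + 12 * i" "bounded w s'" "snd s' = snd s" "fst s' 4 = i"
      "fst s' 8 = U div 2 ^ i" "\<forall>x. x \<noteq> 4 \<and> x \<noteq> 8 \<longrightarrow> fst s' x = fst s x" unfolding I_def by blast
    have m8: "fst s' 8 mod 2 ^ w = fst s' 8" by (rule bounded_mod[OF i(3)]) simp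
    have iL: "i < L" using tt m8 i(6) Ui by simp
    have "fst s' 8 div 2 < 2 ^ w" using boundedD[OF i(3), of 8] by (intro le_less_trans[OF div_le_dividend]) simp
    then have a8: "aval w (Reg 8 \<oslash> Lit 2) s' = U div 2 ^ (i + 1)"
      using m8 2 i(6) by (simp add: div_mult2_eq[symmetric] mult.commute)
    have a4: "aval w (Reg 4 \<oplus> Lit 1) ((fst s')(8 := U div 2 ^ (i + 1)), snd s') = i + 1"
      using i(5) iL L(4) w by (simp add: mod_simps)
    have u: "upds w [(8, Reg 8 \<oslash> Lit 2), (4, Reg 4 \<oplus> Lit 1)] s' = ((fst s')(8 := U div 2 ^ (i + 1), 4 := i + 1), snd s')"
      by (simp only: upds.simps fst_conv snd_conv a8 a4)
    have b': "bounded w ((fst s')(8 := U div 2 ^ (i + 1), 4 := i + 1), snd s')"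
      unfolding u[symmetric] by (rule bounded_upds[OF i(3)])
    show "wp w S (assigns S [(8, Reg 8 \<oslash> Lit 2), (4, Reg 4 \<oplus> Lit 1)])
      (\<lambda>m s''. I (t + (m + cost (Reg 8) + 1)) s'' \<and> L - fst s'' 4 < L - fst s' 4) s'"
    proof (rule wp_assigns, use S in simp, unfold u)
      show "I (t + (upds_cost [(8, Reg 8 \<oslash> Lit 2), (4, Reg 4 \<oplus> Lit 1)] + cost (Reg 8) + 1))
         ((fst s')(8 := U div 2 ^ (i + 1), 4 := i + 1), snd s') \<and>
         L - fst ((fst s')(8 := U div 2 ^ (i + 1), 4 := i + 1), snd s') 4 < L - fst s' 4"
        unfolding I_def using i iL b' by (intro conjI exI[of _ "i + 1"]) auto
    qed
  next
    fix t s' assume "I t s'" and tt: "aval w (Reg 8) s' = 0"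
    then obtain i where i: "i \<le> L" "t \<le> 1 + 12 * i" "bounded w s'" "snd s' = snd s" "fst s' 4 = i"
      "fst s' 8 = U div 2 ^ i" "\<forall>x. x \<noteq> 4 \<and> x \<noteq> 8 \<longrightarrow> fst s' x = fst s x" unfolding I_def by blast
    have m8: "fst s' 8 mod 2 ^ w = fst s' 8" by (rule bounded_mod[OF i(3)]) simp
    then have "U div 2 ^ i = 0" using tt i(6) by simp
    then have "i = L" using Ui[of i] i(1) by linarith
    then show "t + 1 \<le> 2 + 12 * L \<and> bounded w s' \<and> snd s' = snd s \<and> fst s' 4 = L \<and>
      (\<forall>x. x \<noteq> 4 \<and> x \<noteq> 8 \<longrightarrow> fst s' x = fst s x)" using i by simp
  qed (use S in simp)
qed

lemma upds_setup:
  assumes b: "bounded w s" and r: "fst s 1 = U" "fst s 2 = T" "fst s 3 = N" "fst s 4 = L"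
    and x: "qa * L < 2 ^ w" "qb < 2 ^ w" "qa * L div qb < w" "K * 2 ^ (qa * L div qb) < 2 ^ w"
      "c1 * L < w" "k < 2 ^ w" "(c0 * L) ^ 5 * (k * N) < 2 ^ w" "k * U + 1 < 2 ^ w" "c0 * L < 2 ^ w" "0 < w"
      "k * N < 2 ^ w"
  shows "upds w (setup_regs k c0 c1 K qa qb) s = ((fst s)(5 := c0 * L, 6 := K * 2 ^ (qa * L div qb),
    7 := 2 ^ (c1 * L), 36 := k * N, 10 := (c0 * L) ^ 5 * (k * N), 23 := k * U + 1, 0 := 0, 9 := 0, 11 := k, 12 := T), snd s)"
proof -
  have m: "U mod 2 ^ w = U" "T mod 2 ^ w = T" "N mod 2 ^ w = N" "L mod 2 ^ w = L"
    using bounded_mod[OF b, of 1] bounded_mod[OF b, of 2] bounded_mod[OF b, of 3] bounded_mod[OF b, of 4] r by simp_all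
  have less_w: "x < w \<Longrightarrow> x < 2 ^ w" for x :: nat using less_exp[of w] by linarith
  define R1 where "R1 = (fst s)(5 := c0 * L)"
  define R2 where "R2 = R1(6 := K * 2 ^ (qa * L div qb))"
  define R3 where "R3 = R2(7 := 2 ^ (c1 * L))"
  define R4 where "R4 = R3(36 := k * N)"
  define R5 where "R5 = R4(10 := (c0 * L) ^ 5 * (k * N))"
  define R6 where "R6 = R5(23 := k * U + 1)"
  define R7 where "R7 = R6(0 := 0)"
  define R8 where "R8 = R7(9 := 0)"
  define R9 where "R9 = R8(11 := k)"
  note R = R1_def R2_def R3_def R4_def R5_def R6_def R7_def R8_def R9_def
  have A1: "aval w (Lit c0 \<otimes> Reg 4) s = c0 * L" using x(9) r by (simp add: mod_simps)
  have A2: "aval w (Lit K \<otimes> Bin Shl (Lit 1) ((Lit qa \<otimes> Reg 4) \<oslash> Lit qb)) (R1, snd s) = K * 2 ^ (qa * L div qb)"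
  proof -
    have "aval w (Lit qa \<otimes> Reg 4) (R1, snd s) = qa * L" using x(1) r by (simp add: R mod_simps)
    then have "aval w ((Lit qa \<otimes> Reg 4) \<oslash> Lit qb) (R1, snd s) = qa * L div qb"
      unfolding aval.simps(3)[of w Div] using x(2) less_w[OF x(3)] by simp
    then have "aval w (Bin Shl (Lit 1) ((Lit qa \<otimes> Reg 4) \<oslash> Lit qb)) (R1, snd s) = 2 ^ (qa * L div qb)"
      unfolding aval.simps(3)[of w Shl] using x(3,10) by simp
    then show ?thesis unfolding aval.simps(3)[of w Mul] using x(4) by (simp add: mod_simps)
  qed
  have A3: "aval w (Bin Shl (Lit 1) (Lit c1 \<otimes> Reg 4)) (R2, snd s) = 2 ^ (c1 * L)"
  proof -
    have "aval w (Lit c1 \<otimes> Reg 4) (R2, snd s) = c1 * L" using less_w[OF x(5)] r by (simp add: R mod_simps)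
    then show ?thesis unfolding aval.simps(3)[of w Shl] using x(5,10) by simp
  qed
  have A4: "aval w (Lit k \<otimes> Reg 3) (R3, snd s) = k * N" using x(11) r by (simp add: R mod_simps)
  have A5: "aval w (Reg 5 \<otimes> Reg 5 \<otimes> Reg 5 \<otimes> Reg 5 \<otimes> Reg 5 \<otimes> Reg 36) (R4, snd s) = (c0 * L) ^ 5 * (k * N)"
  proof -
    have "aval w (Reg 5 \<otimes> Reg 5 \<otimes> Reg 5 \<otimes> Reg 5 \<otimes> Reg 5 \<otimes> Reg 36) (R4, snd s) =
      (R4 5 * R4 5 * R4 5 * R4 5 * R4 5 * R4 36) mod 2 ^ w"
      by (simp only: aval.simps binop_val.simps mod_simps fst_conv)
    also have "R4 5 = c0 * L" by (simp add: R)
    also have "R4 36 = k * N" by (simp add: R)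
    also have "c0 * L * (c0 * L) * (c0 * L) * (c0 * L) * (c0 * L) * (k * N) = (c0 * L) ^ 5 * (k * N)"
      by (simp only: numeral_eq_Suc pred_numeral_simps power.simps eval_nat_numeral mult_1_right mult.assoc Nat.One_nat_def BitM.simps)
    finally show ?thesis using x(7) by simp
  qed
  have A6: "aval w (Lit k \<otimes> Reg 1 \<oplus> Lit 1) (R5, snd s) = k * U + 1" using x(8,10) r by (simp add: R mod_simps)
  have A7: "aval w (Lit 0) (R6, snd s) = 0" by simp
  have A8: "aval w (Lit 0) (R7, snd s) = 0" by simp
  have A9: "aval w (Lit k) (R8, snd s) = k" using x(6) by simp
  have A10: "aval w (Reg 2) (R9, snd s) = T" using m r by (simp add: R)
  have "upds w (setup_regs k c0 c1 K qa qb) s = (R9(12 := T), snd s)"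
    unfolding setup_regs_def upds.simps fst_conv snd_conv A1 R1_def[symmetric] A2 R2_def[symmetric] A3 R3_def[symmetric]
      A4 R4_def[symmetric] A5 R5_def[symmetric] A6 R6_def[symmetric] A7 R7_def[symmetric] A8 R8_def[symmetric]
      A9 R9_def[symmetric] A10 by (rule refl)
  then show ?thesis unfolding R .
qed

section \<open>Existence of a right guess\<close>

lemma sum_lessThan_nat: "(\<Sum>i<n. i) = (n * n - n) div (2::nat)"
proof -
  have "2 * (\<Sum>i<n. i) + n = n * n" by (induction n) (auto simp: algebra_simps)
  then show ?thesis by linarith
qed

lemma floor_log_eq: assumes "2 ^ x \<le> n" "n < 2 ^ (x + 1)" shows "floor_log n = x"
proof -
  have "0 < n" using assms(1) by (metis gr0I le_zero_eq power_not_zero zero_neq_numeral)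
  then show ?thesis using assms by (intro floor_log_eqI) auto
qed

lemma mod_mult_self_add: "x < Q \<Longrightarrow> (x + Q * y) mod Q = x" "x < Q \<Longrightarrow> (x + Q * y) div Q = (y::nat)"
  by simp_all

text \<open>Besides correctness of the gadget, the point is that the guessed word length is the true
  one: the target is the largest number of the input, and its bit length is
  \<open>2 * es + 2 * ef + eE + 6\<close>.\<close>

lemma good_of_gadget:
  fixes em es ef eE ea k U :: nat and zs :: "nat list"
  assumes gad: "gadget k U (2 ^ em) (2 ^ es) (2 ^ ef) (2 ^ ea) (2 ^ eE) (set zs)"
    and zs: "distinct zs" and eQ: "em < Q" "es < Q" "ef < Q" "eE < Q" "ea < Q"
    and F: "2 ^ em < F" "2 ^ es < F" and T: "T \<le> k * U" and c: "1 \<le> c"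
    and solves: "\<And>\<kappa> T' xs. \<kappa> < k \<Longrightarrow> T' \<le> T \<Longrightarrow>
      xs \<in> subset_sum_encodings (gadget.X k U (2 ^ em) (2 ^ es) (2 ^ ef) (2 ^ ea) (2 ^ eE) (set zs) \<kappa>,
        gadget.target k U (2 ^ es) (2 ^ ef) (2 ^ eE) \<kappa> T') \<Longrightarrow>
      \<exists>j s0. exec (word_length c xs) p (init_state xs) j s0 \<and> j \<le> F \<and> (accepting s0 \<longleftrightarrow>
       subset_sum_yes (gadget.X k U (2 ^ em) (2 ^ es) (2 ^ ef) (2 ^ ea) (2 ^ eE) (set zs) \<kappa>,
        gadget.target k U (2 ^ es) (2 ^ ef) (2 ^ eE) \<kappa> T'))"
  shows "\<exists>g<Q ^ 5. good_guess p c k Q F T (k * U + 1) zs (\<lambda>\<kappa> T'. ksum_yes \<kappa> (set zs, T', U)) g"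
proof -
  interpret gadget k U "2 ^ em" "2 ^ es" "2 ^ ef" "2 ^ ea" "2 ^ eE" "set zs" by (rule gad)
  define v where "v = c * (2 * es + 2 * ef + eE + 6)"
  have N: "card (set zs) = length zs" using distinct_card[OF zs] .
  let ?il = "instance_list (2 ^ em) (2 ^ es) (2 ^ ef) (2 ^ ea) (2 ^ eE) (k * U + 1) zs"
  have main: "(\<exists>j s0. exec v p (init_state (?il \<kappa> T')) j s0 \<and> j \<le> F \<and> (accepting s0 \<longleftrightarrow> ksum_yes \<kappa> (set zs, T', U))) \<and>
      (\<forall>x\<in>set (?il \<kappa> T'). x < 2 ^ v) \<and> length (?il \<kappa> T') \<le> 2 ^ v"
    if \<kappa>: "\<kappa> < k" and T': "T' \<le> T" for \<kappa> T'
  proof -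
    have k': "\<kappa> \<le> k" "T' \<le> k * U" using \<kappa> T' T by linarith+
    define n where "n = 2 ^ em + 2 ^ es + \<kappa> * length zs"
    have "(\<Sum>i<2 ^ es. filler d H (2 ^ ef) i) = 2 ^ es * (d * H + 4 * 2 ^ ef) + d * (\<Sum>i<2 ^ es. i)"
    proof -
      have "(\<Sum>i<2 ^ es. filler d H (2 ^ ef) i) = (\<Sum>i<2 ^ es. (d * H + 4 * 2 ^ ef) + d * i)"
        by (intro sum.cong) (auto simp: filler_def algebra_simps)
      then show ?thesis by (simp only: sum.distrib sum_distrib_left sum_constant card_lessThan of_nat_id distrib_left)
    qed
    moreover have "(\<Sum>j<\<kappa>. d * (2 ^ eE + G * j) + 1) = \<kappa> * (d * 2 ^ eE + 1) + d * (G * (\<Sum>j<\<kappa>. j))"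
    proof -
      have "(\<Sum>j<\<kappa>. d * (2 ^ eE + G * j) + 1) = (\<Sum>j<\<kappa>. (d * 2 ^ eE + 1) + d * (G * j))"
        by (intro sum.cong) (auto simp: algebra_simps)
      then show ?thesis by (simp only: sum.distrib sum_distrib_left sum_constant card_lessThan of_nat_id distrib_left)
    qed
    ultimately have tv: "target_val (2 ^ es) (2 ^ ef) (2 ^ eE) (k * U + 1) \<kappa> T' = target \<kappa> T'"
      unfolding target_def target_val_def sum_lessThan_nat d_def H_def G_def by simp
    have el: "elem_at (2 ^ em) (2 ^ es) (2 ^ ef) (2 ^ ea) (2 ^ eE) (k * U + 1) zs = elem zs"
      by (rule ext) (simp add: elem_at_def elem_def d_def H_def G_def N)
    have il: "?il \<kappa> T' = [target \<kappa> T', n] @ map (elem zs) [0..<n]"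
      unfolding instance_list_def Let_def tv el n_def by (rule refl)
    have enc: "?il \<kappa> T' \<in> subset_sum_encodings (X \<kappa>, target \<kappa> T')"
      unfolding il n_def using encoding[OF zs refl, of "target \<kappa> T'" \<kappa>] by (simp add: N)
    have sm: "set (map (elem zs) [0..<n]) = X \<kappa>" using elem_image[OF zs refl, of \<kappa>] by (simp add: n_def N)
    have le: "y \<le> target \<kappa> T'" if "y \<in> set (map (elem zs) [0..<n])" for y
      using that elements_le_target[OF k'] unfolding sm by blast
    have n2: "n + 2 \<le> target \<kappa> T'" using size_le_target[OF k'] by (simp add: n_def N)
    \<comment> \<open>The exponent of two in \<open>s * d * H = 32 * s ^ 2 * \<phi> ^ 2 * E\<close>;
      the 5 comes from the factor 32. The bit length is one more.\<close>
    define x where "x = 2 * es + 2 * ef + eE + 5"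
    have "2 ^ es * d * H = 2 ^ x"
      unfolding x_def power_add mult_2 by (simp add: d_def H_def mult_ac)
    then have tb: "2 ^ x \<le> target \<kappa> T'" "target \<kappa> T' < 2 ^ (x + 1)" using target_bounds[OF k'] by simp_all
    have wl: "word_length c (?il \<kappa> T') = v"
    proof -
      have "word_length c (?il \<kappa> T') = c * (floor_log (max (length (map (elem zs) [0..<n]) + 2) (target \<kappa> T')) + 1)"
        unfolding il by (rule word_length_max) (use le n2 in auto)
      also have "max (length (map (elem zs) [0..<n]) + 2) (target \<kappa> T') = target \<kappa> T'" using n2 by simp
      also have "floor_log (target \<kappa> T') = x" by (rule floor_log_eq[OF tb])
      finally show ?thesis by (simp add: v_def x_def)
    qed
    have "1 * (2 * es + 2 * ef + eE + 6) \<le> v" unfolding v_def using c by (rule mult_right_mono) simp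
    then have "x + 1 \<le> v" by (simp add: x_def)
    then have "(2::nat) ^ (x + 1) \<le> 2 ^ v" by (intro power_increasing) auto
    then have tv2: "target \<kappa> T' < 2 ^ v" using tb by linarith
    have small: "\<forall>y\<in>set (?il \<kappa> T'). y < 2 ^ v"
    proof
      fix y assume "y \<in> set (?il \<kappa> T')"
      then have "y \<le> target \<kappa> T'" using le n2 unfolding il by auto
      then show "y < 2 ^ v" using tv2 by linarith
    qed
    have len: "length (?il \<kappa> T') \<le> 2 ^ v" unfolding il using n2 tv2 by simp
    from solves[OF \<kappa> T' enc] obtain j s0 where "exec v p (init_state (?il \<kappa> T')) j s0" "j \<le> F"
      "accepting s0 \<longleftrightarrow> ksum_yes \<kappa> (set zs, T', U)"
      unfolding wl gadget_correct[OF k'] by blast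
    then show ?thesis using small len by blast
  qed
  \<comment> \<open>The number with these base-\<open>Q\<close> digits, in the order in which
    \<open>digits\<close> extracts them.\<close>
  define g where "g = em + Q * (es + Q * (ef + Q * (eE + Q * ea)))"
  have g1: "g mod Q = em" "g div Q = es + Q * (ef + Q * (eE + Q * ea))"
    unfolding g_def using mod_mult_self_add[OF eQ(1)] by blast+
  have g2: "g div Q mod Q = es" "g div Q div Q = ef + Q * (eE + Q * ea)"
    unfolding g1 using mod_mult_self_add[OF eQ(2)] by blast+
  have g3: "g div Q div Q mod Q = ef" "g div Q div Q div Q = eE + Q * ea"
    unfolding g2 using mod_mult_self_add[OF eQ(3)] by blast+
  have g4: "g div Q div Q div Q mod Q = eE" "g div Q div Q div Q div Q = ea"
    unfolding g3 using mod_mult_self_add[OF eQ(4)] by blast+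
  have g5: "g div Q div Q div Q div Q mod Q = ea" unfolding g4 using eQ(5) by simp
  have step: "x + Q * y < Q * B" if "x < Q" "y < B" for x y B :: nat
  proof -
    have "x + Q * y < Q * (y + 1)" using that(1) by simp
    also have "\<dots> \<le> Q * B" using that(2) by (intro mult_left_mono) auto
    finally show ?thesis .
  qed
  have "g < Q * (Q * (Q * (Q * Q)))" unfolding g_def by (intro step eQ)
  then have "g < Q ^ 5" by (simp add: eval_nat_numeral)
  moreover have "good_guess p c k Q F T (k * U + 1) zs (\<lambda>\<kappa> T'. ksum_yes \<kappa> (set zs, T', U)) g"
  proof -
    show ?thesis unfolding good_guess_def Let_def g1(1) g2(1) g3(1) g4(1) g5 v_def[symmetric] using F main by blast
  qed
  ultimately show ?thesis by blast
qed


text \<open>A region has \<open>2 ^ (region_exp c k c0 K * L)\<close> cells. The first summand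
  covers the memory of the simulated machine, the summands with \<open>K\<close> and
  \<open>k\<close> an instance of at most \<open>2 * F + k * N + 2\<close> cells, and 6 is a
  reserve.\<close>

definition region_exp :: "nat \<Rightarrow> nat \<Rightarrow> nat \<Rightarrow> nat \<Rightarrow> nat" where
  "region_exp c k c0 K = c * (5 * c0 + 6) + 2 * K + k + 6"

text \<open>Words must address all regions: beyond the size of one region, \<open>5 * c0\<close> is
  for \<open>Q ^ 5\<close> and \<open>k\<close> for \<open>k * N\<close>. The other summands let the
  constants \<open>k * k\<close>, \<open>qa\<close>, \<open>qb\<close> and \<open>K\<close>
  fit.\<close>

definition word_factor :: "nat \<Rightarrow> nat \<Rightarrow> nat \<Rightarrow> nat \<Rightarrow> nat \<Rightarrow> nat \<Rightarrow> nat" where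
  "word_factor c k c0 K qa qb = region_exp c k c0 K + 5 * c0 + k + k * k + qa + qb + K + 10"

text \<open>Most size conditions reduce to \<open>y * L < w\<close> for a constant \<open>y\<close>
  below the word factor. This holds because \<open>L\<close> is at most the bit length of the
  largest input number, of which \<open>w\<close> is a multiple by that factor.\<close>

lemma ksum_program_correct:
  fixes p :: com and c k c0 K qa qb U T L :: nat and zs :: "nat list"
  defines "F \<equiv> K * 2 ^ (qa * L div qb)" and "Q \<equiv> c0 * L" and "N \<equiv> length zs"
  assumes par: "1 \<le> c" "1 \<le> k" "1 \<le> c0" "1 \<le> qb" "qa \<le> qb"
    and U: "set zs \<subseteq> {1..U}" "distinct zs"
    and L: "2 ^ (L - 1) \<le> U" "U < 2 ^ L" "1 \<le> L"
    and xs: "xs = [U, T, N] @ zs" and w: "w = word_length (word_factor c k c0 K qa qb) xs"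
    and good: "1 \<le> N \<Longrightarrow> T \<le> k * U \<Longrightarrow>
      \<exists>g<Q ^ 5. good_guess p c k Q F T (k * U + 1) zs (\<lambda>\<kappa> T'. ksum_yes \<kappa> (set zs, T', U)) g"
  shows "\<exists>n s. exec w (ksum_program p c k c0 (region_exp c k c0 K) K qa qb) (init_state xs) n s \<and>
    n \<le> 200 + 12 * L + Q ^ 5 * (k * N) * ((500 + 2 * nregs p + sim_cost p) * (3 * F + k * N + 1) + 4) \<and>
    (accepting s \<longleftrightarrow> ksum_yes k (set zs, T, U))"
proof -
  define c1 where "c1 = region_exp c k c0 K"
  define c' where "c' = word_factor c k c0 K qa qb"
  define W where "W = (2::nat) ^ (c1 * L)"
  define G where "G = k * U + 1"
  define mx where "mx = Max (set (length xs # xs))"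
  define l where "l = floor_log mx + 1"
  define S where "S = zone + Suc (nregs p)"
  have wl: "w = c' * l" by (simp add: w word_length_def c'_def l_def mx_def)
  have c1: "c1 = c * (5 * c0 + 6) + 2 * K + k + 6" by (simp add: c1_def region_exp_def)
  have c': "c' = c1 + 5 * c0 + k + k * k + qa + qb + K + 10" by (simp add: c'_def word_factor_def c1_def)
  have "y < 2 ^ l" if "y \<in> set xs" for y
  proof -
    have "y \<le> mx" unfolding mx_def using that by (intro Max_ge) auto
    also have "mx < 2 ^ l" using floor_log_exp2_gt[of mx] by (simp add: l_def)
    finally show ?thesis .
  qed
  then have xl: "U < 2 ^ l" "T < 2 ^ l" "N < 2 ^ l" "\<And>y. y \<in> set zs \<Longrightarrow> y < 2 ^ l" by (auto simp: xs)
  have "(2::nat) ^ (L - 1) < 2 ^ l" using L(1) xl(1) by linarith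
  then have Ll: "L \<le> l" using L(3) by simp
  have aL: "y * L < w" if "y < c'" for y
  proof -
    have "y * L \<le> y * l" using Ll by simp
    also have "\<dots> < c' * l" using that L(3) Ll by simp
    finally show ?thesis by (simp add: wl)
  qed
  have aw: "y < w" if "y < c'" for y using aL[OF that] L(3) by (metis le_less_trans mult.right_neutral mult_le_mono2)
  have pw: "y < w \<Longrightarrow> y < 2 ^ w" for y :: nat using less_exp[of w] by linarith
  have w3: "3 \<le> w" using aw[of 3] c' by simp
  have "2 * l \<le> w" unfolding wl using c' by (intro mult_right_mono) auto
  then have lw: "l < w" using L(3) Ll by linarith
  then have lw2: "(2::nat) ^ l < 2 ^ w" by simp
  have in_w: "U < 2 ^ w" "T + 1 < 2 ^ w" "N < 2 ^ w" using xl(1-3) lw2 by linarith+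
  have zs_w: "y < 2 ^ w" if "y \<in> set zs" for y using xl(4)[OF that] lw2 by linarith
  have NU: "N \<le> U" using card_mono[OF _ U(1)] distinct_card[OF U(2)] by (simp add: N_def)
  have NL: "N < 2 ^ L" using NU L(2) by linarith
  have U1: "1 \<le> U" using L(1) by (metis le_trans one_le_power one_le_numeral)
  have FL: "F \<le> K * 2 ^ L"
  proof -
    have "qa * L div qb \<le> qb * L div qb" using par by (intro div_le_mono mult_right_mono) auto
    then have "qa * L div qb \<le> L" using par by simp
    then show ?thesis unfolding F_def by (intro mult_left_mono power_increasing) auto
  qed
  have two: "y < 2 ^ y" for y :: nat by (rule less_exp)
  have addL: "y + L \<le> (y + 1) * L" for y using L(3) by simp
  have W1: "2 * F + k * N + 2 < W"
  proof -
    have "k * N \<le> k * 2 ^ L" using NL by simp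
    moreover have "2 \<le> 2 * (2::nat) ^ L" by simp
    ultimately have "2 * F + k * N + 2 \<le> 2 * (K * 2 ^ L) + k * 2 ^ L + 2 * 2 ^ L" using FL by linarith
    also have "\<dots> = (2 * K + k + 2) * 2 ^ L" by (simp add: algebra_simps)
    also have "\<dots> < 2 ^ (2 * K + k + 2) * 2 ^ L" by (intro mult_strict_right_mono two) simp
    also have "\<dots> = 2 ^ (2 * K + k + 2 + L)" by (simp add: power_add)
    also have "\<dots> \<le> W" unfolding W_def
    proof (rule power_increasing)
      have "2 * K + k + 2 + L \<le> (2 * K + k + 2 + 1) * L" by (rule addL)
      also have "\<dots> \<le> c1 * L" unfolding c1 by (intro mult_right_mono) auto
      finally show "2 * K + k + 2 + L \<le> c1 * L" .
    qed simp
    finally show ?thesis .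
  qed
  have W2: "3 + N \<le> W"
  proof -
    have "3 + N \<le> 2 ^ (2 + L)" using NL by simp
    also have "\<dots> \<le> W" unfolding W_def
    proof (rule power_increasing)
      have "2 + L \<le> (2 + 1) * L" by (rule addL)
      also have "\<dots> \<le> c1 * L" unfolding c1 by (intro mult_right_mono) auto
      finally show "2 + L \<le> c1 * L" .
    qed simp
    finally show ?thesis .
  qed
  have Q1: "1 \<le> Q" unfolding Q_def using par(3) L(3) by simp
  \<comment> \<open>The estimate \<open>Q ^ 5 \<le> 2 ^ (5 * Q)\<close> is wasteful but keeps the
    exponent linear in \<open>L\<close>.\<close>
  have W3: "(Q ^ 5 * (k * N) + 1) * W \<le> 2 ^ w"
  proof -
    have "Q ^ 5 \<le> (2 ^ Q) ^ 5" using two[of Q] by (intro power_mono) auto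
    also have "\<dots> = 2 ^ (5 * c0 * L)" by (simp add: power_mult[symmetric] Q_def mult.commute mult.left_commute)
    finally have q5: "Q ^ 5 \<le> 2 ^ (5 * c0 * L)" .
    have "k * N + 1 \<le> (k + 1) * 2 ^ L"
    proof -
      have "k * N \<le> k * 2 ^ L" using NL by simp
      moreover have "(1::nat) \<le> 2 ^ L" "(k + 1) * 2 ^ L = k * 2 ^ L + 2 ^ L" by simp_all
      ultimately show ?thesis by linarith
    qed
    also have "\<dots> \<le> 2 ^ k * 2 ^ L" by (intro mult_right_mono) (auto simp: Suc_le_eq)
    finally have kn: "k * N + 1 \<le> 2 ^ (k + L)" by (simp add: power_add)
    have "1 ^ 5 \<le> Q ^ 5" using Q1 by (intro power_mono) auto
    then have "Q ^ 5 * (k * N) + 1 \<le> Q ^ 5 * (k * N + 1)" by simp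
    also have "\<dots> \<le> 2 ^ (5 * c0 * L) * 2 ^ (k + L)" using q5 kn by (intro mult_mono) auto
    finally have "(Q ^ 5 * (k * N) + 1) * W \<le> 2 ^ (5 * c0 * L) * 2 ^ (k + L) * W" by (intro mult_right_mono) auto
    also have "\<dots> = 2 ^ (5 * c0 * L + (k + L) + c1 * L)" by (simp add: W_def power_add)
    also have "\<dots> \<le> 2 ^ w"
    proof (rule power_increasing)
      have "k + L \<le> (k + 1) * L" by (rule addL)
      then have "5 * c0 * L + (k + L) + c1 * L \<le> (5 * c0 + (k + 1) + c1) * L" by (simp add: add_mult_distrib)
      also have "\<dots> < w" by (rule aL) (simp add: c')
      finally show "5 * c0 * L + (k + L) + c1 * L \<le> w" by simp
    qed simp
    finally show ?thesis .
  qed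
  have Ww: "1 * W \<le> (Q ^ 5 * (k * N) + 1) * W" by (rule mult_right_mono) auto
  then have Ww: "W \<le> 2 ^ w" using W3 by linarith
  have cap: "c * (5 * Q + 6) \<le> c * (5 * c0 + 6) * L"
  proof -
    have "5 * Q + 6 \<le> (5 * c0 + 6) * L" using L(3) by (simp add: Q_def add_mult_distrib)
    then have "c * (5 * Q + 6) \<le> c * ((5 * c0 + 6) * L)" by (rule mult_left_mono) simp
    then show ?thesis by (simp only: mult.assoc)
  qed
  have cap1: "c * (5 * Q + 6) < w" 
  proof (rule le_less_trans[OF cap aL])
    show "c * (5 * c0 + 6) < c'" unfolding c' c1 by linarith
  qed
  have "c * (5 * c0 + 6) * L \<le> c1 * L" unfolding c1 by (intro mult_right_mono) auto
  then have "c * (5 * Q + 6) \<le> c1 * L" using cap by linarith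
  then have cap2: "2 ^ (c * (5 * Q + 6)) \<le> W" unfolding W_def by (rule power_increasing) simp
  have kk: "k * k < 2 ^ w" by (rule pw[OF aw]) (simp add: c')
  have Gw: "G < 2 ^ w"
  proof -
    have "k * U + 1 \<le> k * (2 ^ L - 1) + k" using L(2) par(2) by (intro add_mono mult_left_mono) auto
    also have "\<dots> = k * 2 ^ L" by (simp add: algebra_simps)
    also have "\<dots> < 2 ^ k * 2 ^ L" by (intro mult_strict_right_mono two) simp
    also have "\<dots> = 2 ^ (k + L)" by (simp add: power_add)
    also have "\<dots> \<le> 2 ^ w"
    proof (rule power_increasing)
      have "k + L \<le> (k + 1) * L" by (rule addL)
      also have "\<dots> < w" by (rule aL) (simp add: c')
      finally show "k + L \<le> w" by simp
    qed simp
    finally show ?thesis by (simp add: G_def)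
  qed
  let ?ans = "\<lambda>\<kappa> T'. ksum_yes \<kappa> (set zs, T', U)"
  let ?body = "loop S (Bin Less (Reg 9) (Reg 10)) (body S p c k)"
  let ?CB = "(500 + 2 * nregs p + sim_cost p) * (3 * F + k * N + 1)"
  define fin where "fin = (\<lambda>t s'. t \<le> 200 + 12 * L + Q ^ 5 * (k * N) * (?CB + 4) \<and> (accepting s' \<longleftrightarrow> ?ans k T))"
  have init_mem: "snd (init_state xs) 0 = U" "snd (init_state xs) (Suc 0) = T" "snd (init_state xs) 2 = N"
    "\<forall>i<N. snd (init_state xs) (3 + i) = zs ! i" "\<forall>x\<ge>N + 3. snd (init_state xs) x = 0"
    by (auto simp: init_state_def xs N_def nth_Cons numeral_2_eq_2 numeral_3_eq_3)
  have b0: "bounded w (init_state xs)" by (simp add: bounded_def init_state_def)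
  define s1 where "s1 = upds w read_input (init_state xs)"
  have "(2::nat) < 2 ^ w" using power_increasing[OF w3, of "2::nat"] by simp
  then have s1: "s1 = ((\<lambda>_. 0)(1 := U, 2 := T, 3 := N, 8 := U, 4 := 0), snd (init_state xs))"
    using in_w w3 unfolding s1_def read_input_def
    by (simp add: init_mem) (simp add: init_state_def fun_upd_twist)
  have b1: "bounded w s1" unfolding s1_def by (rule bounded_upds[OF b0])
  have "wp w S (ksum_program p c k c0 c1 K qa qb) fin (init_state xs)"
    unfolding ksum_program_def Let_def S_def[symmetric]
  proof (rule wp_Seq, rule wp_assigns, simp add: read_input_def S_def, unfold s1_def[symmetric], rule wp_Seq,
      rule wp_mono[OF wp_log_loop[OF _ b1 _ _ w3 L]])
    show "zone \<le> S" by (simp add: S_def)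
    show "fst s1 8 = U" "fst s1 4 = 0" by (simp_all add: s1)
    show "L < 2 ^ w" using Ll lw pw by (meson le_less_trans)
    fix t2 s2 assume q2: "t2 \<le> 2 + 12 * L \<and> bounded w s2 \<and> snd s2 = snd s1 \<and> fst s2 4 = L \<and>
      (\<forall>x. x \<noteq> 4 \<and> x \<noteq> 8 \<longrightarrow> fst s2 x = fst s1 x)"
    have b2: "bounded w s2" using q2 by blast
    have r2: "fst s2 1 = U" "fst s2 2 = T" "fst s2 3 = N" "fst s2 4 = L" "snd s2 = snd (init_state xs)"
      using q2 by (simp_all add: s1)
    define s3 where "s3 = upds w (setup_regs k c0 c1 K qa qb) s2"
    have b3: "bounded w s3" unfolding s3_def by (rule bounded_upds[OF b2])
    have "(c0 * L) ^ 5 * (k * N) < 2 ^ w"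
    proof -
      have "0 < W" by (simp add: W_def)
      then have "(Q ^ 5 * (k * N) + 1) * 1 \<le> (Q ^ 5 * (k * N) + 1) * W" by (intro mult_left_mono) auto
      then show ?thesis using W3 by (simp add: Q_def)
    qed
    moreover have "qa * L div qb < w"
      using aL[of qa] c' by (intro le_less_trans[OF div_le_dividend]) simp
    ultimately have s3: "s3 = ((fst s2)(5 := c0 * L, 6 := K * 2 ^ (qa * L div qb),
      7 := 2 ^ (c1 * L), 36 := k * N, 10 := (c0 * L) ^ 5 * (k * N), 23 := k * U + 1, 0 := 0, 9 := 0, 11 := k, 12 := T), snd s2)"
      unfolding s3_def
      by (intro upds_setup[OF b2 r2(1-4)])
        (use aL[of qa] aw[of qb] aL[of c1] aw[of k] aL[of c0] c' pw W1 Ww Gw w3 in \<open>auto simp: F_def G_def\<close>)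
    have cost: "upds_cost read_input \<le> 30" "upds_cost (setup_regs k c0 c1 K qa qb) \<le> 60"
      by (simp_all add: read_input_def setup_regs_def)
    define t0 where "t0 = upds_cost read_input + (t2 + upds_cost (setup_regs k c0 c1 K qa qb))"
    have t0: "t0 \<le> 92 + 12 * L" unfolding t0_def using cost q2 by linarith
    have "wp w S (ifte S (Bin Less (Reg 2) (Reg 23)) ?body Skip) (\<lambda>t. fin (t0 + t)) s3"
    proof (rule wp_ifte)
      show "regs_below S (Bin Less (Reg 2) (Reg 23))" by (simp add: S_def)
      have tst: "aval w (Bin Less (Reg 2) (Reg 23)) s3 \<noteq> 0 \<longleftrightarrow> T \<le> k * U"
        using bounded_mod[OF b3, of 2] bounded_mod[OF b3, of 23] w3 by (simp add: s3 r2 less_Suc_eq_le)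
      {
        assume "aval w (Bin Less (Reg 2) (Reg 23)) s3 \<noteq> 0"
        then have T: "T \<le> k * U" using tst by blast
        show "wp w S ?body (\<lambda>n. fin (t0 + (cost (Bin Less (Reg 2) (Reg 23)) + Suc n))) s3"
        proof (cases "1 \<le> N")
          case True
          obtain g where g: "g < Q ^ 5" "good_guess p c k Q F T G zs ?ans g"
            using good[OF True T] unfolding G_def by blast
          interpret search p c k w Q F W T G zs ?ans
            by unfold_locales
              (use w3 True par kk Q1 cap1 cap2 W1 W2 W3 in_w zs_w in \<open>auto simp: N_def\<close>)
          have zr: "\<forall>x\<ge>W. snd (init_state xs) x = 0" using init_mem(5) W2 by auto
          have st: "st 1 0 k T 0 s3"
            unfolding st_def using b3 init_mem(4) zr by (simp add: s3 r2 Q_def F_def W_def G_def N_def)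
          show ?thesis
          proof (rule wp_mono[OF wp_search[OF refl st g, folded S_def N_def]])
            fix t :: nat and s' :: state assume "t \<le> 4 + Q ^ 5 * (k * N) * (?CB + 4) \<and> (fst s' 0 \<noteq> 0 \<longleftrightarrow> ksum_yes k (set zs, T, U))"
            then show "fin (t0 + (cost (Bin Less (Reg 2) (Reg 23)) + Suc t)) s'"
              unfolding fin_def accepting_def using t0 by simp
          qed
        next
          case False
          \<comment> \<open>With an empty list there are no rounds and, since
            \<open>k \<ge> 1\<close>, no solutions.\<close>
          then have N0: "N = 0" by simp
          have e: "aval w (Bin Less (Reg 9) (Reg 10)) s3 = 0" by (simp add: s3 N0)
          have no: "\<not> ?ans k T" using N0 par(2) by (auto simp: ksum_yes_def N_def)
          show ?thesis
          proof (rule wp_loop[where I = "\<lambda>n s. n = 3 \<and> s = s3" and \<mu> = "\<lambda>_. 0"])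
            show "regs_below S (Bin Less (Reg 9) (Reg 10))" by (simp add: S_def)
            show "cost (Bin Less (Reg 9) (Reg 10)) = 3 \<and> s3 = s3" by simp
            fix n :: nat and s assume "n = 3 \<and> s = s3"
            then show "fin (t0 + (cost (Bin Less (Reg 2) (Reg 23)) + Suc (n + 1))) s"
              unfolding fin_def accepting_def using t0 no by (simp add: s3)
          qed (use e in blast)
        qed
      }
      {
        assume "aval w (Bin Less (Reg 2) (Reg 23)) s3 = 0"
        then have T: "\<not> T \<le> k * U" using tst by blast
        have "\<not> ?ans k T"
        proof
          assume "?ans k T"
          then obtain ys where ys: "length ys = k" "set ys \<subseteq> set zs" "sum_list ys = T" by (auto simp: ksum_yes_def)
          have "sum_list ys \<le> length ys * U"
            using ys(2) U(1) by (induction ys) (auto intro: add_mono)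
          then show False using ys T by simp
        qed
        then show "wp w S Skip (\<lambda>n. fin (t0 + (cost (Bin Less (Reg 2) (Reg 23)) + Suc n))) s3"
          by (intro wp_Skip) (use t0 in \<open>simp add: fin_def accepting_def s3\<close>)
      }
    qed
    note main = this[unfolded t0_def s3_def add.assoc]
    have "\<forall>u\<in>set (setup_regs k c0 c1 K qa qb). fst u < S \<and> regs_below S (snd u)"
      by (simp add: setup_regs_def S_def)
    then show "wp w S (Seq (assigns S (setup_regs k c0 c1 K qa qb)) (ifte S (Bin Less (Reg 2) (Reg 23)) ?body Skip))
       (\<lambda>n'. fin (upds_cost read_input + (t2 + n'))) s2"
      by (rule wp_Seq[OF wp_assigns]) (rule main)
  qed
  note main = this
  have "\<forall>x<S. fst (init_state xs) x = fst (init_state xs) x" by blast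
  with main obtain n R' s' where e: "exec w (ksum_program p c k c0 c1 K qa qb) (fst (init_state xs), snd (init_state xs)) n (R', snd s')"
    "\<forall>x<S. R' x = fst s' x" "fin n s'"
    by (rule wpE)
  have "accepting (R', snd s') \<longleftrightarrow> accepting s'" using e(2) by (simp add: accepting_def S_def)
  then show ?thesis using e(1,3) unfolding fin_def c1_def by auto
qed

section \<open>Choice of the sizes\<close>

lemma power2_below:
  fixes y :: real
  assumes "1 \<le> y"
  obtains j :: nat where "2 ^ j \<le> y" "y < 2 * 2 ^ j"
proof -
  define n where "n = nat \<lfloor>y\<rfloor>"
  have n: "real n \<le> y" "y < real n + 1" "0 < n" using assms unfolding n_def by linarith+
  define j where "j = floor_log n"
  have "2 ^ j \<le> n" unfolding j_def using n(3) by (intro floor_log_exp2_le) auto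
  then have 1: "real (2 ^ j) \<le> real n" using of_nat_le_iff by blast
  have "n + 1 \<le> 2 * 2 ^ j" unfolding j_def using floor_log_exp2_gt[of n] by simp
  then have 2: "real (n + 1) \<le> real (2 * 2 ^ j)" using of_nat_le_iff by blast
  have "real (2 ^ j) = 2 ^ j" "real (2 * 2 ^ j) = 2 * 2 ^ j" by simp_all
  then show thesis using that[of j] n 1 2 by linarith
qed

text \<open>The class prescribes the orders: \<open>s\<close> is the ratio of target to maximum,
  \<open>d * H\<close> is the maximum and \<open>M * d * a\<close> the sum. The free choice is
  \<open>\<phi>\<close>, about \<open>M powr (\<beta> / 2)\<close>: large against \<open>k\<close>
  and \<open>card Z\<close>, yet small enough that \<open>a\<close>, about
  \<open>M powr (\<sigma> - 1) / d\<close>, admits \<open>U\<close> of order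
  \<open>M powr (e - \<beta>)\<close>.\<close>

lemma gadget_parameters:
  fixes \<tau> \<xi> \<sigma> \<beta> e M :: real and k U em :: nat and Z :: "nat set"
  assumes par: "nontrivial_setting \<tau> \<xi> \<sigma>" and e: "e = \<xi> + \<sigma> - \<tau> - 1" "1 < e"
    and \<beta>: "0 < \<beta>" "\<beta> \<le> 1" "\<beta> \<le> (e - 1) / 2"
    and k: "1 \<le> k" and U: "1 \<le> U" "Z \<subseteq> {1..U}"
    and M: "M = 2 ^ em" "32 * real k \<le> M powr (\<beta> / 4)" "64 \<le> M powr ((e - 1) / 2)"
      "512 * real k ^ 3 * real U \<le> M powr (e - \<beta>)" "real (card Z) \<le> M powr (\<beta> / 4)"
  obtains es ef ea eE :: nat where "gadget k U (2 ^ em) (2 ^ es) (2 ^ ef) (2 ^ ea) (2 ^ eE) Z"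
    "2 ^ es \<le> M" "2 ^ ef \<le> M" "2 ^ ea \<le> M powr (\<xi> + \<sigma>)" "2 ^ eE \<le> 16 * M powr (\<xi> + \<sigma>)"
    "\<And>\<kappa> T. \<kappa> \<le> k \<Longrightarrow> T \<le> k * U \<Longrightarrow>
      (gadget.X k U (2 ^ em) (2 ^ es) (2 ^ ef) (2 ^ ea) (2 ^ eE) Z \<kappa>, gadget.target k U (2 ^ es) (2 ^ ef) (2 ^ eE) \<kappa> T)
        \<in> subset_sum_class (64 * 3 powr (\<tau> + \<xi> + \<sigma>)) \<tau> \<xi> \<sigma>"
    "\<And>\<kappa>. \<kappa> \<le> k \<Longrightarrow> card (gadget.X k U (2 ^ em) (2 ^ es) (2 ^ ef) (2 ^ ea) (2 ^ eE) Z \<kappa>) \<le> 3 * 2 ^ em"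
proof -
  have p: "2 \<le> \<sigma>" "1 \<le> \<xi>" "\<xi> \<le> \<tau>" "\<tau> \<le> \<sigma>" "\<sigma> \<le> 1 + \<xi>" using par by (auto simp: nontrivial_setting_def)
  have M1: "1 \<le> M" unfolding M(1) by simp
  then have M0: "0 < M" by linarith
  have mono: "M powr x \<le> M powr y" if "x \<le> y" for x y using that M1 by (rule powr_mono)
  have ge1: "1 \<le> M powr x" if "0 \<le> x" for x using that M1 by (intro ge_one_powr_ge_zero)
  have mul: "M powr x * M powr y = M powr (x + y)" for x y by (simp add: powr_add)
  have pos: "0 < M powr x" for x using M0 by simp
  have t1: "0 \<le> \<tau> - \<xi>" using p by linarith
  obtain es where s: "2 ^ es \<le> M powr (\<tau> - \<xi>)" "M powr (\<tau> - \<xi>) < 2 * 2 ^ es"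
    using power2_below[OF ge1[OF t1]] by blast
  obtain ef where f: "2 ^ ef \<le> M powr (\<beta> / 2)" "M powr (\<beta> / 2) < 2 * 2 ^ ef"
    using power2_below[OF ge1[of "\<beta> / 2"]] \<beta> by auto
  define s' f' where "s' = (2::real) ^ es" and "f' = (2::real) ^ ef"
  have sf: "0 < s'" "0 < f'" "1 \<le> s'" "1 \<le> f'" by (simp_all add: s'_def f'_def)
  note s = s[folded s'_def f'_def] and f = f[folded s'_def f'_def]
  define d where "d = 32 * s' * f'"
  have d0: "0 < d" using sf by (simp add: d_def)
  have d1: "1 \<le> d"
  proof -
    have "1 * 1 \<le> s' * f'" using sf by (intro mult_mono) auto
    then show ?thesis by (simp add: d_def)
  qed
  have dle: "d \<le> 32 * M powr (\<tau> - \<xi> + \<beta> / 2)"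
  proof -
    have "s' * f' \<le> M powr (\<tau> - \<xi>) * M powr (\<beta> / 2)" using s f sf by (intro mult_mono) auto
    then show ?thesis by (simp add: d_def mul)
  qed
  \<comment> \<open>Leaves a factor \<open>M powr ((e - 1) / 2)\<close> between \<open>M * d\<close>
    and \<open>M powr (\<sigma> - 1)\<close>, which swallows the constants.\<close>
  have ea1: "\<tau> - \<xi> + \<beta> / 2 + (e - 1) / 2 + 1 \<le> \<sigma> - 1"
  proof -
    have "\<tau> - \<xi> = \<sigma> - 1 - e" using e by linarith
    then show ?thesis using \<beta> by argo
  qed
  have "M * d \<le> M powr 1 * (32 * M powr (\<tau> - \<xi> + \<beta> / 2))" using dle M0 by simp
  also have "\<dots> = 32 * M powr (1 + (\<tau> - \<xi> + \<beta> / 2))" unfolding powr_add by simp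
  also have "2 * \<dots> \<le> M powr ((e - 1) / 2) * M powr (1 + (\<tau> - \<xi> + \<beta> / 2))"
    using M(3) pos[of "1 + (\<tau> - \<xi> + \<beta> / 2)"] by (simp add: mult_right_mono)
  also have "\<dots> \<le> M powr (\<sigma> - 1)" unfolding mul using ea1 by (intro mono) linarith
  finally have Md: "2 * (M * d) \<le> M powr (\<sigma> - 1)" by linarith
  then have "1 \<le> M powr (\<sigma> - 1) / d"
  proof -
    have "1 * d \<le> M * d" using M1 d0 by (intro mult_right_mono) auto
    then have "d \<le> M powr (\<sigma> - 1)" using Md d0 by linarith
    then show ?thesis using d0 by simp
  qed
  then obtain ea where a: "2 ^ ea \<le> M powr (\<sigma> - 1) / d" "M powr (\<sigma> - 1) / d < 2 * 2 ^ ea"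
    using power2_below by blast
  define a' where "a' = (2::real) ^ ea"
  have da: "d * a' \<le> M powr (\<sigma> - 1)" "M powr (\<sigma> - 1) < 2 * (d * a')"
    using a[folded a'_def] d0 by (simp_all add: field_simps)
  have ff: "f' * f' \<le> M powr \<beta>"
  proof -
    have "f' * f' \<le> M powr (\<beta> / 2) * M powr (\<beta> / 2)" using f sf by (intro mult_mono) auto
    then show ?thesis by (simp add: mul)
  qed
  have "d * f' \<le> 32 * (M powr (\<tau> - \<xi>) * M powr \<beta>)"
  proof -
    have "s' * (f' * f') \<le> M powr (\<tau> - \<xi>) * M powr \<beta>" using s ff sf by (intro mult_mono) auto
    then show ?thesis by (simp add: d_def mult.assoc)
  qed
  also have "\<dots> \<le> 64 * (M powr (\<tau> - \<xi> + \<beta>))" unfolding mul using pos[of "\<tau> - \<xi> + \<beta>"] by simp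
  also have "\<dots> \<le> M powr ((e - 1) / 2) * M powr (\<tau> - \<xi> + \<beta>)" using M(3) by (intro mult_right_mono) auto
  also have "\<dots> \<le> M powr \<xi>" unfolding mul using e \<beta> p by (intro mono) argo
  finally have dfx: "d * f' \<le> M powr \<xi>" .
  have df0: "0 < d * f'" using d0 sf by simp
  \<comment> \<open>The factor 16 ensures that after rounding down \<open>d * H\<close> still
    exceeds \<open>8 * M powr \<xi>\<close>, as \<open>8 * a \<le> H\<close> requires.\<close>
  have "1 \<le> 16 * M powr \<xi> / (d * f')" using dfx df0 by (simp add: field_simps)
  then obtain eE where E: "2 ^ eE \<le> 16 * M powr \<xi> / (d * f')" "16 * M powr \<xi> / (d * f') < 2 * 2 ^ eE"
    using power2_below by blast
  define E' where "E' = (2::real) ^ eE"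
  define H where "H = E' * f'"
  have dH: "d * H \<le> 16 * M powr \<xi>" "8 * M powr \<xi> < d * H"
    using E[folded E'_def] df0 by (simp_all add: field_simps H_def)
  have kN: "16 * real k * real (card Z) \<le> f'"
  proof -
    have "32 * real k * real (card Z) \<le> M powr (\<beta> / 4) * M powr (\<beta> / 4)" using M(2,5) by (intro mult_mono) auto
    also have "\<dots> = M powr (\<beta> / 2)" by (simp add: mul)
    finally show ?thesis using f by linarith
  qed
  have k16: "16 * real k \<le> f'"
  proof -
    have "32 * real k * 1 \<le> M powr (\<beta> / 4) * M powr (\<beta> / 4)" using M(2) ge1[of "\<beta> / 4"] \<beta> by (intro mult_mono) auto
    also have "\<dots> = M powr (\<beta> / 2)" by (simp add: mul)
    finally show ?thesis using f by linarith
  qed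
  \<comment> \<open>This condition limits \<open>U\<close>: up to constants,
    \<open>d * \<phi>\<close> is at most \<open>M powr (\<tau> - \<xi> + \<beta>)\<close>, and
    \<open>e - \<beta>\<close> is what remains of the exponent \<open>\<sigma> - 1\<close>.\<close>
  have abig: "4 * real k ^ 3 * (real U + 1) * f' \<le> a'"
  proof -
    have "d * (4 * real k ^ 3 * (real U + 1) * f') \<le> d * (4 * real k ^ 3 * (2 * real U) * f')"
      using d0 sf U(1) by (intro mult_left_mono mult_right_mono) auto
    also have "\<dots> = (512 * real k ^ 3 * real U) * (s' * (f' * f')) / 2" by (simp add: d_def)
    also have "\<dots> \<le> M powr (e - \<beta>) * (M powr (\<tau> - \<xi>) * M powr \<beta>) / 2"
      using M(4) s ff sf by (intro divide_right_mono mult_mono) auto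
    also have "\<dots> = M powr (\<sigma> - 1) / 2"
    proof -
      have "e - \<beta> + (\<tau> - \<xi> + \<beta>) = \<sigma> - 1" using e(1) by simp
      then show ?thesis by (simp only: mul)
    qed
    also have "\<dots> \<le> d * a'" using da by linarith
    finally show ?thesis using d0 by simp
  qed
  have Ma: "M \<le> a'"
  proof -
    have "d * M \<le> d * a'" using Md da by (simp add: mult.commute)
    then show ?thesis using d0 by simp
  qed
  have E1: "8 * a' \<le> H"
  proof -
    have "M powr (\<sigma> - 1) \<le> M powr \<xi>" using p by (intro mono) linarith
    then have "d * (8 * a') \<le> d * H" using da dH by simp
    then show ?thesis using d0 by simp
  qed
  have E2: "4 * s' \<le> H"
  proof -
    have "s' * s' * f' \<le> M powr (\<tau> - \<xi>) * M powr (\<tau> - \<xi>) * M powr (\<beta> / 2)" using s f sf by (intro mult_mono) auto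
    also have "\<dots> = M powr (2 * (\<tau> - \<xi>) + \<beta> / 2)" unfolding mul by (simp add: algebra_simps)
    finally have "d * (4 * s') \<le> 128 * M powr (2 * (\<tau> - \<xi>) + \<beta> / 2)" by (simp add: d_def mult_ac)
    also have "\<dots> = 2 * (64 * M powr (2 * (\<tau> - \<xi>) + \<beta> / 2))" by simp
    also have "\<dots> \<le> 2 * (M powr ((e - 1) / 2) * M powr (2 * (\<tau> - \<xi>) + \<beta> / 2))"
      using M(3) by (intro mult_left_mono mult_right_mono) auto
    also have "\<dots> \<le> 2 * M powr \<xi>" unfolding mul using e \<beta> p by (intro mult_left_mono mono) argo+
    also have "\<dots> \<le> d * H" using dH pos[of \<xi>] by linarith
    finally show ?thesis using d0 by simp
  qed
  have gad: "gadget k U (2 ^ em) (2 ^ es) (2 ^ ef) (2 ^ ea) (2 ^ eE) Z"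
  proof
    have "real (16 * k) \<le> real (2 ^ ef)" using k16 by (simp add: s'_def f'_def)
    then show "16 * k \<le> 2 ^ ef" using of_nat_le_iff by blast
    have "real (16 * k * card Z) \<le> real (2 ^ ef)" using kN by (simp add: s'_def f'_def)
    then show "16 * k * card Z \<le> 2 ^ ef" using of_nat_le_iff by blast
    have "real (4 * k ^ 3 * (U + 1) * 2 ^ ef) \<le> real (2 ^ ea)" using abig by (simp add: s'_def f'_def a'_def algebra_simps)
    then show "4 * k ^ 3 * (U + 1) * 2 ^ ef \<le> 2 ^ ea" using of_nat_le_iff by blast
    have "real (2 ^ em) \<le> real (2 ^ ea)" using Ma by (simp add: M(1) a'_def)
    then show "2 ^ em \<le> (2 ^ ea :: nat)" using of_nat_le_iff by blast
    have "real (8 * 2 ^ ea) \<le> real (2 ^ eE * 2 ^ ef)" using E1 by (simp add: a'_def H_def E'_def s'_def f'_def)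
    then show "8 * 2 ^ ea \<le> (2 ^ eE * 2 ^ ef :: nat)" using of_nat_le_iff by blast
    have "real (4 * 2 ^ es) \<le> real (2 ^ eE * 2 ^ ef)" using E2 by (simp add: H_def E'_def s'_def f'_def)
    then show "4 * 2 ^ es \<le> (2 ^ eE * 2 ^ ef :: nat)" using of_nat_le_iff by blast
  qed (use k U in auto)
  then interpret G: gadget k U "2 ^ em" "2 ^ es" "2 ^ ef" "2 ^ ea" "2 ^ eE" Z .
  have Gd: "real G.d = d" by (simp add: G.d_def d_def s'_def f'_def)
  have GH: "real G.H = H" by (simp add: G.H_def H_def E'_def s'_def f'_def)
  have sM: "s' \<le> M"
  proof -
    have "M powr (\<tau> - \<xi>) \<le> M powr 1" using p by (intro mono) linarith
    then show ?thesis using s M0 by simp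
  qed
  have fM: "f' \<le> M"
  proof -
    have "M powr (\<beta> / 2) \<le> M powr 1" using \<beta> by (intro mono) linarith
    then show ?thesis using f M0 by simp
  qed
  have card: "2 ^ em \<le> card (G.X \<kappa>)" "card (G.X \<kappa>) \<le> 3 * 2 ^ em" if "\<kappa> \<le> k" for \<kappa>
  proof -
    show "2 ^ em \<le> card (G.X \<kappa>)" by (simp add: G.card_X)
    have "real \<kappa> * real (card Z) \<le> real k * real (card Z)" using that by (intro mult_right_mono) auto
    also have "\<dots> \<le> M"
    proof -
      have "0 \<le> real k * real (card Z)" by simp
      then show ?thesis using kN fM by linarith
    qed
    finally have kz: "real \<kappa> * real (card Z) \<le> M" .
    have "real (card (G.X \<kappa>)) = M + s' + real \<kappa> * real (card Z)" "real (3 * 2 ^ em) = 3 * M"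
      by (simp_all add: G.card_X M(1) s'_def)
    then have "real (card (G.X \<kappa>)) \<le> real (3 * 2 ^ em)" using kz sM by linarith
    then show "card (G.X \<kappa>) \<le> 3 * 2 ^ em" using of_nat_le_iff by blast
  qed
  have sdH: "4 * M powr \<tau> \<le> s' * d * H" "s' * d * H \<le> 16 * M powr \<tau>"
  proof -
    have eq: "M powr (\<tau> - \<xi>) * M powr \<xi> = M powr \<tau>" unfolding mul by simp
    have "(M powr (\<tau> - \<xi>) / 2) * (8 * M powr \<xi>) \<le> s' * (d * H)" using s dH sf pos by (intro mult_mono[where c = "8 * M powr \<xi>"]) auto
    moreover have "(M powr (\<tau> - \<xi>) / 2) * (8 * M powr \<xi>) = 4 * M powr \<tau>" by (simp add: eq[symmetric])
    moreover have as: "s' * d * H = s' * (d * H)" by simp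
    ultimately show "4 * M powr \<tau> \<le> s' * d * H" by linarith
    have "s' * (d * H) \<le> M powr (\<tau> - \<xi>) * (16 * M powr \<xi>)" using s dH sf pos d0
      by (intro mult_mono[where c = "d * H"]) (auto simp: H_def E'_def)
    moreover have "M powr (\<tau> - \<xi>) * (16 * M powr \<xi>) = 16 * M powr \<tau>" by (simp add: eq[symmetric])
    ultimately show "s' * d * H \<le> 16 * M powr \<tau>" using as by linarith
  qed
  have Mda: "M powr \<sigma> / 2 \<le> M * d * a'" "M * d * a' \<le> M powr \<sigma>"
  proof -
    have eq: "M * M powr (\<sigma> - 1) = M powr \<sigma>" using M0 by (simp add: powr_mult_base)
    have "M * (M powr (\<sigma> - 1) / 2) \<le> M * (d * a')" using da M0 by (intro mult_left_mono) auto
    then show "M powr \<sigma> / 2 \<le> M * d * a'" using eq by (simp add: mult.assoc)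
    have "M * (d * a') \<le> M * M powr (\<sigma> - 1)" using da M0 by (intro mult_left_mono) auto
    then show "M * d * a' \<le> M powr \<sigma>" using eq by (simp add: mult.assoc)
  qed
  have cls: "(G.X \<kappa>, G.target \<kappa> T) \<in> subset_sum_class (64 * 3 powr (\<tau> + \<xi> + \<sigma>)) \<tau> \<xi> \<sigma>"
    if \<kappa>: "\<kappa> \<le> k" "T \<le> k * U" for \<kappa> T
  proof (rule subset_sum_classI[of _ "2 ^ em"])
    have rM: "real (2 ^ em) = M" by (simp add: M(1))
    have "real (2 ^ es * G.d * G.H) \<le> real (G.target \<kappa> T)" "real (G.target \<kappa> T) \<le> real (2 * (2 ^ es * G.d * G.H))"
      using G.target_bounds[OF \<kappa>] of_nat_le_iff less_imp_le by blast+
    then have "s' * d * H \<le> real (G.target \<kappa> T)" "real (G.target \<kappa> T) \<le> 2 * (s' * d * H)"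
      by (simp_all add: Gd GH s'_def f'_def)
    then show "real (2 ^ em) powr \<tau> / 64 \<le> real (G.target \<kappa> T)" "real (G.target \<kappa> T) \<le> 64 * real (2 ^ em) powr \<tau>"
      unfolding rM using sdH pos[of \<tau>] by linarith+
    have "real (G.d * G.H) \<le> real (Max (G.X \<kappa>))" "real (Max (G.X \<kappa>)) \<le> real (2 * (G.d * G.H))"
      using G.Max_bounds[OF \<kappa>(1)] of_nat_le_iff by blast+
    then have "d * H \<le> real (Max (G.X \<kappa>))" "real (Max (G.X \<kappa>)) \<le> 2 * (d * H)" by (simp_all add: Gd GH)
    then show "real (2 ^ em) powr \<xi> / 64 \<le> real (Max (G.X \<kappa>))" "real (Max (G.X \<kappa>)) \<le> 64 * real (2 ^ em) powr \<xi>"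
      unfolding rM using dH pos[of \<xi>] by linarith+
    have "real (2 ^ em * G.d * 2 ^ ea) \<le> real (\<Sum>(G.X \<kappa>))"
      "real (\<Sum>(G.X \<kappa>)) \<le> real (2 * (2 ^ em * G.d * 2 ^ ea) + 3 * (2 ^ es * G.d * G.H))"
      using G.sum_bounds[OF \<kappa>(1)] of_nat_le_iff by blast+
    then have S: "M * d * a' \<le> real (\<Sum>(G.X \<kappa>))" "real (\<Sum>(G.X \<kappa>)) \<le> 2 * (M * d * a') + 3 * (s' * d * H)"
      by (simp_all del: of_nat_sum add: Gd GH M(1) a'_def s'_def f'_def)
    then show "real (2 ^ em) powr \<sigma> / 64 \<le> real (\<Sum>(G.X \<kappa>))"
      unfolding rM using Mda pos[of \<sigma>] by linarith
    have "M powr \<tau> \<le> M powr \<sigma>" using p by (intro mono) linarith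
    then show "real (\<Sum>(G.X \<kappa>)) \<le> 64 * real (2 ^ em) powr \<sigma>"
      unfolding rM using S(2) Mda sdH pos[of \<sigma>] by linarith
    show "2 ^ em \<le> card (G.X \<kappa>)" "card (G.X \<kappa>) \<le> 3 * 2 ^ em" by (rule card[OF \<kappa>(1)])+
  qed (use p G.X_pos in auto)
  have a_le: "a' \<le> M powr (\<xi> + \<sigma>)"
  proof -
    have "1 \<le> d" by (rule d1)
    then have "1 * a' \<le> d * a'" by (intro mult_right_mono) (auto simp: a'_def)
    also have "\<dots> \<le> M powr (\<xi> + \<sigma>)" using da mono[of "\<sigma> - 1" "\<xi> + \<sigma>"] p by linarith
    finally show ?thesis by simp
  qed
  have E_le: "E' \<le> 16 * M powr (\<xi> + \<sigma>)"
  proof -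
    have "1 * 1 \<le> d * f'" using d1 sf by (intro mult_mono) auto
    then have "1 \<le> d * f'" by simp
    then have "1 * E' \<le> (d * f') * E'" by (intro mult_right_mono) (auto simp: E'_def)
    also have "\<dots> = d * H" by (simp add: H_def)
    also have "\<dots> \<le> 16 * M powr (\<xi> + \<sigma>)" using dH mono[of \<xi> "\<xi> + \<sigma>"] p by linarith
    finally show ?thesis by simp
  qed
  show thesis
    by (rule that[OF gad]) (use sM fM a_le E_le cls card in \<open>simp_all add: s'_def f'_def a'_def E'_def\<close>)
qed


text \<open>Three factors \<open>u powr \<delta>\<close> are spent: one for \<open>Q ^ 5\<close>,
  which is polylogarithmic in \<open>U\<close>, one for the \<open>k * N\<close> rounds of a guess,
  and one to absorb \<open>k * N\<close> in the cost of a round.\<close>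

lemma running_time_bound:
  fixes L U N k c0 A K F :: nat and q \<delta> \<theta> cL :: real
  assumes L: "2 ^ (L - 1) \<le> U" "1 \<le> L" and U: "1 \<le> U" and N: "real N \<le> real U powr \<delta>" and F: "real F \<le> 2 * real K * real U powr q"
    and d: "0 < \<delta>" "0 \<le> q" "q + 3 * \<delta> \<le> \<theta>"
    and cL: "cL = 1 + 1 / (\<delta> / 5 * ln 2)"
  shows "real (200 + 12 * L + (c0 * L) ^ 5 * (k * N) * (A * (3 * F + k * N + 1) + 4)) \<le>
    (200 + 12 * cL + (real c0 * cL) ^ 5 * (real k * (real A * (6 * real K + real k + 1) + 4))) * real U powr \<theta>"
proof -
  define u where "u = real U"
  have u: "1 \<le> u" using U by (simp add: u_def)
  have mono: "u powr x \<le> u powr y" if "x \<le> y" for x y using that u by (rule powr_mono)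
  have ge1: "1 \<le> u powr x" if "0 \<le> x" for x using that u by (intro ge_one_powr_ge_zero)
  have cL1: "1 \<le> cL" unfolding cL using d by simp
  have "real (2 ^ (L - 1)) \<le> u" using L(1) of_nat_le_iff unfolding u_def by blast
  then have "2 ^ (L - 1) \<le> u" by simp
  then have "ln (2 ^ (L - 1)) \<le> ln u" using u by (subst ln_le_cancel_iff) auto
  then have "real (L - 1) * ln 2 \<le> ln u" by (simp add: ln_realpow)
  \<comment> \<open>The exponent \<open>\<delta> / 5\<close> is made for the fifth power of the bit
    length.\<close>
  also have "ln u \<le> u powr (\<delta> / 5) / (\<delta> / 5)" using u d by (intro ln_powr_bound) auto
  finally have st: "real (L - 1) * ln 2 \<le> u powr (\<delta> / 5) / (\<delta> / 5)" .
  have ln2: "0 < ln (2::real)" by simp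
  have "real (L - 1) \<le> u powr (\<delta> / 5) / (\<delta> / 5) / ln 2" using st pos_le_divide_eq[OF ln2] by blast
  also have "\<dots> = 1 / (\<delta> / 5 * ln 2) * u powr (\<delta> / 5)" by simp
  finally have "real L \<le> 1 * u powr (\<delta> / 5) + 1 / (\<delta> / 5 * ln 2) * u powr (\<delta> / 5)"
    using ge1[of "\<delta> / 5"] d L(2) by simp
  then have Lb: "real L \<le> cL * u powr (\<delta> / 5)" unfolding cL by (simp only: distrib_right)
  have "(real c0 * real L) ^ 5 \<le> (real c0 * (cL * u powr (\<delta> / 5))) ^ 5"
    using Lb by (intro power_mono mult_left_mono) auto
  also have "\<dots> = (real c0 * cL) ^ 5 * (u powr (\<delta> / 5)) ^ 5" by (simp add: power_mult_distrib)
  also have "(u powr (\<delta> / 5)) ^ 5 = u powr \<delta>" using u by (simp add: powr_power)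
  finally have Q: "(real c0 * real L) ^ 5 \<le> (real c0 * cL) ^ 5 * u powr \<delta>" .
  have "real k * real N \<le> real k * u powr \<delta>" using N unfolding u_def by (intro mult_left_mono) auto
  note kN = this
  have up: "u powr q \<le> u powr (q + \<delta>)" "u powr \<delta> \<le> u powr (q + \<delta>)" "1 \<le> u powr (q + \<delta>)"
    using d by (auto intro: mono ge1)
  have "3 * real F + real k * real N + 1 \<le> 6 * real K * u powr q + real k * u powr \<delta> + 1"
    using F kN unfolding u_def by simp
  also have "\<dots> \<le> 6 * real K * u powr (q + \<delta>) + real k * u powr (q + \<delta>) + u powr (q + \<delta>)"
    using up by (intro add_mono mult_left_mono) auto
  finally have "3 * real F + real k * real N + 1 \<le> (6 * real K + real k + 1) * u powr (q + \<delta>)" by (simp add: algebra_simps)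
  then have "real A * (3 * real F + real k * real N + 1) \<le> real A * ((6 * real K + real k + 1) * u powr (q + \<delta>))"
    by (rule mult_left_mono) simp
  then have "real A * (3 * real F + real k * real N + 1) + 4 \<le>
      real A * ((6 * real K + real k + 1) * u powr (q + \<delta>)) + 4 * u powr (q + \<delta>)"
    using up(3) by linarith
  also have "\<dots> = (real A * (6 * real K + real k + 1) + 4) * u powr (q + \<delta>)" by (simp add: algebra_simps)
  finally have R: "real A * (3 * real F + real k * real N + 1) + 4 \<le> (real A * (6 * real K + real k + 1) + 4) * u powr (q + \<delta>)" .
  have "(real c0 * real L) ^ 5 * (real k * real N) * (real A * (3 * real F + real k * real N + 1) + 4)
    \<le> ((real c0 * cL) ^ 5 * u powr \<delta>) * (real k * u powr \<delta>) * ((real A * (6 * real K + real k + 1) + 4) * u powr (q + \<delta>))"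
    by (rule mult_mono[OF mult_mono[OF Q kN] R]) (use cL1 in auto)
  also have "\<dots> = (real c0 * cL) ^ 5 * (real k * (real A * (6 * real K + real k + 1) + 4)) * (u powr \<delta> * u powr \<delta> * u powr (q + \<delta>))"
    by (simp only: mult_ac)
  also have "u powr \<delta> * u powr \<delta> * u powr (q + \<delta>) = u powr (q + 3 * \<delta>)"
    by (simp add: powr_add[symmetric] add.commute)
  also have "(real c0 * cL) ^ 5 * (real k * (real A * (6 * real K + real k + 1) + 4)) * u powr (q + 3 * \<delta>)
     \<le> (real c0 * cL) ^ 5 * (real k * (real A * (6 * real K + real k + 1) + 4)) * u powr \<theta>"
    using d(3) cL1 by (intro mult_left_mono mono) auto
  finally have 1: "(real c0 * real L) ^ 5 * (real k * real N) * (real A * (3 * real F + real k * real N + 1) + 4)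
    \<le> (real c0 * cL) ^ 5 * (real k * (real A * (6 * real K + real k + 1) + 4)) * u powr \<theta>" .
  have "u powr (\<delta> / 5) \<le> u powr \<theta>" using d by (intro mono) linarith
  then have "cL * u powr (\<delta> / 5) \<le> cL * u powr \<theta>" using cL1 by (intro mult_left_mono) auto
  then have 2: "12 * real L \<le> 12 * cL * u powr \<theta>" using Lb by linarith
  have 3: "200 \<le> 200 * u powr \<theta>" using ge1[of \<theta>] d by simp
  have "real (200 + 12 * L + (c0 * L) ^ 5 * (k * N) * (A * (3 * F + k * N + 1) + 4)) =
    200 + 12 * real L + (real c0 * real L) ^ 5 * (real k * real N) * (real A * (3 * real F + real k * real N + 1) + 4)"
    by (simp only: of_nat_add of_nat_mult of_nat_power of_nat_numeral of_nat_1)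
  also have "\<dots> \<le> 200 * u powr \<theta> + 12 * cL * u powr \<theta> + (real c0 * cL) ^ 5 * (real k * (real A * (6 * real K + real k + 1) + 4)) * u powr \<theta>"
    using 1 2 3 by linarith
  also have "\<dots> = (200 + 12 * cL + (real c0 * cL) ^ 5 * (real k * (real A * (6 * real K + real k + 1) + 4))) * u powr \<theta>"
    by (simp only: distrib_right)
  finally show ?thesis unfolding u_def .
qed

section \<open>The lower bound\<close>

text \<open>Rounds the exponent of the step limit up to a fraction that the program can evaluate,
  while keeping it below 1.\<close>

lemma rational_between:
  fixes x :: real
  assumes "0 < x" "x < 1"
  obtains qa qb :: nat where "1 \<le> qb" "qa < qb" "x \<le> real qa / real qb"
proof -
  obtain qb :: nat where qb: "1 / (1 - x) + 1 < real qb" using reals_Archimedean2 by blast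
  have "0 < 1 / (1 - x)" using assms by simp
  then have qb1: "1 \<le> qb" "0 < real qb" using qb by linarith+
  define qa where "qa = nat \<lceil>x * real qb\<rceil>"
  have "0 < x * real qb" using assms qb1 by simp
  then have qa: "x * real qb \<le> real qa" "real qa < x * real qb + 1" unfolding qa_def by linarith+
  have "1 < (1 - x) * real qb" using qb assms by (simp add: field_simps)
  then have "real qa < real qb" using qa by (simp add: algebra_simps)
  moreover have "x \<le> real qa / real qb" using qa(1) qb1 by (simp add: pos_le_divide_eq)
  ultimately show thesis using that qb1(1) by simp
qed

text \<open>Up to constants, instances have \<open>U powr (1 / \<zeta>)\<close> elements with
  \<open>\<zeta> = e - \<beta>\<close>, so time \<open>n powr \<gamma>\<close> becomes
  \<open>U powr x\<close> with \<open>x = \<gamma> / \<zeta> < 1\<close>. The gap between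
  \<open>x\<close> and 1 pays for the rational exponent, the number of guesses and the length of the
  list.\<close>

lemma no_fast_algorithm:
  fixes \<tau> \<xi> \<sigma> \<epsilon> :: real
  assumes IH: "intermediate_hypothesis" and par: "nontrivial_setting \<tau> \<xi> \<sigma>"
    and e1: "1 < \<xi> + \<sigma> - \<tau> - 1" and \<epsilon>: "0 < \<epsilon>"
  shows "\<not> solvable_in_time (subset_sum_class (64 * 3 powr (\<tau> + \<xi> + \<sigma>)) \<tau> \<xi> \<sigma>) subset_sum_encodings
    subset_sum_yes (\<lambda>(X, t). real (card X) powr ((\<xi> + \<sigma> - \<tau> - 1) * (1 - \<epsilon>)))"
proof
  let ?class = "subset_sum_class (64 * 3 powr (\<tau> + \<xi> + \<sigma>)) \<tau> \<xi> \<sigma>"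
  define e where "e = \<xi> + \<sigma> - \<tau> - 1"
  assume "solvable_in_time ?class subset_sum_encodings
    subset_sum_yes (\<lambda>(X, t). real (card X) powr ((\<xi> + \<sigma> - \<tau> - 1) * (1 - \<epsilon>)))"
  then obtain p c C where c: "0 < c" and C: "0 < C" and sol: "\<forall>i\<in>?class. \<forall>xs\<in>subset_sum_encodings i. \<exists>n s.
      exec (word_length c xs) p (init_state xs) n s \<and>
      real n \<le> C * (case i of (X, t) \<Rightarrow> real (card X) powr ((\<xi> + \<sigma> - \<tau> - 1) * (1 - \<epsilon>))) \<and>
      (accepting s \<longleftrightarrow> subset_sum_yes i)"
    unfolding solvable_in_time_def by (elim exE conjE)
  have solves: "\<exists>n s. exec (word_length c xs) p (init_state xs) n s \<and>
        real n \<le> C * real (card X) powr (e * (1 - \<epsilon>)) \<and> (accepting s \<longleftrightarrow> subset_sum_yes (X, t))"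
    if "(X, t) \<in> ?class" "xs \<in> subset_sum_encodings (X, t)" for X t xs
    using bspec[OF bspec[OF sol that(1)] that(2)] by (simp only: case_prod_conv e_def)
  have e: "1 < e" using e1 by (simp add: e_def)
  \<comment> \<open>At least 1, since the step limit also has to exceed the sizes m and s of the
    instance to be written.\<close>
  define \<gamma> where "\<gamma> = max 1 (e * (1 - \<epsilon>))"
  have "0 < e * \<epsilon>" using e \<epsilon> by simp
  then have \<gamma>: "1 \<le> \<gamma>" "\<gamma> < e" "e * (1 - \<epsilon>) \<le> \<gamma>" using e by (auto simp: \<gamma>_def algebra_simps)
  \<comment> \<open>At most half the gap between \<open>\<gamma>\<close> and \<open>e\<close> keeps
    \<open>\<zeta>\<close> above \<open>\<gamma>\<close>; because of \<open>1 \<le> \<gamma>\<close>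
    it is also at most \<open>(e - 1) / 2\<close>, as \<open>gadget_parameters\<close>
    requires.\<close>
  define \<beta> where "\<beta> = min 1 ((e - \<gamma>) / 2)"
  have \<beta>: "0 < \<beta>" "\<beta> \<le> 1" "\<beta> \<le> (e - \<gamma>) / 2" 
    unfolding \<beta>_def min_def using \<gamma> by auto
  define \<zeta> where "\<zeta> = e - \<beta>"
  have \<zeta>: "\<gamma> < \<zeta>" "1 < \<zeta>" "\<zeta> \<le> e" using \<beta> \<gamma> by (simp_all add: \<zeta>_def)
  define x where "x = \<gamma> / \<zeta>"
  have x: "0 < x" "x < 1" using \<gamma> \<zeta> by (auto simp: x_def)
  obtain qa qb :: nat where q: "1 \<le> qb" "qa < qb" "x \<le> real qa / real qb" by (rule rational_between[OF x])
  define q where "q = real qa / real qb"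
  have q01: "0 < q" "q < 1" "x \<le> q" using q x by (auto simp: q_def)
  \<comment> \<open>Then \<open>q + 3 * \<delta>\<close> stays below \<open>1 - (1 - q) / 2\<close>,
    the exponent for which k-Sum is assumed hard.\<close>
  define \<delta> where "\<delta> = (1 - q) / 8"
  \<comment> \<open>\<open>U \<le> M powr \<zeta>\<close> with \<open>\<zeta> \<le> e\<close> turns
    \<open>N \<le> U powr \<alpha>\<close> into \<open>N \<le> M powr (\<beta> / 4)\<close>; the
    bound by \<open>\<delta>\<close> serves the running time.\<close>
  define \<alpha> where "\<alpha> = min (\<beta> / (4 * e)) \<delta>"
  have \<delta>: "0 < \<delta>" using q01 by (simp add: \<delta>_def)
  have \<alpha>: "0 < \<alpha>" "\<alpha> \<le> \<beta> / (4 * e)" "\<alpha> \<le> \<delta>" 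
    unfolding \<alpha>_def min_def using \<delta> \<beta> e by auto
  have eps: "0 < (1 - q) / 2" using q01 by simp
  obtain k where k: "3 \<le> k" and hard: "\<not> solvable_in_time (ksum_instances \<alpha>) ksum_encodings (ksum_yes k)
      (\<lambda>(Z, T, U). real U powr (1 - (1 - q) / 2))"
    using IH \<alpha>(1) eps unfolding intermediate_hypothesis_def by blast
  have k1: "1 \<le> k" "1 \<le> real k" using k by auto
  define A where "A = 512 * real k ^ 3"
  have "1 ^ 3 \<le> real k ^ 3" using k1 by (intro power_mono) auto
  then have A: "1 \<le> A" by (simp add: A_def)
  \<comment> \<open>A lower bound on \<open>M\<close> under which its powers exceed the constants
    even for small \<open>U\<close>.\<close>
  define m0 where "m0 = max 1 (max ((32 * real k) powr (4 / \<beta>)) (64 powr (2 / (e - 1))))"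
  have m0: "1 \<le> m0" "(32 * real k) powr (4 / \<beta>) \<le> m0" "64 powr (2 / (e - 1)) \<le> m0" by (auto simp: m0_def)
  \<comment> \<open>The constant in \<open>M \<le> B * u powr (1 / \<zeta>)\<close>; the 2 is for
    rounding to a power of two.\<close>
  define B where "B = 2 * m0 * A powr (1 / \<zeta>)"
  have Ap: "1 \<le> A powr (1 / \<zeta>)" using A \<zeta> by (intro ge_one_powr_ge_zero) auto
  have "1 * 1 \<le> m0 * A powr (1 / \<zeta>)" using m0 Ap by (intro mult_mono) auto
  then have B: "1 \<le> B" by (simp add: B_def)
  \<comment> \<open>\<open>C + 1\<close> leaves room for the running time
    \<open>C * n powr \<gamma>\<close> as well as for the sizes m and s, \<open>3 * B\<close> comes
    from \<open>n \<le> 3 * M\<close>, and 2 compensates for rounding down the exponent of the step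
    limit.\<close>
  define K where "K = nat \<lceil>2 * (C + 1) * (3 * B) powr \<gamma>\<rceil>"
  have K: "2 * (C + 1) * (3 * B) powr \<gamma> \<le> real K" unfolding K_def by linarith
  define b where "b = nat \<lceil>B\<rceil>"
  define D where "D = nat \<lceil>\<xi> + \<sigma>\<rceil>"
  have D: "\<xi> + \<sigma> \<le> real D" unfolding D_def by linarith
  have pn: "1 \<le> \<xi>" "2 \<le> \<sigma>" using par by (auto simp: nontrivial_setting_def)
  have "B \<le> real b" using B unfolding b_def by linarith
  also have "real b \<le> 2 ^ b" using less_exp[of b] by (metis less_imp_le of_nat_le_iff of_nat_numeral of_nat_power)
  finally have Bb: "B \<le> 2 ^ b" .
  \<comment> \<open>Every size is at most \<open>16 * M powr (\<xi> + \<sigma>)\<close>, so all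
    exponents are at most \<open>4 + (b + L) * D\<close>, which is below
    \<open>c0 * L\<close>.\<close>
  define c0 where "c0 = 5 + (b + 1) * D"
  define cL where "cL = 1 + 1 / (\<delta> / 5 * ln 2)"
  define AA where "AA = 500 + 2 * nregs p + sim_cost p"
  define Ct where "Ct = 200 + 12 * cL + (real c0 * cL) ^ 5 * (real k * (real AA * (6 * real K + real k + 1) + 4))"
  have cL: "0 < cL" using \<delta> by (simp add: cL_def add_pos_pos)
  have Ct: "0 < Ct" unfolding Ct_def using cL by (intro add_pos_nonneg) auto
  let ?prog = "ksum_program p c k c0 (region_exp c k c0 K) K qa qb"
  have main: "\<exists>n s. exec (word_length (word_factor c k c0 K qa qb) xs) ?prog (init_state xs) n s \<and>
      real n \<le> Ct * real U powr (1 - (1 - q) / 2) \<and> (accepting s \<longleftrightarrow> ksum_yes k (Z, T, U))"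
    if inst: "(Z, T, U) \<in> ksum_instances \<alpha>" and enc: "xs \<in> ksum_encodings (Z, T, U)" for Z T U xs
  proof -
    have U: "1 \<le> U" "Z \<subseteq> {1..U}" "real (card Z) \<le> real U powr \<alpha>" using inst by (auto simp: ksum_instances_def)
    obtain zs where zs: "xs = [U, T, card Z] @ zs" "distinct zs" "set zs = Z" using enc by (auto simp: ksum_encodings_def)
    have N: "card Z = length zs" using distinct_card[OF zs(2)] zs(3) by simp
    define L where "L = floor_log U + 1"
    have L: "2 ^ (L - 1) \<le> U" "U < 2 ^ L" "1 \<le> L"
      using floor_log_exp2_le[of U] floor_log_exp2_gt[of U] U(1) by (auto simp: L_def)
    define u where "u = real U"
    have u: "1 \<le> u" using U(1) by (simp add: u_def)
    have "real U < real (2 ^ L)" using L(2) of_nat_less_iff by blast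
    then have uL: "u < 2 ^ L" by (simp add: u_def)
    define F where "F = K * 2 ^ (qa * L div qb)"
    \<comment> \<open>Rounding down \<open>q * L\<close> and replacing \<open>U\<close> by
      \<open>2 ^ L\<close> each cost at most a factor 2, in opposite directions.\<close>
    have pq: "u powr q \<le> 2 * 2 ^ (qa * L div qb)" "2 ^ (qa * L div qb) \<le> 2 * u powr q"
    proof -
      have qb0: "0 < real qb" using q(1) by simp
      have qL: "q * real L = real (qa * L) / real qb" by (simp add: q_def)
      have "qa * L < (qa * L div qb + 1) * qb" using q(1) dividend_less_div_times[of qb "qa * L"] by (simp add: algebra_simps)
      then have "real (qa * L) \<le> real ((qa * L div qb + 1) * qb)" using of_nat_le_iff less_imp_le by blast
      then have "real (qa * L) \<le> real (qa * L div qb + 1) * real qb" by (simp only: of_nat_mult)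
      then have 1: "q * real L \<le> real (qa * L div qb + 1)" unfolding qL using pos_divide_le_eq[OF qb0] by blast
      have "u powr q \<le> (2 ^ L) powr q" using uL u q01 by (intro powr_mono2) auto
      also have "\<dots> = 2 powr (q * real L)" by (simp add: powr_powr powr_realpow[symmetric] mult.commute)
      also have "\<dots> \<le> 2 powr real (qa * L div qb + 1)" using 1 by (intro powr_mono) auto
      also have "\<dots> = 2 ^ (qa * L div qb + 1)" by (rule powr_realpow) simp
      finally show "u powr q \<le> 2 * 2 ^ (qa * L div qb)" by simp
      have "(qa * L div qb) * qb \<le> qa * L" by (rule div_times_less_eq_dividend)
      then have "real ((qa * L div qb) * qb) \<le> real (qa * L)" using of_nat_le_iff by blast
      then have "real (qa * L div qb) * real qb \<le> real (qa * L)" by (simp only: of_nat_mult)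
      then have 2: "real (qa * L div qb) \<le> q * real L" unfolding qL using pos_le_divide_eq[OF qb0] by blast
      have "real (2 ^ (L - 1)) \<le> real U" using L(1) of_nat_le_iff by blast
      then have "2 * 2 ^ (L - 1) \<le> 2 * u" by (simp add: u_def)
      moreover have "2 * 2 ^ (L - 1) = (2::real) ^ L" using L(3) by (simp add: power_eq_if)
      ultimately have Lu: "2 ^ L \<le> 2 * u" by simp
      have "(2::real) ^ (qa * L div qb) = 2 powr real (qa * L div qb)" by (rule powr_realpow[symmetric]) simp
      also have "\<dots> \<le> 2 powr (q * real L)" using 2 by (intro powr_mono) auto
      also have "\<dots> = (2 ^ L) powr q" by (simp add: powr_powr powr_realpow[symmetric] mult.commute)
      also have "\<dots> \<le> (2 * u) powr q" using Lu q01 by (intro powr_mono2) auto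
      also have "\<dots> = 2 powr q * u powr q" using u by (simp add: powr_mult)
      also have "\<dots> \<le> 2 powr 1 * u powr q" using q01 by (intro mult_right_mono powr_mono) auto
      finally show "2 ^ (qa * L div qb) \<le> 2 * u powr q" by simp
    qed
    have Fr: "real F = real K * 2 ^ (qa * L div qb)" by (simp add: F_def)
    have "real K * 2 ^ (qa * L div qb) \<le> real K * (2 * u powr q)" using pq(2) by (rule mult_left_mono) simp
    then have Fup: "real F \<le> 2 * real K * real U powr q" unfolding Fr u_def by simp
    have up: "u powr x \<le> u powr q" using q01 u by (intro powr_mono) auto
    have Flow: "(C + 1) * ((3 * B) powr \<gamma> * u powr x) \<le> real F"
    proof -
      have "2 * ((C + 1) * ((3 * B) powr \<gamma> * u powr x)) = 2 * (C + 1) * (3 * B) powr \<gamma> * u powr x" by simp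
      also have "\<dots> \<le> real K * u powr q" using K up C by (intro mult_mono) auto
      also have "\<dots> \<le> real K * (2 * 2 ^ (qa * L div qb))" using pq(1) by (rule mult_left_mono) simp
      also have "\<dots> = 2 * real F" by (simp add: Fr)
      finally show ?thesis by linarith
    qed
    have good: "\<exists>g<(c0 * L) ^ 5. good_guess p c k (c0 * L) F T (k * U + 1) zs (\<lambda>\<kappa> T'. ksum_yes \<kappa> (set zs, T', U)) g"
      if T: "T \<le> k * U"
    proof -
      \<comment> \<open>Apart from the lower bound \<open>m0\<close>, the least size with
        \<open>512 * k ^ 3 * U \<le> M powr \<zeta>\<close>. This must not be undercut, hence the
        next higher power of two with exponent \<open>j + 1\<close>.\<close>
      define y where "y = max m0 ((A * u) powr (1 / \<zeta>))"
      have y1: "1 \<le> y" using m0 by (simp add: y_def)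
      obtain j where j: "2 ^ j \<le> y" "y < 2 * 2 ^ j" by (rule power2_below[OF y1])
      define em where "em = j + 1"
      define M where "M = (2::real) ^ em"
      have My: "y \<le> M" "M \<le> 2 * y" using j by (auto simp: M_def em_def)
      have M1: "1 \<le> M" using My y1 by linarith
      have Au: "1 \<le> A * u" using mult_mono[OF A u] A by simp
      have MA: "A * u \<le> M powr \<zeta>"
      proof -
        have "A * u = ((A * u) powr (1 / \<zeta>)) powr \<zeta>" using Au \<zeta> by (simp add: powr_powr)
        also have "\<dots> \<le> M powr \<zeta>" using My \<zeta> by (intro powr_mono2) (auto simp: y_def)
        finally show ?thesis .
      qed
      have uM: "u \<le> M powr \<zeta>"
      proof -
        have "1 * u \<le> A * u" using A u by (intro mult_right_mono) auto
        then show ?thesis using MA by simp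
      qed
      have ck: "real (card Z) \<le> M powr (\<beta> / 4)"
      proof -
        have "u powr \<alpha> \<le> (M powr \<zeta>) powr \<alpha>" using uM u \<alpha> by (intro powr_mono2) auto
        also have "\<dots> = M powr (\<zeta> * \<alpha>)" by (simp add: powr_powr)
        also have "\<dots> \<le> M powr (\<beta> / 4)"
        proof (rule powr_mono)
          have "\<zeta> * \<alpha> \<le> e * (\<beta> / (4 * e))" using \<zeta> \<alpha> e by (intro mult_mono) auto
          then show "\<zeta> * \<alpha> \<le> \<beta> / 4" using e by simp
        qed (rule M1)
        finally show ?thesis using U(3) by (simp add: u_def)
      qed
      have mm: "m0 \<le> M" using My by (simp add: y_def)
      have M32: "32 * real k \<le> M powr (\<beta> / 4)"
      proof -
        have "32 * real k = ((32 * real k) powr (4 / \<beta>)) powr (\<beta> / 4)" using k1 \<beta> by (simp add: powr_powr)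
        also have "\<dots> \<le> M powr (\<beta> / 4)" using m0(2) mm \<beta> by (intro powr_mono2) auto
        finally show ?thesis .
      qed
      have M64: "64 \<le> M powr ((e - 1) / 2)"
      proof -
        have "2 / (e - 1) * ((e - 1) / 2) = 1" using e by simp
        then have "(64::real) = (64 powr (2 / (e - 1))) powr ((e - 1) / 2)" by (simp only: powr_powr powr_one)
        also have "\<dots> \<le> M powr ((e - 1) / 2)" using m0(3) mm e by (intro powr_mono2) auto
        finally show ?thesis .
      qed
      have "(e - \<gamma>) / 2 \<le> (e - 1) / 2" using \<gamma>(1) by (intro divide_right_mono) auto
      with \<beta>(3) have \<beta>': "\<beta> \<le> (e - 1) / 2" by (rule order_trans)
      obtain es ef ea eE where gp: "gadget k U (2 ^ em) (2 ^ es) (2 ^ ef) (2 ^ ea) (2 ^ eE) Z"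
        "2 ^ es \<le> M" "2 ^ ef \<le> M" "2 ^ ea \<le> M powr (\<xi> + \<sigma>)" "2 ^ eE \<le> 16 * M powr (\<xi> + \<sigma>)"
        "\<And>\<kappa> T. \<kappa> \<le> k \<Longrightarrow> T \<le> k * U \<Longrightarrow>
        (gadget.X k U (2 ^ em) (2 ^ es) (2 ^ ef) (2 ^ ea) (2 ^ eE) Z \<kappa>, gadget.target k U (2 ^ es) (2 ^ ef) (2 ^ eE) \<kappa> T) \<in> ?class"
        "\<And>\<kappa>. \<kappa> \<le> k \<Longrightarrow> card (gadget.X k U (2 ^ em) (2 ^ es) (2 ^ ef) (2 ^ ea) (2 ^ eE) Z \<kappa>) \<le> 3 * 2 ^ em"
        using gadget_parameters[OF par e_def e \<beta>(1,2) \<beta>' k1(1) U(1,2) M_def M32 M64 _ ck] MA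
        unfolding A_def u_def \<zeta>_def by blast
      have MB: "M \<le> B * u powr (1 / \<zeta>)"
      proof -
        have g1: "1 \<le> (A * u) powr (1 / \<zeta>)" using Au \<zeta> by (intro ge_one_powr_ge_zero) auto
        have "m0 * 1 \<le> m0 * (A * u) powr (1 / \<zeta>)" using g1 m0 by (intro mult_left_mono) auto
        moreover have "1 * (A * u) powr (1 / \<zeta>) \<le> m0 * (A * u) powr (1 / \<zeta>)" using m0 by (intro mult_right_mono) auto
        ultimately have "y \<le> m0 * (A * u) powr (1 / \<zeta>)" by (simp add: y_def)
        also have "(A * u) powr (1 / \<zeta>) = A powr (1 / \<zeta>) * u powr (1 / \<zeta>)" using A u by (simp add: powr_mult)
        finally show ?thesis using My(2) by (simp add: B_def mult_ac)
      qed
      have M3: "(3 * M) powr \<gamma> \<le> (3 * B) powr \<gamma> * u powr x"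
      proof -
        have "(3 * M) powr \<gamma> \<le> (3 * B * u powr (1 / \<zeta>)) powr \<gamma>" using MB M1 \<gamma> by (intro powr_mono2) auto
        also have "\<dots> = (3 * B) powr \<gamma> * (u powr (1 / \<zeta>)) powr \<gamma>" using B by (simp add: powr_mult)
        also have "(u powr (1 / \<zeta>)) powr \<gamma> = u powr x" by (simp add: powr_powr x_def)
        finally show ?thesis .
      qed
      have "(C + 1) * (3 * M) powr \<gamma> \<le> (C + 1) * ((3 * B) powr \<gamma> * u powr x)" using M3 C by (intro mult_left_mono) auto
      then have FM: "(C + 1) * (3 * M) powr \<gamma> \<le> real F" using Flow by linarith
      have M3M: "3 * M \<le> (3 * M) powr \<gamma>" using powr_mono[of 1 \<gamma> "3 * M"] \<gamma> M1 by simp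
      have MF: "M < real F"
      proof -
        have "0 \<le> C * (3 * M) powr \<gamma>" using C by simp
        then have "(3 * M) powr \<gamma> \<le> (C + 1) * (3 * M) powr \<gamma>" by (simp add: distrib_right)
        then show ?thesis using FM M3M M1 by linarith
      qed
      have CF: "C * (3 * M) powr \<gamma> \<le> real F"
      proof -
        have "C * (3 * M) powr \<gamma> \<le> (C + 1) * (3 * M) powr \<gamma>" by (intro mult_right_mono) auto
        then show ?thesis using FM by linarith
      qed
      have exps: "i < c0 * L" if i: "2 ^ i \<le> 16 * M powr (\<xi> + \<sigma>)" for i :: nat
      proof -
        have "u powr (1 / \<zeta>) \<le> u powr 1" using u \<zeta> by (intro powr_mono) auto
        then have "u powr (1 / \<zeta>) \<le> 2 ^ L" using u uL by simp
        then have "B * u powr (1 / \<zeta>) \<le> 2 ^ b * 2 ^ L" using Bb by (intro mult_mono) auto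
        then have MbL: "M \<le> 2 ^ (b + L)" using MB by (simp add: power_add)
        have "M powr (\<xi> + \<sigma>) \<le> M powr real D" using D M1 by (intro powr_mono) auto
        also have "\<dots> = M ^ D" using M1 by (intro powr_realpow) linarith
        also have "\<dots> \<le> (2 ^ (b + L)) ^ D" using MbL M1 by (intro power_mono) auto
        finally have "(2::real) ^ i \<le> 16 * (2 ^ (b + L)) ^ D" using i by linarith
        also have "\<dots> = 2 ^ (4 + (b + L) * D)" by (simp add: power_add power_mult)
        finally have "i \<le> 4 + (b + L) * D" by simp
        also have "\<dots> < c0 * L"
        proof -
          have "b + L \<le> (b + 1) * L" using L(3) by simp
          then have "(b + L) * D \<le> (b + 1) * L * D" by (rule mult_right_mono) simp
          moreover have "c0 * L = 5 * L + (b + 1) * L * D" by (simp add: c0_def algebra_simps)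
          ultimately show ?thesis using L(3) by linarith
        qed
        finally show ?thesis .
      qed
      have Mp: "M \<le> M powr (\<xi> + \<sigma>)" using powr_mono[of 1 "\<xi> + \<sigma>" M] pn M1 by simp
      have M0: "0 \<le> M powr (\<xi> + \<sigma>)" by simp
      have "2 ^ em \<le> 16 * M powr (\<xi> + \<sigma>)" using Mp M0 unfolding M_def[symmetric] by linarith
      moreover have "2 ^ es \<le> 16 * M powr (\<xi> + \<sigma>)" "2 ^ ef \<le> 16 * M powr (\<xi> + \<sigma>)" "2 ^ ea \<le> 16 * M powr (\<xi> + \<sigma>)"
        using gp(2-4) Mp M0 by linarith+
      ultimately have eQ: "em < c0 * L" "es < c0 * L" "ef < c0 * L" "eE < c0 * L" "ea < c0 * L"
        using exps gp(5) by blast+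
      have "real (2 ^ em) < real F" using MF by (simp add: M_def)
      then have F1: "2 ^ em < F" using of_nat_less_iff by blast
      have "real (2 ^ es) = 2 ^ es" by simp
      then have "real (2 ^ es) < real F" using MF gp(2) by linarith
      then have F2: "2 ^ es < F" using of_nat_less_iff by blast
      show ?thesis
      proof (rule good_of_gadget[OF _ zs(2) eQ F1 F2 T])
        show "gadget k U (2 ^ em) (2 ^ es) (2 ^ ef) (2 ^ ea) (2 ^ eE) (set zs)" unfolding zs(3) by (rule gp(1))
        show "1 \<le> c" using c by simp
        fix \<kappa> T' xs
        assume \<kappa>: "\<kappa> < k" "T' \<le> T" and xs: "xs \<in> subset_sum_encodings (gadget.X k U (2 ^ em) (2 ^ es) (2 ^ ef) (2 ^ ea) (2 ^ eE) (set zs) \<kappa>,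
          gadget.target k U (2 ^ es) (2 ^ ef) (2 ^ eE) \<kappa> T')"
        have k': "\<kappa> \<le> k" "T' \<le> k * U" using \<kappa> T by linarith+
        let ?X = "gadget.X k U (2 ^ em) (2 ^ es) (2 ^ ef) (2 ^ ea) (2 ^ eE) Z \<kappa>"
        obtain n s where n: "exec (word_length c xs) p (init_state xs) n s" "real n \<le> C * real (card ?X) powr (e * (1 - \<epsilon>))"
          "accepting s \<longleftrightarrow> subset_sum_yes (?X, gadget.target k U (2 ^ es) (2 ^ ef) (2 ^ eE) \<kappa> T')"
          using solves[OF gp(6)[OF k'] xs[unfolded zs(3)]] by blast
        have "card ?X = 2 ^ em + 2 ^ es + \<kappa> * card Z" by (rule gadget.card_X[OF gp(1)])
        moreover have "(1::nat) \<le> 2 ^ em" by simp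
        ultimately have "1 \<le> card ?X" by linarith
        then have cX: "1 \<le> real (card ?X)" by simp
        have "real (card ?X) \<le> real (3 * 2 ^ em)" using gp(7)[OF k'(1)] of_nat_le_iff by blast
        then have cM: "real (card ?X) \<le> 3 * M" by (simp add: M_def)
        have "real (card ?X) powr (e * (1 - \<epsilon>)) \<le> real (card ?X) powr \<gamma>" using \<gamma>(3) cX by (rule powr_mono)
        also have "\<dots> \<le> (3 * M) powr \<gamma>" using cM cX \<gamma> by (intro powr_mono2) auto
        finally have "C * real (card ?X) powr (e * (1 - \<epsilon>)) \<le> C * (3 * M) powr \<gamma>" using C by (intro mult_left_mono) auto
        then have "real n \<le> real F" using n(2) CF by linarith
        then have "n \<le> F" by simp
        then show "\<exists>j s0. exec (word_length c xs) p (init_state xs) j s0 \<and> j \<le> F \<and> (accepting s0 \<longleftrightarrow>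
          subset_sum_yes (gadget.X k U (2 ^ em) (2 ^ es) (2 ^ ef) (2 ^ ea) (2 ^ eE) (set zs) \<kappa>,
          gadget.target k U (2 ^ es) (2 ^ ef) (2 ^ eE) \<kappa> T'))"
          unfolding zs(3) using n(1,3) by blast
      qed
    qed
    have prog: "\<exists>n s. exec (word_length (word_factor c k c0 K qa qb) xs) ?prog (init_state xs) n s \<and>
      n \<le> 200 + 12 * L + (c0 * L) ^ 5 * (k * length zs) * (AA * (3 * F + k * length zs + 1) + 4) \<and>
      (accepting s \<longleftrightarrow> ksum_yes k (set zs, T, U))"
      unfolding AA_def F_def
      by (rule ksum_program_correct[OF _ k1(1) _ q(1) less_imp_le[OF q(2)] _ zs(2) L _ refl])
        (use c good U(2) zs N in \<open>auto simp: c0_def F_def\<close>)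
    then obtain n s where n: "exec (word_length (word_factor c k c0 K qa qb) xs) ?prog (init_state xs) n s"
      "n \<le> 200 + 12 * L + (c0 * L) ^ 5 * (k * length zs) * (AA * (3 * F + k * length zs + 1) + 4)"
      "accepting s \<longleftrightarrow> ksum_yes k (Z, T, U)" unfolding zs(3) by blast
    have "real n \<le> real (200 + 12 * L + (c0 * L) ^ 5 * (k * length zs) * (AA * (3 * F + k * length zs + 1) + 4))"
      using n(2) of_nat_le_iff by blast
    also have "\<dots> \<le> Ct * real U powr (1 - (1 - q) / 2)"
      unfolding Ct_def
    proof (rule running_time_bound[OF L(1,3) U(1) _ Fup \<delta> _ _ cL_def])
      have "real U powr \<alpha> \<le> real U powr \<delta>" using \<alpha>(3) U(1) by (intro powr_mono) auto
      then show "real (length zs) \<le> real U powr \<delta>" using U(3) N by simp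
      show "0 \<le> q" using q01 by simp
      show "q + 3 * \<delta> \<le> 1 - (1 - q) / 2" using q01 by (simp add: \<delta>_def field_simps)
    qed
    finally show ?thesis using n(1,3) by blast
  qed
  have "solvable_in_time (ksum_instances \<alpha>) ksum_encodings (ksum_yes k) (\<lambda>(Z, T, U). real U powr (1 - (1 - q) / 2))"
    unfolding solvable_in_time_def
  proof (rule exI[of _ ?prog], rule exI[of _ "word_factor c k c0 K qa qb"], rule exI[of _ Ct], intro conjI ballI)
    show "0 < word_factor c k c0 K qa qb" by (simp add: word_factor_def)
    show "0 < Ct" by (rule Ct)
    fix i xs assume i: "i \<in> ksum_instances \<alpha>" "xs \<in> ksum_encodings i"
    obtain Z T U where iZ: "i = (Z, T, U)" by (cases i) auto
    show "\<exists>n s. exec (word_length (word_factor c k c0 K qa qb) xs) ?prog (init_state xs) n s \<and>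
      real n \<le> Ct * (case i of (Z, T, U) \<Rightarrow> real U powr (1 - (1 - q) / 2)) \<and> accepting s = ksum_yes k i"
      using main[OF i[unfolded iZ]] unfolding iZ by simp
  qed
  with hard show False by blast
qed


section \<open>Agreement of the two time bounds and the conclusion\<close>

lemma powr_ratio_bound:
  fixes x y D r :: real
  assumes "0 < x" "0 < y" "1 \<le> D" "y / D \<le> x" "x \<le> D * y"
  shows "x powr r \<le> D powr \<bar>r\<bar> * y powr r"
proof (cases "0 \<le> r")
  case True
  have "x powr r \<le> (D * y) powr r" using assms True by (intro powr_mono2) auto
  then show ?thesis using assms True by (simp add: powr_mult)
next
  \<comment> \<open>The exponent \<open>1 - \<epsilon>\<close> is negative for
    \<open>\<epsilon> > 1\<close>.\<close>
  case False
  have "0 < y / D" using assms by simp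
  then have "x powr r \<le> (y / D) powr r" using assms False by (intro powr_mono2') auto
  also have "\<dots> = y powr r * D powr \<bar>r\<bar>" using assms False by (simp add: powr_divide powr_minus_divide)
  finally show ?thesis by (simp add: mult.commute)
qed

text \<open>Three ratios between \<open>1 / \<rho>\<close> and \<open>\<rho>\<close> enter the
  quotient, hence \<open>\<rho> ^ 3\<close>; the powers of \<open>n\<close> that go with them
  combine to the exponent \<open>\<xi> + \<sigma> - \<tau> - 1\<close>.\<close>

lemma class_ratio:
  fixes \<rho> \<tau> \<xi> \<sigma> :: real
  assumes "(X, t) \<in> subset_sum_class \<rho> \<tau> \<xi> \<sigma>" "1 \<le> \<rho>"
  defines "n \<equiv> real (card X)" and "y \<equiv> real (Max X) * real (\<Sum>X) / (real (card X) * real t)"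
  shows "0 < n" "0 < y" "n powr (\<xi> + \<sigma> - \<tau> - 1) / \<rho> ^ 3 \<le> y" "y \<le> \<rho> ^ 3 * n powr (\<xi> + \<sigma> - \<tau> - 1)"
proof -
  define p q r where "p = real t / n powr \<tau>" and "q = real (Max X) / n powr \<xi>" and "r = real (\<Sum>X) / n powr \<sigma>"
  have pqr: "1 / \<rho> \<le> p" "p \<le> \<rho>" "1 / \<rho> \<le> q" "q \<le> \<rho>" "1 / \<rho> \<le> r" "r \<le> \<rho>"
    using assms(1) unfolding subset_sum_class_def p_def q_def r_def n_def by auto
  have r0: "0 < 1 / \<rho>" using assms(2) by simp
  have pos: "0 < p" "0 < q" "0 < r" using pqr r0 by linarith+
  show n: "0 < n"
  proof (rule ccontr)
    assume "\<not> 0 < n"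
    \<comment> \<open>A quotient by \<open>0 powr \<tau> = 0\<close> is 0, which lies below
      \<open>1 / \<rho>\<close>.\<close>
    then have "n = 0" by (simp add: n_def)
    then show False using pos(1) by (simp add: p_def)
  qed
  have eqs: "real t = p * n powr \<tau>" "real (Max X) = q * n powr \<xi>" "real (\<Sum>X) = r * n powr \<sigma>"
    using n by (simp_all add: p_def q_def r_def)
  have "y = (q * r / p) * (n powr \<xi> * n powr \<sigma> / (n powr 1 * n powr \<tau>))"
    unfolding y_def n_def[symmetric] eqs using n by (simp add: mult_ac)
  also have "n powr \<xi> * n powr \<sigma> / (n powr 1 * n powr \<tau>) = n powr (\<xi> + \<sigma> - \<tau> - 1)"
    unfolding powr_add[symmetric] powr_diff[symmetric] by (simp add: algebra_simps)
  finally have y: "y = (q * r / p) * n powr (\<xi> + \<sigma> - \<tau> - 1)" .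
  have up: "q * r / p \<le> \<rho> ^ 3"
  proof -
    have "q * r \<le> \<rho> * \<rho>" using pqr pos by (intro mult_mono) auto
    then have "q * r / p \<le> \<rho> * \<rho> / (1 / \<rho>)" using pqr pos r0 assms(2) by (intro frac_le) auto
    then show ?thesis by (simp add: power3_eq_cube)
  qed
  have low: "1 / \<rho> ^ 3 \<le> q * r / p"
  proof -
    have "1 / \<rho> * (1 / \<rho>) \<le> q * r" by (rule mult_mono[OF pqr(3,5)]) (use pos r0 in linarith)+
    moreover have "0 \<le> q * r" using pos(2,3) by simp
    ultimately have "1 / \<rho> * (1 / \<rho>) / \<rho> \<le> q * r / p" using pos(1) pqr(2) by (intro frac_le)
    then show ?thesis by (simp add: power3_eq_cube)
  qed
  show "0 < y" unfolding y using pos n by simp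
  show "y \<le> \<rho> ^ 3 * n powr (\<xi> + \<sigma> - \<tau> - 1)" unfolding y using up by (intro mult_right_mono) auto
  have "1 / \<rho> ^ 3 * n powr (\<xi> + \<sigma> - \<tau> - 1) \<le> y" unfolding y using low by (intro mult_right_mono) auto
  then show "n powr (\<xi> + \<sigma> - \<tau> - 1) / \<rho> ^ 3 \<le> y" by simp
qed

lemma solvable_in_time_mono:
  assumes "solvable_in_time I enc yes T" "0 < D" "\<And>i. i \<in> I \<Longrightarrow> T i \<le> D * T' i"
  shows "solvable_in_time I enc yes T'"
proof -
  obtain p c C where c: "0 < c" "0 < C" and s: "\<forall>i\<in>I. \<forall>xs\<in>enc i. \<exists>n s.
      exec (word_length c xs) p (init_state xs) n s \<and> real n \<le> C * T i \<and> (accepting s \<longleftrightarrow> yes i)"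
    using assms(1) unfolding solvable_in_time_def by (elim exE conjE)
  show ?thesis unfolding solvable_in_time_def
  proof (rule exI[of _ p], rule exI[of _ c], rule exI[of _ "C * D"], intro conjI ballI)
    fix i xs assume i: "i \<in> I" "xs \<in> enc i"
    obtain n s where n: "exec (word_length c xs) p (init_state xs) n s" "real n \<le> C * T i" "accepting s \<longleftrightarrow> yes i"
      using bspec[OF bspec[OF s i(1)] i(2)] by blast
    have "C * T i \<le> C * (D * T' i)" using assms(3)[OF i(1)] c by (intro mult_left_mono) auto
    then have "real n \<le> C * D * T' i" using n(2) by (simp add: mult.assoc)
    then show "\<exists>n s. exec (word_length c xs) p (init_state xs) n s \<and> real n \<le> C * D * T' i \<and> (accepting s \<longleftrightarrow> yes i)"
      using n by blast
  qed (use c assms(2) in auto)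
qed

theorem theorem5p10:
  fixes \<tau> \<xi> \<sigma> :: real
  assumes "intermediate_hypothesis"
    and "nontrivial_setting \<tau> \<xi> \<sigma>"
  shows "\<exists>\<rho>\<ge>1. \<forall>\<epsilon>>0.
    \<not> solvable_in_time (subset_sum_class \<rho> \<tau> \<xi> \<sigma>) subset_sum_encodings subset_sum_yes
        (\<lambda>(X, t). (real (Max X) * real (\<Sum>X) / (real (card X) * real t)) powr (1 - \<epsilon>)) \<and>
    \<not> solvable_in_time (subset_sum_class \<rho> \<tau> \<xi> \<sigma>) subset_sum_encodings subset_sum_yes
        (\<lambda>(X, t). real (card X) powr ((\<xi> + \<sigma> - \<tau> - 1) * (1 - \<epsilon>))) \<and>
    O[principal (subset_sum_class \<rho> \<tau> \<xi> \<sigma>)](\<lambda>(X, t).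
        (real (Max X) * real (\<Sum>X) / (real (card X) * real t)) powr (1 - \<epsilon>)) =
    O[principal (subset_sum_class \<rho> \<tau> \<xi> \<sigma>)](\<lambda>(X, t).
        real (card X) powr ((\<xi> + \<sigma> - \<tau> - 1) * (1 - \<epsilon>)))"
proof -
  define \<rho> where "\<rho> = 64 * 3 powr (\<tau> + \<xi> + \<sigma>)"
  define e where "e = \<xi> + \<sigma> - \<tau> - 1"
  have par: "2 \<le> \<sigma>" "1 \<le> \<xi>" "\<xi> \<le> \<tau>" "\<tau> \<le> \<sigma>"
    using assms(2) by (auto simp: nontrivial_setting_def)
  have "1 \<le> (3::real) powr (\<tau> + \<xi> + \<sigma>)" using par by (intro ge_one_powr_ge_zero) auto
  then have \<rho>: "1 \<le> \<rho>" by (simp add: \<rho>_def)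
  then have \<rho>3: "1 \<le> \<rho> ^ 3" by (rule one_le_power)
  let ?class = "subset_sum_class \<rho> \<tau> \<xi> \<sigma>"
  have e0: "0 \<le> e" using par by (simp add: e_def)
  show ?thesis
  proof (intro exI[of _ \<rho>] conjI allI impI)
    show "1 \<le> \<rho>" by (rule \<rho>)
    fix \<epsilon> :: real assume \<epsilon>: "0 < \<epsilon>"
    define f where "f = (\<lambda>(X, t :: nat). (real (Max X) * real (\<Sum>X) / (real (card X) * real t)) powr (1 - \<epsilon>))"
    define g where "g = (\<lambda>(X :: nat set, t :: nat). real (card X) powr ((\<xi> + \<sigma> - \<tau> - 1) * (1 - \<epsilon>)))"
    define D where "D = (\<rho> ^ 3) powr \<bar>1 - \<epsilon>\<bar>"
    have D: "0 < D" using \<rho> by (simp add: D_def)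
    have fg: "f i \<le> D * g i" "g i \<le> D * f i" if i: "i \<in> ?class" for i
    proof -
      obtain X t where Xt: "i = (X, t)" by (cases i) auto
      define n where "n = real (card X)"
      define y where "y = real (Max X) * real (\<Sum>X) / (real (card X) * real t)"
      note r = class_ratio[OF i[unfolded Xt] \<rho>, folded n_def y_def]
      have r3: "0 < \<rho> ^ 3" using \<rho>3 by linarith
      have ne: "0 < n powr (\<xi> + \<sigma> - \<tau> - 1)" using r(1) by simp
      have fi: "f i = y powr (1 - \<epsilon>)" by (simp add: f_def Xt y_def)
      have gi: "g i = (n powr (\<xi> + \<sigma> - \<tau> - 1)) powr (1 - \<epsilon>)" by (simp add: g_def Xt n_def powr_powr)
      show "f i \<le> D * g i" unfolding fi gi D_def by (rule powr_ratio_bound[OF r(2) ne \<rho>3 r(3,4)])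
      have "n powr (\<xi> + \<sigma> - \<tau> - 1) \<le> \<rho> ^ 3 * y" "y / \<rho> ^ 3 \<le> n powr (\<xi> + \<sigma> - \<tau> - 1)"
        using r(3,4) pos_divide_le_eq[OF r3] by (metis mult.commute)+
      then show "g i \<le> D * f i" unfolding fi gi D_def by (intro powr_ratio_bound[OF ne r(2) \<rho>3])
    qed
    have hard: "\<not> solvable_in_time ?class subset_sum_encodings subset_sum_yes g"
    proof (cases "1 < e")
      case True
      then show ?thesis using no_fast_algorithm[OF assms _ \<epsilon>] unfolding g_def \<rho>_def e_def by blast
    next
      case False
      \<comment> \<open>With \<open>e \<le> 1\<close> the time bound is sublinear in
        \<open>n\<close>, so the adversary argument applies, also for \<open>e = 0\<close>.\<close>
      have "e * (1 - \<epsilon>) < 1"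
      proof (cases "e = 0")
        case False
        then have "0 < e * \<epsilon>" using e0 \<epsilon> by simp
        then show ?thesis using \<open>\<not> 1 < e\<close> by (simp add: algebra_simps)
      qed simp
      then show ?thesis using no_sublinear_algorithm[OF assms(2)] unfolding g_def \<rho>_def e_def by blast
    qed
    have pos: "0 \<le> f i" "0 \<le> g i" for i by (auto simp: f_def g_def split: prod.split)
    show "\<not> solvable_in_time ?class subset_sum_encodings subset_sum_yes
      (\<lambda>(X, t). real (card X) powr ((\<xi> + \<sigma> - \<tau> - 1) * (1 - \<epsilon>)))"
      using hard unfolding g_def .
    show "\<not> solvable_in_time ?class subset_sum_encodings subset_sum_yes
      (\<lambda>(X, t). (real (Max X) * real (\<Sum>X) / (real (card X) * real t)) powr (1 - \<epsilon>))"
      unfolding f_def[symmetric]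
    proof
      assume "solvable_in_time ?class subset_sum_encodings subset_sum_yes f"
      then have "solvable_in_time ?class subset_sum_encodings subset_sum_yes g"
        using D fg(1) by (rule solvable_in_time_mono)
      then show False using hard by blast
    qed
    \<comment> \<open>Along \<open>principal ?class\<close>, the Landau symbols compare the bounds
      on all instances of the class with one constant.\<close>
    have "f \<in> \<Theta>[principal ?class](g)"
    proof (rule bigthetaI')
      show "0 < 1 / D" "0 < D" using D by simp_all
      show "eventually (\<lambda>i. 1 / D * norm (g i) \<le> norm (f i) \<and> norm (f i) \<le> D * norm (g i)) (principal ?class)"
        unfolding eventually_principal using fg pos D by (auto simp: field_simps)
    qed
    then have "O[principal ?class](f) = O[principal ?class](g)" by (rule landau_o.big.cong_bigtheta)
    then show "O[principal ?class](\<lambda>(X, t). (real (Max X) * real (\<Sum>X) / (real (card X) * real t)) powr (1 - \<epsilon>)) =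
      O[principal ?class](\<lambda>(X, t). real (card X) powr ((\<xi> + \<sigma> - \<tau> - 1) * (1 - \<epsilon>)))"
      unfolding f_def g_def .
  qed
qed

end
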